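(* Let $k$ be an algebraically closed field, let $n \ge 1$, and let $\Delta = \{\Delta_1, \ldots, \Delta_m\}$ be a collection of $m$ partitions whose sizes add up to $n$, such that $X(\Delta)$ is as defined below. Let $\Gamma = \Sigma\Delta$, let $\Gamma'$ be the transpose partition of $\Gamma$, written $d_1 \ge d_2 \ge \cdots$. Then: (1) the Zariski closure of $S(\Gamma')$ contains $X(\Delta)$; (2) the Zariski closure of $X(\Delta)$ contains $U(\Gamma)$; (3) if $A \in S(\Gamma') \cup X(\Delta) \cup U(\Gamma)$, then the centralizer $C(A)$ of $A$ in $M_n(k)$ satisfies $\dim C(A) = \sum_i d_i^2$; (4) for each $1 \le d < n$, the dimension of $\mathcal{G}_d^A$ is the same for all $A \in S(\Gamma') \cup X(\Delta) \cup U(\Gamma)$.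
   Context: For $A \in M_n(k)$ with $m$ distinct eigenvalues, $\Delta(A)$ is the collection of $m$ partitions $\Delta_i$, where $\Delta_i$ is the partition given by the sizes of the Jordan blocks of $A$ on its $i$-th generalized eigenspace. For a collection $\Delta$ of $m$ partitions with sizes summing to $n$, $X(\Delta) = \{A \in M_n(k) : \Delta(A) = \Delta\}$. $\Sigma\Delta = \sum_i \Delta_i$, where partitions are added as row vectors with nonincreasing entries (padding with zeros to equal length), i.e. componentwise. For a partition $\Gamma$ of $n$, $U(\Gamma)$ is the set of matrices in $M_n(k)$ with a single eigenvalue whose Jordan block sizes are given by $\Gamma$, and $S(\Gamma)$ is the set of semisimple matrices in $M_n(k)$ whose eigenspace dimensions are given by $\Gamma$. $\mathcal{G}_d$ is the Grassmannian of $d$-dimensional subspaces of $k^n$ and $\mathcal{G}_d^A = \{W \in \mathcal{G}_d : AW \subseteq W\}$. *)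

theory Defs
  imports "Jordan_Normal_Form.Jordan_Normal_Form_Uniqueness" "HOL-Library.Multiset"
    "HOL-Library.Extended_Nat"
begin

definition alg_closed :: "'k::field itself \<Rightarrow> bool" where
  "alg_closed _ \<longleftrightarrow> (\<forall>p :: 'k poly. degree p > 0 \<longrightarrow> (\<exists>x. poly p x = 0))"

definition is_partition :: "(nat \<Rightarrow> nat) \<Rightarrow> bool" where
  "is_partition p \<longleftrightarrow> (\<forall>i. p (Suc i) \<le> p i) \<and> finite {i. p i \<noteq> 0}"

definition psize :: "(nat \<Rightarrow> nat) \<Rightarrow> nat" where
  "psize p = (\<Sum>i | p i \<noteq> 0. p i)"

definition parts :: "(nat \<Rightarrow> nat) \<Rightarrow> nat multiset" where
  "parts p = image_mset p (mset_set {i. p i \<noteq> 0})"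

definition psum :: "(nat \<Rightarrow> nat) multiset \<Rightarrow> (nat \<Rightarrow> nat)" where
  "psum D = (\<lambda>i. sum_mset (image_mset (\<lambda>p. p i) D))"

definition conjugate :: "(nat \<Rightarrow> nat) \<Rightarrow> (nat \<Rightarrow> nat)" where
  "conjugate p = (\<lambda>j. card {i. j < p i})"

definition partition_of :: "nat multiset \<Rightarrow> (nat \<Rightarrow> nat)" where
  "partition_of M = (\<lambda>i. if i < size M then rev (sorted_list_of_multiset M) ! i else 0)"

definition jnf_eigs :: "(nat \<times> 'k) list \<Rightarrow> 'k set" where
  "jnf_eigs n_as = snd ` set n_as"

definition jnf_blocks :: "(nat \<times> 'k) list \<Rightarrow> 'k \<Rightarrow> nat multiset" where
  "jnf_blocks n_as a = mset (map fst (filter (\<lambda>x. snd x = a) n_as))"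

definition jordan_type :: "(nat \<times> 'k) list \<Rightarrow> (nat \<Rightarrow> nat) multiset" where
  "jordan_type n_as = image_mset (\<lambda>a. partition_of (jnf_blocks n_as a)) (mset_set (jnf_eigs n_as))"

definition X_set :: "nat \<Rightarrow> (nat \<Rightarrow> nat) multiset \<Rightarrow> 'k::field mat set" where
  "X_set n D = {A \<in> carrier_mat n n. \<exists>n_as. jordan_nf A n_as \<and> jordan_type n_as = D}"

definition U_set :: "nat \<Rightarrow> (nat \<Rightarrow> nat) \<Rightarrow> 'k::field mat set" where
  "U_set n G = {A \<in> carrier_mat n n. \<exists>n_as. jordan_nf A n_as \<and> card (jnf_eigs n_as) = 1
      \<and> jordan_type n_as = {#G#}}"

definition semisimple :: "'k::field mat \<Rightarrow> bool" where
  "semisimple A \<longleftrightarrow> (\<exists>D. diagonal_mat D \<and> similar_mat A D)"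

definition S_set :: "nat \<Rightarrow> (nat \<Rightarrow> nat) \<Rightarrow> 'k::field mat set" where
  "S_set n G = {A \<in> carrier_mat n n. semisimple A \<and>
     image_mset (\<lambda>a. kernel_dim (char_matrix A a)) (mset_set {a. eigenvalue A a}) = parts G}"

definition centralizer :: "'k::field mat \<Rightarrow> 'k mat set" where
  "centralizer A = {B \<in> carrier_mat (dim_row A) (dim_row A). A * B = B * A}"

definition lin_indep_mats :: "nat \<Rightarrow> nat \<Rightarrow> 'k::field mat set \<Rightarrow> bool" where
  "lin_indep_mats r c S \<longleftrightarrow> finite S \<and> S \<subseteq> carrier_mat r c \<and>
     (\<forall>co :: 'k mat \<Rightarrow> 'k. (\<forall>i<r. \<forall>j<c. (\<Sum>B\<in>S. co B * B $$ (i,j)) = 0) \<longrightarrow> (\<forall>B\<in>S. co B = 0))"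

definition mat_space_dim :: "nat \<Rightarrow> nat \<Rightarrow> 'k::field mat set \<Rightarrow> nat" where
  "mat_space_dim r c V = Sup {card S | S. S \<subseteq> V \<and> lin_indep_mats r c S}"

inductive_set poly_fun :: "nat \<Rightarrow> nat \<Rightarrow> ('k::comm_ring_1 mat \<Rightarrow> 'k) set" for r c where
  const: "(\<lambda>M. a) \<in> poly_fun r c"
| coord: "i < r \<Longrightarrow> j < c \<Longrightarrow> (\<lambda>M. M $$ (i,j)) \<in> poly_fun r c"
| add: "f \<in> poly_fun r c \<Longrightarrow> g \<in> poly_fun r c \<Longrightarrow> (\<lambda>M. f M + g M) \<in> poly_fun r c"
| mult: "f \<in> poly_fun r c \<Longrightarrow> g \<in> poly_fun r c \<Longrightarrow> (\<lambda>M. f M * g M) \<in> poly_fun r c"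

definition zariski_closed :: "nat \<Rightarrow> nat \<Rightarrow> 'k::comm_ring_1 mat set \<Rightarrow> bool" where
  "zariski_closed r c C \<longleftrightarrow> (\<exists>F \<subseteq> poly_fun r c. C = {M \<in> carrier_mat r c. \<forall>f\<in>F. f M = 0})"

definition zariski_closure :: "nat \<Rightarrow> nat \<Rightarrow> 'k::comm_ring_1 mat set \<Rightarrow> 'k mat set" where
  "zariski_closure r c S = \<Inter>{C. zariski_closed r c C \<and> S \<subseteq> C}"

definition stiefel :: "nat \<Rightarrow> nat \<Rightarrow> 'k::field mat set" where
  "stiefel n d = {M \<in> carrier_mat n d. \<forall>v \<in> carrier_vec d. M *\<^sub>v v = 0\<^sub>v n \<longrightarrow> v = 0\<^sub>v d}"

definition colspan :: "'k::field mat \<Rightarrow> 'k vec set" where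
  "colspan M = {M *\<^sub>v v | v. v \<in> carrier_vec (dim_col M)}"

definition grassmannian :: "nat \<Rightarrow> nat \<Rightarrow> 'k::field vec set set" where
  "grassmannian n d = colspan ` stiefel n d"

text \<open>Zariski-closed subsets of the Grassmannian: quotient topology of the map M \<mapsto> colspan M
  from the (Zariski) space of full-rank n x d matrices.\<close>
definition gr_closed :: "nat \<Rightarrow> nat \<Rightarrow> 'k::field vec set set \<Rightarrow> bool" where
  "gr_closed n d Z \<longleftrightarrow> Z \<subseteq> grassmannian n d \<and>
     (\<exists>C. zariski_closed n d C \<and> {M \<in> stiefel n d. colspan M \<in> Z} = stiefel n d \<inter> C)"

definition invariant_subspaces :: "'k::field mat \<Rightarrow> nat \<Rightarrow> 'k vec set set" where
  "invariant_subspaces A d = {W \<in> grassmannian (dim_row A) d. \<forall>w\<in>W. A *\<^sub>v w \<in> W}"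

definition subspace_closed :: "('a set \<Rightarrow> bool) \<Rightarrow> 'a set \<Rightarrow> 'a set \<Rightarrow> bool" where
  "subspace_closed cl Y Z \<longleftrightarrow> Z \<subseteq> Y \<and> (\<exists>C. cl C \<and> Z = Y \<inter> C)"

definition irreducible_closed :: "('a set \<Rightarrow> bool) \<Rightarrow> 'a set \<Rightarrow> bool" where
  "irreducible_closed cl Z \<longleftrightarrow> cl Z \<and> Z \<noteq> {} \<and>
     (\<forall>Z1 Z2. cl Z1 \<and> cl Z2 \<and> Z \<subseteq> Z1 \<union> Z2 \<longrightarrow> Z \<subseteq> Z1 \<or> Z \<subseteq> Z2)"

definition krull_dim :: "('a set \<Rightarrow> bool) \<Rightarrow> enat" where
  "krull_dim cl = Sup {enat l | l. \<exists>Z :: nat \<Rightarrow> 'a set.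
      (\<forall>i\<le>l. irreducible_closed cl (Z i)) \<and> (\<forall>i<l. Z i \<subset> Z (Suc i))}"

definition inv_grass_dim :: "'k::field mat \<Rightarrow> nat \<Rightarrow> enat" where
  "inv_grass_dim A d = krull_dim (subspace_closed (gr_closed (dim_row A) d) (invariant_subspaces A d))"

end

(* All three families consist of matrices whose kernel filtration dimensions
   c = dim ker (A - a)^(j+1) / ker (A - a)^j, collected over all eigenvalues a and all j, form the
   multiset of the parts of the transpose of Gamma. Everything in (3) and (4) depends on this
   multiset only.

   Closures: perturb the diagonal of a Jordan matrix linearly in t. A Jordan block with superdiagonal 1
   and perturbed diagonal is nonderogatory, so it has one Jordan block for each distinct diagonal entry.

   Dimension of the invariant Grassmannian: it equals the maximum of the sums of a(c - a) over all
   choices of 0 <= a <= c with total d. An invariant subspace splits over the eigenvalues and has an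
   echelon form whose pivot set P is closed under going down in the Jordan blocks; its module generators
   have exactly sum a(c - a) free coefficients, where a counts the pivots on a level. So the
   Grassmannian is a finite union of images of affine spaces of these dimensions. For the upper bound,
   a chain of irreducible closed sets produces one more algebraically independent function on the cone
   of n x d matrices in each step, starting with d^2 functions on a GL_d-orbit, and counting monomials
   bounds the number of such functions. For the lower bound, the closures of the images of
   coordinate subspaces form a chain, separated by d x d minors. Choices of a that are not decreasing
   along the levels of an eigenvalue do not contribute to the maximum, by an exchange argument. *)

theory Submission
  imports Defs "HOL-Library.Function_Algebras"
begin

section \<open>Polynomial functions and algebraic independence\<close>

text \<open>Transposition turns the componentwise sum of partitions into the union of the multisets
  of their parts. For one eigenvalue the dimensions \<open>c\<close> are the parts of the transpose
  of its partition, so collecting them over all eigenvalues gives the parts of the transpose of the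
  sum. This is why families with different numbers of eigenvalues share one multiset. A pivot set
  forces \<open>a\<close> to be nonincreasing along the levels of each eigenvalue, a condition that
  the multiset cannot express. The exchange argument is there to remove it, so that the maximum no
  longer sees which levels belong together. Dimension is given by chains in a quotient topology. It
  is therefore studied on frames, the full-rank n x d matrices, where closed sets are cut out by
  polynomials. In the upper bound this adds d^2 to both sides. The echelon strata never have to be
  compared with each other: the upper bound uses only that they cover, the lower bound uses each of
  them alone.\<close>

lemma alg_closed_infinite:
  assumes "alg_closed TYPE('k::field)"
  shows "infinite (UNIV :: 'k set)"
proof
  assume fin: "finite (UNIV :: 'k set)"
  define q :: "'k poly" where "q = (\<Prod>a\<in>UNIV. [:-a, 1:])"
  have q0: "q \<noteq> 0" unfolding q_def using fin by (simp add: prod_zero_iff)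
  have ev: "poly (q + 1) x = 1" for x
    unfolding q_def using fin by (simp add: poly_prod prod_zero_iff)
  have "degree (q + 1) > 0"
  proof (rule ccontr)
    assume "\<not> degree (q + 1) > 0"
    then obtain c where c: "q + 1 = [:c:]" using degree_eq_zeroE by blast
    with ev[of 0] have "c = 1" by simp
    with c have "q = 0" by (simp add: one_pCons)
    with q0 show False by simp
  qed
  then obtain x where "poly (q + 1) x = 0" using assms unfolding alg_closed_def by blast
  with ev[of x] show False by simp
qed

lemma poly_zero_of_infinite:
  fixes p :: "'k::field poly"
  assumes "infinite (UNIV :: 'k set)" "finite F" "\<And>s. s \<notin> F \<Longrightarrow> poly p s = 0"
  shows "p = 0"
proof (rule ccontr)
  assume "p \<noteq> 0"
  then have "finite {s. poly p s = 0}" by (rule poly_roots_finite)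
  moreover have "UNIV = F \<union> {s. poly p s = 0}" using assms(3) by auto
  ultimately show False using assms(1,2) by (metis finite_Un)
qed

lemma sum_fun_apply: "(\<Sum>a\<in>A. f a) x = (\<Sum>a\<in>A. f a x)"
  by (induct A rule: infinite_finite_induct) auto

text \<open>Polynomials in several variables are handled as functions, and their dimension counts
  take place in the space of all functions.\<close>

interpretation fs: vector_space "\<lambda>c (f :: 'a \<Rightarrow> 'k::field) x. c * f x"
  by unfold_locales (auto simp: algebra_simps fun_eq_iff)

text \<open>The Steinitz bound for indexed families: a repeated value already gives a relation with
  coefficients 1 and -1, and otherwise the image has more elements than a spanning set.\<close>

lemma linear_relation_exists:
  fixes g :: "'b \<Rightarrow> 'a \<Rightarrow> 'k::field"
  assumes "finite A" "\<And>a. a \<in> A \<Longrightarrow> g a \<in> fs.span B" "finite B" "card B < card A"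
  shows "\<exists>c. (\<exists>a\<in>A. c a \<noteq> 0) \<and> (\<forall>x. (\<Sum>a\<in>A. c a * g a x) = 0)"
proof (cases "inj_on g A")
  case True
  have "fs.dependent (g ` A)"
  proof (rule ccontr)
    assume "fs.independent (g ` A)"
    then have "card (g ` A) \<le> card B"
      using fs.independent_span_bound[of B "g ` A"] assms by auto
    with card_image[OF True] assms(4) show False by simp
  qed
  then obtain u where u: "\<exists>v\<in>g ` A. u v \<noteq> 0" "(\<Sum>v\<in>g ` A. (\<lambda>x. u v * v x)) = 0"
    unfolding fs.dependent_finite[OF finite_imageI[OF assms(1)]] by auto
  have "(\<Sum>a\<in>A. u (g a) * g a x) = 0" for x
  proof -
    have "(\<Sum>a\<in>A. u (g a) * g a x) = (\<Sum>v\<in>g ` A. u v * v x)"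
      using sum.reindex[OF True, of "\<lambda>v. u v * v x"] by simp
    also have "\<dots> = (\<Sum>v\<in>g ` A. (\<lambda>x. u v * v x)) x" by (simp add: sum_fun_apply)
    finally show ?thesis using u(2) by simp
  qed
  with u(1) show ?thesis by (intro exI[of _ "\<lambda>a. u (g a)"]) auto
next
  case False
  then obtain a b where ab: "a \<in> A" "b \<in> A" "a \<noteq> b" "g a = g b" by (auto simp: inj_on_def)
  let ?c = "\<lambda>x. if x = a then 1 else if x = b then - 1 else 0 :: 'k"
  have "(\<Sum>y\<in>A. ?c y * g y x) = 0" for x
  proof -
    have "(\<Sum>y\<in>A. ?c y * g y x) = (\<Sum>y\<in>{a, b}. ?c y * g y x)"
      by (rule sum.mono_neutral_right) (use ab assms(1) in auto)
    then show ?thesis using ab by simp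
  qed
  then show ?thesis using ab by (intro exI[of _ ?c]) auto
qed

lemma poly_fun_power: "f \<in> poly_fun r c \<Longrightarrow> (\<lambda>M. f M ^ k) \<in> poly_fun r c"
  by (induct k) (auto intro: poly_fun.intros)

lemma poly_fun_sum:
  assumes "\<And>a. a \<in> A \<Longrightarrow> f a \<in> poly_fun r c"
  shows "(\<lambda>M. \<Sum>a\<in>A. f a M) \<in> poly_fun r c"
  using assms by (induct A rule: infinite_finite_induct) (auto intro: poly_fun.intros)

lemma poly_fun_prod:
  assumes "\<And>a. a \<in> A \<Longrightarrow> f a \<in> poly_fun r c"
  shows "(\<lambda>M. \<Prod>a\<in>A. f a M) \<in> poly_fun r c"
  using assms by (induct A rule: infinite_finite_induct) (auto intro: poly_fun.intros)

lemma poly_fun_comp: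
  assumes f: "f \<in> poly_fun r c"
    and "\<And>i j. i < r \<Longrightarrow> j < c \<Longrightarrow> (\<lambda>M. \<phi> M $$ (i, j)) \<in> poly_fun r' c'"
  shows "(\<lambda>M. f (\<phi> M)) \<in> poly_fun r' c'"
  using f by induct (auto intro: poly_fun.intros assms(2))

lemma poly_fun_det:
  assumes "\<And>M. \<phi> M \<in> carrier_mat d d"
    and "\<And>i j. i < d \<Longrightarrow> j < d \<Longrightarrow> (\<lambda>M. \<phi> M $$ (i, j)) \<in> poly_fun r c"
  shows "(\<lambda>M. det (\<phi> M)) \<in> poly_fun r c"
proof -
  have "(\<lambda>M. \<Sum>p | p permutes {0..<d}. signof p * (\<Prod>i = 0..<d. \<phi> M $$ (i, p i))) \<in> poly_fun r c"
    by (intro poly_fun_sum poly_fun.mult poly_fun.const poly_fun_prod assms(2))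
       (auto simp: permutes_in_image)
  moreover have "(\<lambda>M. det (\<phi> M)) = (\<lambda>M. \<Sum>p | p permutes {0..<d}. signof p * (\<Prod>i = 0..<d. \<phi> M $$ (i, p i)))"
    by (rule ext) (rule det_def'[OF assms(1)])
  ultimately show ?thesis by (simp only:)
qed

text \<open>Density and irreducibility are always tested on lines, where a polynomial function
  becomes a univariate polynomial; over an infinite field that is zero as soon as it vanishes at all
  but finitely many parameters.\<close>

lemma poly_fun_line:
  fixes U V :: "'k::comm_ring_1 mat"
  assumes "f \<in> poly_fun r c" "U \<in> carrier_mat r c" "V \<in> carrier_mat r c"
  shows "\<exists>p. \<forall>s. f (U + s \<cdot>\<^sub>m V) = poly p s"
  using assms(1)
proof induct
  case (const a)
  show ?case by (rule exI[of _ "[:a:]"]) simp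
next
  case (coord i j)
  then show ?case using assms(2,3)
    by (intro exI[of _ "[:U $$ (i,j), V $$ (i,j):]"]) auto
next
  case (add f g)
  then show ?case by (metis poly_add)
next
  case (mult f g)
  then show ?case by (metis poly_mult)
qed

text \<open>Primeness of the vanishing ideal of \<open>V\<close>, without forming the ideal; for
  nonempty \<open>V\<close> this says that its Zariski closure is irreducible.\<close>

definition irreducible_set :: "nat \<Rightarrow> nat \<Rightarrow> 'k::comm_ring_1 mat set \<Rightarrow> bool" where
  "irreducible_set r c V \<longleftrightarrow> (\<forall>f\<in>poly_fun r c. \<forall>g\<in>poly_fun r c.
     (\<forall>M\<in>V. f M * g M = 0) \<longrightarrow> (\<forall>M\<in>V. f M = 0) \<or> (\<forall>M\<in>V. g M = 0))"

text \<open>A line through a point with \<open>f\<close> nonzero and a point with \<open>g\<close>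
  nonzero carries two nonzero univariate polynomials, and their product cannot vanish outside a
  finite set. Exceptions \<open>F\<close> are allowed because a line leaves the invertible matrices
  at finitely many parameters.\<close>

lemma irreducible_set_lines:
  fixes V :: "'k::field mat set"
  assumes inf: "infinite (UNIV :: 'k set)"
    and V: "\<And>M N. M \<in> V \<Longrightarrow> N \<in> V \<Longrightarrow> \<exists>U W F s t. U \<in> carrier_mat r c \<and> W \<in> carrier_mat r c \<and>
      finite F \<and> (\<forall>s. s \<notin> F \<longrightarrow> U + s \<cdot>\<^sub>m W \<in> V) \<and> M = U + s \<cdot>\<^sub>m W \<and> N = U + t \<cdot>\<^sub>m W"
  shows "irreducible_set r c V"
  unfolding irreducible_set_def
proof (intro ballI impI)
  fix f g :: "'k mat \<Rightarrow> 'k"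
  assume f: "f \<in> poly_fun r c" and g: "g \<in> poly_fun r c" and fg: "\<forall>M\<in>V. f M * g M = 0"
  show "(\<forall>M\<in>V. f M = 0) \<or> (\<forall>M\<in>V. g M = 0)"
  proof (rule ccontr)
    assume "\<not> ?thesis"
    then obtain M N where MN: "M \<in> V" "N \<in> V" "f M \<noteq> 0" "g N \<noteq> 0" by auto
    from V[OF MN(1,2)] obtain U W F s t where UW: "U \<in> carrier_mat r c" "W \<in> carrier_mat r c"
      "finite F" "\<And>s. s \<notin> F \<Longrightarrow> U + s \<cdot>\<^sub>m W \<in> V" "M = U + s \<cdot>\<^sub>m W" "N = U + t \<cdot>\<^sub>m W" by metis
    obtain p where p: "\<And>s. f (U + s \<cdot>\<^sub>m W) = poly p s" using poly_fun_line[OF f UW(1,2)] by blast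
    obtain q where q: "\<And>s. g (U + s \<cdot>\<^sub>m W) = poly q s" using poly_fun_line[OF g UW(1,2)] by blast
    have "p * q = 0"
    proof (rule poly_zero_of_infinite[OF inf UW(3)])
      fix s assume "s \<notin> F"
      from bspec[OF fg UW(4)[OF this]] show "poly (p * q) s = 0" by (simp add: p q)
    qed
    with MN UW p q show False by auto
  qed
qed

section \<open>Monomials and independence modulo a vanishing ideal\<close>

text \<open>A box of exponents rather than a bound on the total degree: the number of monomials is
  then exactly \<open>Suc T ^ m\<close>.\<close>

definition exps :: "nat \<Rightarrow> nat \<Rightarrow> nat list set" where
  "exps m T = {\<alpha>. set \<alpha> \<subseteq> {..T} \<and> length \<alpha> = m}"

definition monom_at :: "('a \<Rightarrow> 'k::comm_ring_1) list \<Rightarrow> nat list \<Rightarrow> 'a \<Rightarrow> 'k" where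
  "monom_at fs \<alpha> x = prod_list (map2 (\<lambda>f a. f x ^ a) fs \<alpha>)"

text \<open>Independence of the restrictions to \<open>V\<close>. On the empty set every relation
  holds, so there not even the empty list is independent.\<close>

definition alg_indep :: "'a set \<Rightarrow> ('a \<Rightarrow> 'k::comm_ring_1) list \<Rightarrow> bool" where
  "alg_indep V fs \<longleftrightarrow> (\<forall>T c. (\<forall>x\<in>V. (\<Sum>\<alpha>\<in>exps (length fs) T. c \<alpha> * monom_at fs \<alpha> x) = 0)
     \<longrightarrow> (\<forall>\<alpha>\<in>exps (length fs) T. c \<alpha> = 0))"

lemma finite_exps [simp]: "finite (exps m T)"
  unfolding exps_def by (rule finite_lists_length_eq) simp

lemma card_exps: "card (exps m T) = Suc T ^ m"
  unfolding exps_def by (subst card_lists_length_eq) auto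

lemma sum_exps_Suc:
  "(\<Sum>\<alpha>\<in>exps (Suc m) T. h \<alpha>) = (\<Sum>j\<le>T. \<Sum>\<alpha>\<in>exps m T. h (j # \<alpha>))"
proof -
  have "exps (Suc m) T = (\<lambda>(j, \<alpha>). j # \<alpha>) ` ({..T} \<times> exps m T)"
    unfolding exps_def by (force simp: length_Suc_conv image_iff)
  moreover have "inj_on (\<lambda>(j, \<alpha>). j # \<alpha>) ({..T} \<times> exps m T)" by (auto simp: inj_on_def)
  ultimately show ?thesis
    by (simp add: sum.reindex sum.cartesian_product case_prod_unfold o_def)
qed

lemma monom_at_simps [simp]:
  "monom_at [] \<alpha> x = 1" "monom_at (f # fs) (a # \<alpha>) x = f x ^ a * monom_at fs \<alpha> x"
  by (simp_all add: monom_at_def)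

lemma poly_fun_monom_at:
  "set fs \<subseteq> poly_fun r c \<Longrightarrow> (\<lambda>x. monom_at fs \<alpha> x) \<in> poly_fun r c"
proof (induct fs arbitrary: \<alpha>)
  case (Cons f fs)
  then show ?case
    by (cases \<alpha>) (auto intro!: poly_fun.intros poly_fun_power simp: monom_at_def[of _ "[]"])
qed (auto simp: monom_at_def[abs_def] intro: poly_fun.intros)

lemma alg_indep_Nil: "V \<noteq> {} \<Longrightarrow> alg_indep V []"
proof -
  have "exps 0 T = {[]}" for T by (auto simp: exps_def)
  then show "V \<noteq> {} \<Longrightarrow> alg_indep V []" unfolding alg_indep_def by auto
qed

text \<open>A relation of minimal order in \<^term>\<open>g\<close> on the larger set can be divided by a power of
  \<^term>\<open>g\<close>, and then restricts to a relation between the old functions on the smaller set.\<close>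

lemma alg_indep_Cons:
  fixes g :: "'k::field mat \<Rightarrow> 'k"
  assumes ind: "alg_indep V fs" and sub: "V \<subseteq> V'" and irr: "irreducible_set r c V'"
    and g: "g \<in> poly_fun r c" and fs: "set fs \<subseteq> poly_fun r c"
    and g0: "\<And>M. M \<in> V \<Longrightarrow> g M = 0" and M1: "M1 \<in> V'" "g M1 \<noteq> 0"
  shows "alg_indep V' (g # fs)"
  unfolding alg_indep_def
proof (intro allI impI)
  fix T :: nat and co :: "nat list \<Rightarrow> 'k"
  let ?m = "length fs"
  assume "\<forall>x\<in>V'. (\<Sum>\<alpha>\<in>exps (length (g # fs)) T. co \<alpha> * monom_at (g # fs) \<alpha> x) = 0"
  then have rel: "(\<Sum>j\<le>T. \<Sum>\<alpha>\<in>exps ?m T. co (j # \<alpha>) * (g x ^ j * monom_at fs \<alpha> x)) = 0"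
    if "x \<in> V'" for x using that by (simp add: sum_exps_Suc)
  show "\<forall>\<alpha>\<in>exps (length (g # fs)) T. co \<alpha> = 0"
  proof (rule ccontr)
    assume "\<not> ?thesis"
    then obtain \<beta> where \<beta>: "\<beta> \<in> exps (Suc ?m) T" "co \<beta> \<noteq> 0" by auto
    \<comment> \<open>The powers of \<open>g\<close> that occur in the relation; the least one is
      divided out.\<close>
    define P where "P j \<longleftrightarrow> (\<exists>\<alpha>\<in>exps ?m T. j \<le> T \<and> co (j # \<alpha>) \<noteq> 0)" for j
    have "\<exists>j. P j" using \<beta> unfolding P_def exps_def by (cases \<beta>) auto
    then have Pj: "P (Least P)" by (meson LeastI_ex)
    define j0 where "j0 = Least P"
    have j0T: "j0 \<le> T" using Pj unfolding j0_def[symmetric] P_def by blast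
    have least: "co (j # \<alpha>) = 0" if "j < j0" "\<alpha> \<in> exps ?m T" for j \<alpha>
    proof -
      have "j < Least P" using that(1) by (simp add: j0_def)
      then have "\<not> P j" by (rule not_less_Least)
      moreover have "j \<le> T" using j0T that(1) by linarith
      ultimately show ?thesis using that(2) unfolding P_def by blast
    qed
    define H where "H x = (\<Sum>j\<in>{j0..T}. \<Sum>\<alpha>\<in>exps ?m T. co (j # \<alpha>) * (g x ^ (j - j0) * monom_at fs \<alpha> x))" for x
    have H: "H \<in> poly_fun r c" unfolding H_def[abs_def]
      by (intro poly_fun_sum poly_fun.mult poly_fun.const poly_fun_power g poly_fun_monom_at fs)
    have "g x ^ j0 * H x = 0" if "x \<in> V'" for x
    proof -
      have "0 = (\<Sum>j\<le>T. \<Sum>\<alpha>\<in>exps ?m T. co (j # \<alpha>) * (g x ^ j * monom_at fs \<alpha> x))"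
        using rel[OF that] by simp
      also have "\<dots> = (\<Sum>j\<in>{j0..T}. \<Sum>\<alpha>\<in>exps ?m T. co (j # \<alpha>) * (g x ^ j * monom_at fs \<alpha> x))"
        by (rule sum.mono_neutral_right) (auto simp: least)
      also have "\<dots> = g x ^ j0 * H x" unfolding H_def sum_distrib_left
      proof (intro sum.cong refl)
      fix j \<alpha> assume "j \<in> {j0..T}"
      then have "g x ^ j = g x ^ j0 * g x ^ (j - j0)" by (simp flip: power_add)
      then show "co (j # \<alpha>) * (g x ^ j * monom_at fs \<alpha> x)
        = g x ^ j0 * (co (j # \<alpha>) * (g x ^ (j - j0) * monom_at fs \<alpha> x))" by (simp add: mult_ac)
    qed
      finally show ?thesis by simp
    qed
    \<comment> \<open>Irreducibility of \<open>V'\<close> cancels the factor \<open>g ^ j0\<close>,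
      which is nonzero at \<open>M1\<close>.\<close>
    then have "(\<forall>M\<in>V'. g M ^ j0 = 0) \<or> (\<forall>M\<in>V'. H M = 0)"
      by (intro irr[unfolded irreducible_set_def, rule_format, OF poly_fun_power[OF g, of j0] H])
    then have H0: "\<forall>M\<in>V'. H M = 0" using M1 power_not_zero[OF M1(2), of j0] by blast
    have "(\<Sum>\<alpha>\<in>exps ?m T. co (j0 # \<alpha>) * monom_at fs \<alpha> x) = 0" if x: "x \<in> V" for x
    proof -
      have "0 = H x" using H0 x sub by auto
      also have "\<dots> = (\<Sum>j\<in>{j0}. \<Sum>\<alpha>\<in>exps ?m T. co (j # \<alpha>) * (g x ^ (j - j0) * monom_at fs \<alpha> x))"
        unfolding H_def by (rule sum.mono_neutral_right) (use j0T g0[OF x] in auto)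
      finally show ?thesis by simp
    qed
    then have "\<forall>\<alpha>\<in>exps ?m T. co (j0 # \<alpha>) = 0"
      by (intro ballI ind[unfolded alg_indep_def, rule_format, where T = T and c = "\<lambda>\<alpha>. co (j0 # \<alpha>)"])
    with Pj show False unfolding P_def j0_def[symmetric] by blast
  qed
qed

section \<open>Polynomial maps on coordinate spaces and the count of monomials\<close>

definition monoms :: "'i set \<Rightarrow> nat \<Rightarrow> (('i \<Rightarrow> 'k::field) \<Rightarrow> 'k) set" where
  "monoms R B = (\<lambda>\<alpha> x. \<Prod>i\<in>R. x i ^ \<alpha> i) ` (R \<rightarrow>\<^sub>E {..B})"

lemma finite_monoms: "finite R \<Longrightarrow> finite (monoms R B)"
  unfolding monoms_def by (intro finite_imageI finite_PiE) auto

lemma card_monoms: "finite R \<Longrightarrow> card (monoms R B) \<le> Suc B ^ card R"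
  unfolding monoms_def
  by (rule order.trans[OF card_image_le]) (auto simp: card_PiE intro: finite_PiE)

lemma monomsI: "(\<And>i. i \<in> R \<Longrightarrow> \<alpha> i \<le> B) \<Longrightarrow> (\<lambda>x. \<Prod>i\<in>R. x i ^ \<alpha> i) \<in> monoms R B"
  unfolding monoms_def by (rule image_eqI[of _ _ "restrict \<alpha> R"]) auto

lemma monoms_mono: "B \<le> B' \<Longrightarrow> monoms R B \<subseteq> monoms R B'"
  unfolding monoms_def by (intro image_mono PiE_mono) auto

lemma span_monoms_mono: "B \<le> B' \<Longrightarrow> f \<in> fs.span (monoms R B) \<Longrightarrow> f \<in> fs.span (monoms R B')"
  using fs.span_mono[OF monoms_mono] by blast

lemma span_monoms_const: "(\<lambda>x. a) \<in> fs.span (monoms R B)"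
proof -
  have "(\<lambda>x. 1) \<in> monoms R B" using monomsI[of R "\<lambda>_. 0" B] by simp
  from fs.span_scale[OF fs.span_base[OF this], of a] show ?thesis by simp
qed

lemma span_monoms_var:
  fixes R :: "'a set"
  assumes "finite R" "i \<in> R"
  shows "(\<lambda>x :: 'a \<Rightarrow> 'b::field. x i) \<in> fs.span (monoms R 1)"
proof -
  have "(\<lambda>x. \<Prod>j\<in>R. x j ^ (if j = i then 1 else 0)) = (\<lambda>x :: 'a \<Rightarrow> 'b. x i)"
    using assms by (intro ext) (simp add: if_distrib[of "\<lambda>n. _ ^ n"] prod.delta cong: if_cong)
  moreover have "(\<lambda>x :: 'a \<Rightarrow> 'b. \<Prod>j\<in>R. x j ^ (if j = i then 1 else 0)) \<in> monoms R 1"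
    by (rule monomsI) auto
  ultimately have "(\<lambda>x :: 'a \<Rightarrow> 'b. x i) \<in> monoms R 1" by (simp only:)
  then show ?thesis by (rule fs.span_base)
qed

lemma span_monoms_add:
  assumes "f \<in> fs.span (monoms R B)" "g \<in> fs.span (monoms R B)"
  shows "(\<lambda>x. f x + g x) \<in> fs.span (monoms R B)"
  using fs.span_add[OF assms] by (simp add: plus_fun_def)

text \<open>Two monomials multiply to a monomial with added exponents; this extends linearly in the
  right factor first and then in the left one.\<close>

lemma span_monoms_mult:
  assumes f: "f \<in> fs.span (monoms R B)" and g: "g \<in> fs.span (monoms R C)"
  shows "(\<lambda>x. f x * g x) \<in> fs.span (monoms R (B + C))"
proof -
  let ?S = "fs.span (monoms R (B + C))"
  have base: "(\<lambda>x. h x * k x) \<in> ?S" if hk: "h \<in> monoms R B" "k \<in> monoms R C" for h k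
  proof -
    from hk obtain \<alpha> \<beta> where *: "\<alpha> \<in> R \<rightarrow>\<^sub>E {..B}" "\<beta> \<in> R \<rightarrow>\<^sub>E {..C}"
      "h = (\<lambda>x. \<Prod>i\<in>R. x i ^ \<alpha> i)" "k = (\<lambda>x. \<Prod>i\<in>R. x i ^ \<beta> i)" unfolding monoms_def by auto
    have "(\<lambda>x. \<Prod>i\<in>R. x i ^ (\<alpha> i + \<beta> i)) \<in> monoms R (B + C)"
      by (rule monomsI) (use * in \<open>auto intro!: add_mono\<close>)
    moreover have "(\<lambda>x. h x * k x) = (\<lambda>x. \<Prod>i\<in>R. x i ^ (\<alpha> i + \<beta> i))"
      by (simp add: * prod.distrib power_add)
    ultimately have "(\<lambda>x. h x * k x) \<in> monoms R (B + C)" by (simp only:)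
    then show ?thesis by (rule fs.span_base)
  qed
  have right: "(\<lambda>x. h x * g x) \<in> ?S" if h: "h \<in> monoms R B" for h
    using g
  proof (induct rule: fs.span_induct)
    case base
    show ?case
    proof (rule fs.subspaceI)
      show "0 \<in> {a. (\<lambda>x. h x * a x) \<in> ?S}" using fs.span_zero by (auto simp: zero_fun_def)
    next
      fix a b assume "a \<in> {a. (\<lambda>x. h x * a x) \<in> ?S}" "b \<in> {a. (\<lambda>x. h x * a x) \<in> ?S}"
      then show "a + b \<in> {a. (\<lambda>x. h x * a x) \<in> ?S}"
        using span_monoms_add[of "\<lambda>x. h x * a x" R "B + C" "\<lambda>x. h x * b x"] by (simp add: distrib_left)
    next
      fix c a assume "a \<in> {a. (\<lambda>x. h x * a x) \<in> ?S}"
      then show "(\<lambda>x. c * a x) \<in> {a. (\<lambda>x. h x * a x) \<in> ?S}"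
        using fs.span_scale[of "\<lambda>x. h x * a x" "monoms R (B + C)" c] by (simp add: mult.left_commute)
    qed
  next
    case (step k)
    then show ?case using base[OF h] by simp
  qed
  show ?thesis
    using f
  proof (induct rule: fs.span_induct)
    case base
    show ?case
    proof (rule fs.subspaceI)
      show "0 \<in> {a. (\<lambda>x. a x * g x) \<in> ?S}" using fs.span_zero by (auto simp: zero_fun_def)
    next
      fix a b assume "a \<in> {a. (\<lambda>x. a x * g x) \<in> ?S}" "b \<in> {a. (\<lambda>x. a x * g x) \<in> ?S}"
      then show "a + b \<in> {a. (\<lambda>x. a x * g x) \<in> ?S}"
        using span_monoms_add[of "\<lambda>x. a x * g x" R "B + C" "\<lambda>x. b x * g x"] by (simp add: distrib_right)
    next
      fix c a assume "a \<in> {a. (\<lambda>x. a x * g x) \<in> ?S}"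
      then show "(\<lambda>x. c * a x) \<in> {a. (\<lambda>x. a x * g x) \<in> ?S}"
        using fs.span_scale[of "\<lambda>x. a x * g x" "monoms R (B + C)" c] by (simp add: mult.assoc)
    qed
  next
    case (step k)
    then show ?case using right by simp
  qed
qed

text \<open>Polynomials in the variables \<open>R\<close>, filtered by a bound on each exponent;
  this bound is what is counted later.\<close>

definition poly_map :: "'i set \<Rightarrow> (('i \<Rightarrow> 'k::field) \<Rightarrow> 'k) set" where
  "poly_map R = (\<Union>B. fs.span (monoms R B))"

lemma poly_map_const: "(\<lambda>x. a) \<in> poly_map R"
  unfolding poly_map_def by (rule UN_I[OF UNIV_I]) (rule span_monoms_const)

lemma poly_map_var: "finite R \<Longrightarrow> i \<in> R \<Longrightarrow> (\<lambda>x. x i) \<in> poly_map R"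
  unfolding poly_map_def by (rule UN_I[OF UNIV_I]) (rule span_monoms_var)

lemma poly_map_add: "f \<in> poly_map R \<Longrightarrow> g \<in> poly_map R \<Longrightarrow> (\<lambda>x. f x + g x) \<in> poly_map R"
proof -
  assume "f \<in> poly_map R" "g \<in> poly_map R"
  then obtain B C where "f \<in> fs.span (monoms R B)" "g \<in> fs.span (monoms R C)"
    unfolding poly_map_def by auto
  then have "(\<lambda>x. f x + g x) \<in> fs.span (monoms R (max B C))"
    by (intro span_monoms_add span_monoms_mono[OF max.cobounded1] span_monoms_mono[OF max.cobounded2])
  then show ?thesis unfolding poly_map_def by (rule UN_I[OF UNIV_I])
qed
 
lemma poly_map_mult: "f \<in> poly_map R \<Longrightarrow> g \<in> poly_map R \<Longrightarrow> (\<lambda>x. f x * g x) \<in> poly_map R"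
proof -
  assume "f \<in> poly_map R" "g \<in> poly_map R"
  then obtain B C where "f \<in> fs.span (monoms R B)" "g \<in> fs.span (monoms R C)"
    unfolding poly_map_def by auto
  from span_monoms_mult[OF this] show ?thesis unfolding poly_map_def by (rule UN_I[OF UNIV_I])
qed

lemma poly_map_sum:
  assumes "\<And>a. a \<in> A \<Longrightarrow> f a \<in> poly_map R"
  shows "(\<lambda>x. \<Sum>a\<in>A. f a x) \<in> poly_map R"
  using assms by (induct A rule: infinite_finite_induct) (simp_all add: poly_map_const poly_map_add)

lemma poly_map_comp:
  assumes f: "f \<in> poly_fun r c"
    and "\<And>i j. i < r \<Longrightarrow> j < c \<Longrightarrow> (\<lambda>x. \<Phi> x $$ (i, j)) \<in> poly_map R"
  shows "(\<lambda>x. f (\<Phi> x)) \<in> poly_map R"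
  using f by induct (auto intro: poly_map_const poly_map_add poly_map_mult assms(2))

lemma span_monoms_power:
  assumes "f \<in> fs.span (monoms R B)"
  shows "(\<lambda>x. f x ^ k) \<in> fs.span (monoms R (k * B))"
proof (induct k)
  case (Suc k)
  from span_monoms_mult[OF assms Suc] show ?case by simp
qed (use span_monoms_const[of 1 R 0] in simp)

lemma span_monoms_monom_at:
  assumes "\<And>f. f \<in> set fs \<Longrightarrow> (\<lambda>x. f (\<Phi> x)) \<in> fs.span (monoms R B)" "set \<alpha> \<subseteq> {..T}"
    "length \<alpha> = length fs"
  shows "(\<lambda>x. monom_at fs \<alpha> (\<Phi> x)) \<in> fs.span (monoms R (length fs * (T * B)))"
  using assms
proof (induct fs arbitrary: \<alpha>)
  case Nil
  then show ?case using span_monoms_const[of 1 R 0] by simp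
next
  case (Cons f fs)
  then obtain a \<beta> where \<alpha>: "\<alpha> = a # \<beta>" by (cases \<alpha>) auto
  have "(\<lambda>x. f (\<Phi> x) ^ a) \<in> fs.span (monoms R (a * B))"
    by (rule span_monoms_power) (use Cons.prems(1) in auto)
  then have "(\<lambda>x. f (\<Phi> x) ^ a) \<in> fs.span (monoms R (T * B))"
    by (rule span_monoms_mono[rotated]) (use Cons.prems \<alpha> in auto)
  moreover have "(\<lambda>x. monom_at fs \<beta> (\<Phi> x)) \<in> fs.span (monoms R (length fs * (T * B)))"
    using Cons \<alpha> by auto
  ultimately have "(\<lambda>x. f (\<Phi> x) ^ a * monom_at fs \<beta> (\<Phi> x)) \<in> fs.span (monoms R (T * B + length fs * (T * B)))"
    by (rule span_monoms_mult)
  then show ?case by (simp add: \<alpha>)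
qed

text \<open>Extension by zero to a disjoint union. A set covered by several images is studied by
  pulling functions back to the disjoint union of the parameter spaces.\<close>

definition on_component :: "'s \<Rightarrow> ('x \<Rightarrow> 'k::zero) \<Rightarrow> 's \<times> 'x \<Rightarrow> 'k" where
  "on_component s m = (\<lambda>(s', x). if s' = s then m x else 0)"

lemma span_disjoint_union:
  fixes h :: "'s \<times> 'x \<Rightarrow> 'k::field"
  assumes S: "finite S" and h: "\<And>s. s \<in> S \<Longrightarrow> (\<lambda>x. h (s, x)) \<in> fs.span (Bs s)"
    and h0: "\<And>s x. s \<notin> S \<Longrightarrow> h (s, x) = 0"
  shows "h \<in> fs.span (\<Union>s\<in>S. on_component s ` Bs s)" (is "_ \<in> fs.span ?U")
proof -
  have lift: "on_component s m \<in> fs.span ?U" if s: "s \<in> S" and m: "m \<in> fs.span (Bs s)" for s m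
    using m
  proof (induct rule: fs.span_induct)
    case base
    show ?case
    proof (rule fs.subspaceI)
      have "on_component s (0 :: 'x \<Rightarrow> 'k) = 0" by (auto simp: fun_eq_iff on_component_def)
      then show "0 \<in> {m. on_component s m \<in> fs.span ?U}" unfolding mem_Collect_eq by (simp only: fs.span_zero)
    next
      fix a b assume "a \<in> {m. on_component s m \<in> fs.span ?U}" "b \<in> {m. on_component s m \<in> fs.span ?U}"
      moreover have "on_component s (a + b) = on_component s a + on_component s b" by (auto simp: fun_eq_iff on_component_def)
      ultimately show "a + b \<in> {m. on_component s m \<in> fs.span ?U}"
        unfolding mem_Collect_eq by (simp only: fs.span_add)
    next
      fix c a assume "a \<in> {m. on_component s m \<in> fs.span ?U}"
      moreover have "on_component s (\<lambda>x. c * a x) = (\<lambda>y. c * on_component s a y)" by (auto simp: fun_eq_iff on_component_def)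
      ultimately show "(\<lambda>x. c * a x) \<in> {m. on_component s m \<in> fs.span ?U}"
        unfolding mem_Collect_eq by (simp only: fs.span_scale)
    qed
  next
    case (step m)
    then show ?case using s by (auto intro!: fs.span_base)
  qed
  have "h = (\<Sum>s\<in>S. on_component s (\<lambda>x. h (s, x)))"
  proof
    fix y :: "'s \<times> 'x"
    obtain s' x where y: "y = (s', x)" by force
    show "h y = (\<Sum>s\<in>S. on_component s (\<lambda>x. h (s, x))) y"
      using S h0 unfolding y by (cases "s' \<in> S") (auto simp: sum_fun_apply on_component_def)
  qed
  also have "\<dots> \<in> fs.span ?U" by (intro fs.span_sum lift h)
  finally show ?thesis .
qed

text \<open>Monomials of degree at most \<^term>\<open>T\<close> in more than \<^term>\<open>E\<close> functions outnumber, for large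
  \<^term>\<open>T\<close>, the monomials in \<^term>\<open>E\<close> variables that can occur in them.\<close>

lemma alg_indep_image_bound:
  fixes \<Phi> :: "'s \<Rightarrow> ('i \<Rightarrow> 'k::field) \<Rightarrow> 'k mat"
  assumes S: "finite S" and R: "\<And>s. s \<in> S \<Longrightarrow> finite (R s) \<and> card (R s) \<le> E"
    and \<Phi>: "\<And>s i j. s \<in> S \<Longrightarrow> i < r \<Longrightarrow> j < c \<Longrightarrow> (\<lambda>x. \<Phi> s x $$ (i, j)) \<in> poly_map (R s)"
    and V: "\<And>M. M \<in> V \<Longrightarrow> \<exists>s\<in>S. \<exists>x. M = \<Phi> s x"
    and fs: "set fs \<subseteq> poly_fun r c" and ind: "alg_indep V fs"
  shows "length fs \<le> E"
proof (rule ccontr)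
  assume "\<not> length fs \<le> E"
  then have len: "Suc E \<le> length fs" by simp
  let ?m = "length fs"
  have "\<exists>B. \<forall>f\<in>set fs. (\<lambda>x. f (\<Phi> s x)) \<in> fs.span (monoms (R s) B)" if s: "s \<in> S" for s
  proof -
    have "\<forall>f\<in>set fs. \<exists>B. (\<lambda>x. f (\<Phi> s x)) \<in> fs.span (monoms (R s) B)"
    proof
      fix f assume "f \<in> set fs"
      then have "(\<lambda>x. f (\<Phi> s x)) \<in> poly_map (R s)"
        using poly_map_comp[of f r c "\<Phi> s" "R s"] \<Phi>[OF s] fs by blast
      then show "\<exists>B. (\<lambda>x. f (\<Phi> s x)) \<in> fs.span (monoms (R s) B)" unfolding poly_map_def by blast
    qed
    from bchoice[OF this] obtain B
      where B: "\<And>f. f \<in> set fs \<Longrightarrow> (\<lambda>x. f (\<Phi> s x)) \<in> fs.span (monoms (R s) (B f))" by blast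
    have "\<forall>f\<in>set fs. (\<lambda>x. f (\<Phi> s x)) \<in> fs.span (monoms (R s) (Max (B ` set fs)))"
    proof
      fix f assume f: "f \<in> set fs"
      show "(\<lambda>x. f (\<Phi> s x)) \<in> fs.span (monoms (R s) (Max (B ` set fs)))"
        by (rule span_monoms_mono[OF _ B[OF f]]) (use f in simp)
    qed
    then show ?thesis by blast
  qed
  then have "\<forall>s\<in>S. \<exists>B. \<forall>f\<in>set fs. (\<lambda>x. f (\<Phi> s x)) \<in> fs.span (monoms (R s) B)" by blast
  from bchoice[OF this] obtain Bs
    where Bs: "\<And>s f. s \<in> S \<Longrightarrow> f \<in> set fs \<Longrightarrow> (\<lambda>x. f (\<Phi> s x)) \<in> fs.span (monoms (R s) (Bs s))"
    by blast
  define B where "B = Max (insert 0 (Bs ` S))"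
  have B: "(\<lambda>x. f (\<Phi> s x)) \<in> fs.span (monoms (R s) B)" if "s \<in> S" "f \<in> set fs" for s f
    by (rule span_monoms_mono[OF _ Bs[OF that]]) (use S that in \<open>auto simp: B_def\<close>)
  \<comment> \<open>This constant absorbs the number of components and the growth factor of the
    exponents. The available monomials then number at most \<open>T * Suc T ^ E\<close>, which is
    less than \<open>Suc T ^ Suc E\<close>.\<close>
  define T where "T = card S * Suc (?m * B) ^ E"
  define N where "N = ?m * (T * B)"
  \<comment> \<open>The monomials in \<open>fs\<close>, pulled back to the disjoint union and 0 on
    the other indices. A relation between these functions is a relation on \<open>V\<close>.\<close>
  define g where "g \<alpha> y = (if fst y \<in> S then monom_at fs \<alpha> (\<Phi> (fst y) (snd y)) else 0)" for \<alpha> y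
  define CB :: "'s \<Rightarrow> ('s \<times> ('i \<Rightarrow> 'k) \<Rightarrow> 'k) set"
    where "CB s = on_component s ` monoms (R s) N" for s
  let ?U = "\<Union>s\<in>S. CB s"
  have g: "g \<alpha> \<in> fs.span ?U" if "\<alpha> \<in> exps ?m T" for \<alpha>
    unfolding CB_def
  proof (rule span_disjoint_union[OF S])
    fix s assume s: "s \<in> S"
    then have "(\<lambda>x. g \<alpha> (s, x)) = (\<lambda>x. monom_at fs \<alpha> (\<Phi> s x))" by (simp add: g_def)
    also have "\<dots> \<in> fs.span (monoms (R s) N)" unfolding N_def
      by (rule span_monoms_monom_at) (use that B[OF s] in \<open>auto simp: exps_def\<close>)
    finally show "(\<lambda>x. g \<alpha> (s, x)) \<in> fs.span (monoms (R s) N)" .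
  qed (simp add: g_def)
  have finU: "finite ?U" unfolding CB_def using S R finite_monoms by auto
  have "card ?U \<le> (\<Sum>s\<in>S. card (CB s))"
    by (rule card_UN_le[OF S])
  also have "\<dots> \<le> (\<Sum>s\<in>S. Suc N ^ E)"
  proof (rule sum_mono)
    fix s assume s: "s \<in> S"
    have "card (CB s) \<le> card (monoms (R s) N :: (('i \<Rightarrow> 'k) \<Rightarrow> 'k) set)"
      unfolding CB_def
      by (rule card_image_le) (rule finite_monoms, use R[OF s] in simp)
    also have "\<dots> \<le> Suc N ^ card (R s)" by (rule card_monoms) (use R[OF s] in simp)
    also have "\<dots> \<le> Suc N ^ E" by (rule power_increasing) (use R[OF s] in auto)
    finally show "card (CB s) \<le> Suc N ^ E" .
  qed
  also have "\<dots> = card S * Suc N ^ E" by simp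
  also have "\<dots> \<le> card S * (Suc (?m * B) * Suc T) ^ E"
  proof -
    have "Suc N \<le> Suc (?m * B) * Suc T" by (simp add: N_def algebra_simps)
    then show ?thesis by (intro mult_left_mono power_mono) simp_all
  qed
  also have "\<dots> = T * Suc T ^ E"
    unfolding power_mult_distrib mult.assoc[symmetric] T_def[symmetric] ..
  also have "\<dots> < Suc T ^ Suc E" by simp
  also have "\<dots> \<le> Suc T ^ ?m" by (rule power_increasing[OF len]) simp
  also have "\<dots> = card (exps ?m T)" by (simp add: card_exps)
  finally have "card ?U < card (exps ?m T)" .
  then have "\<exists>co. (\<exists>\<alpha>\<in>exps ?m T. co \<alpha> \<noteq> 0) \<and> (\<forall>y. (\<Sum>\<alpha>\<in>exps ?m T. co \<alpha> * g \<alpha> y) = 0)"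
    by (intro linear_relation_exists[where B = ?U] finite_exps g finU)
  then obtain co where
    co: "\<exists>\<alpha>\<in>exps ?m T. co \<alpha> \<noteq> 0" and rel: "\<forall>y. (\<Sum>\<alpha>\<in>exps ?m T. co \<alpha> * g \<alpha> y) = 0" by (elim exE conjE)
  have "(\<Sum>\<alpha>\<in>exps ?m T. co \<alpha> * monom_at fs \<alpha> M) = 0" if "M \<in> V" for M
  proof -
    from V[OF that] obtain s x where "s \<in> S" "M = \<Phi> s x" by blast
    then show ?thesis using rel[rule_format, of "(s, x)"] by (simp add: g_def)
  qed
  then have "\<forall>\<alpha>\<in>exps ?m T. co \<alpha> = 0"
    by (intro ballI ind[unfolded alg_indep_def, rule_format, where T = T and c = co])
  with co show False by simp
qed

section \<open>Grassmannians\<close>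

definition GL :: "nat \<Rightarrow> 'k::field mat set" where
  "GL d = {g \<in> carrier_mat d d. det g \<noteq> 0}"

lemma one_GL: "1\<^sub>m d \<in> GL d" by (simp add: GL_def)

lemma GL_carrier: "g \<in> GL d \<Longrightarrow> g \<in> carrier_mat d d" by (simp add: GL_def)

lemma GL_inverse:
  assumes "g \<in> GL d"
  obtains h where "h \<in> GL d" "g * h = 1\<^sub>m d" "h * g = 1\<^sub>m d"
proof -
  from assms have g: "g \<in> carrier_mat d d" "det g \<noteq> 0" by (auto simp: GL_def)
  from det_non_zero_imp_unit[OF g, of undefined] obtain h
    where h: "h \<in> carrier_mat d d" "g * h = 1\<^sub>m d" "h * g = 1\<^sub>m d"
    unfolding Units_def ring_mat_def by auto
  from det_mult[OF g(1) h(1)] h(2) have "det h \<noteq> 0" by auto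
  with h that show ?thesis by (auto simp: GL_def)
qed

lemma GL_of_inj:
  assumes "g \<in> carrier_mat d d" "\<And>v. v \<in> carrier_vec d \<Longrightarrow> g *\<^sub>v v = 0\<^sub>v d \<Longrightarrow> v = 0\<^sub>v d"
  shows "g \<in> GL d"
  using assms det_0_iff_vec_prod_zero_field[OF assms(1)] by (auto simp: GL_def)

lemma GL_inj:
  assumes "g \<in> GL d" "v \<in> carrier_vec d" "g *\<^sub>v v = 0\<^sub>v d"
  shows "v = 0\<^sub>v d"
  using assms det_0_iff_vec_prod_zero_field[OF GL_carrier[OF assms(1)]] by (auto simp: GL_def)

lemma mult_mat_unit_vec:
  fixes M :: "'k::field mat"
  assumes "M \<in> carrier_mat n d" "j < d"
  shows "M *\<^sub>v unit_vec d j = col M j"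
  using assms by (intro eq_vecI) (auto simp: scalar_prod_right_unit)

lemma stiefel_carrier: "M \<in> stiefel n d \<Longrightarrow> M \<in> carrier_mat n d" by (simp add: stiefel_def)

lemma stiefel_mult_GL:
  assumes M: "M \<in> stiefel n d" and g: "g \<in> GL d"
  shows "M * g \<in> stiefel n d" "colspan (M * g) = colspan M"
proof -
  from M have Mc: "M \<in> carrier_mat n d" by (rule stiefel_carrier)
  from g have gc: "g \<in> carrier_mat d d" by (rule GL_carrier)
  from g obtain h where h: "h \<in> GL d" "g * h = 1\<^sub>m d" by (rule GL_inverse)
  from h have hc: "h \<in> carrier_mat d d" by (auto dest: GL_carrier)
  show "M * g \<in> stiefel n d"
    using M Mc gc GL_inj[OF g] unfolding stiefel_def by (auto simp: assoc_mult_mat_vec[OF Mc gc])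
  show "colspan (M * g) = colspan M"
  proof (intro equalityI subsetI)
    fix w assume "w \<in> colspan (M * g)"
    then obtain v where v: "v \<in> carrier_vec d" "w = (M * g) *\<^sub>v v" using gc by (auto simp: colspan_def)
    then have "w = M *\<^sub>v (g *\<^sub>v v)" by (simp add: assoc_mult_mat_vec[OF Mc gc])
    then show "w \<in> colspan M" unfolding colspan_def using v gc Mc by auto
  next
    fix w assume "w \<in> colspan M"
    then obtain v where v: "v \<in> carrier_vec d" "w = M *\<^sub>v v" using Mc by (auto simp: colspan_def)
    have "w = M *\<^sub>v ((g * h) *\<^sub>v v)" using v h by simp
    also have "\<dots> = (M * g) *\<^sub>v (h *\<^sub>v v)"
      using v hc by (simp add: assoc_mult_mat_vec[OF gc hc] assoc_mult_mat_vec[OF Mc gc])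
    finally show "w \<in> colspan (M * g)" unfolding colspan_def using v hc gc by auto
  qed
qed

lemma col_in_colspan:
  fixes N :: "'k::field mat"
  assumes "N \<in> carrier_mat n d" "j < d"
  shows "col N j \<in> colspan N"
  using mult_mat_unit_vec[OF assms] assms
  unfolding colspan_def by (auto intro!: exI[of _ "unit_vec d j"])

text \<open>Containment suffices because both frames have \<open>d\<close> columns: the coordinates
  of the columns of \<open>N\<close> form a square matrix, which is injective since \<open>N\<close>
  is.\<close>

lemma colspan_colsD:
  fixes M :: "'k::field mat"
  assumes M: "M \<in> stiefel n d" and N: "N \<in> stiefel n d" and cols: "\<And>j. j < d \<Longrightarrow> col N j \<in> colspan M"
  obtains g where "g \<in> GL d" "N = M * g"
proof -
  from M N have Mc: "M \<in> carrier_mat n d" and Nc: "N \<in> carrier_mat n d"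
    by (auto dest: stiefel_carrier)
  have "\<exists>v. v \<in> carrier_vec d \<and> M *\<^sub>v v = col N j" if "j < d" for j
    using cols[OF that] Mc unfolding colspan_def by auto
  then obtain v where v: "\<And>j. j < d \<Longrightarrow> v j \<in> carrier_vec d" "\<And>j. j < d \<Longrightarrow> M *\<^sub>v v j = col N j" by metis
  define g where "g = mat d d (\<lambda>(i, j). v j $ i)"
  have gc: "g \<in> carrier_mat d d" by (simp add: g_def)
  have colg: "col g j = v j" if "j < d" for j
    using v(1)[OF that] that by (intro eq_vecI) (auto simp: g_def)
  have NMg: "N = M * g"
  proof (rule eq_matI)
    fix i j assume ij: "i < dim_row (M * g)" "j < dim_col (M * g)"
    then have "(M * g) $$ (i, j) = (M *\<^sub>v v j) $ i" using Mc gc colg by auto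
    also have "\<dots> = N $$ (i, j)" using v(2)[of j] ij Mc Nc gc by auto
    finally show "N $$ (i, j) = (M * g) $$ (i, j)" by simp
  qed (use Mc Nc gc in auto)
  have "g \<in> GL d"
  proof (rule GL_of_inj[OF gc])
    fix w assume w: "w \<in> carrier_vec d" "g *\<^sub>v w = 0\<^sub>v d"
    then have "N *\<^sub>v w = 0\<^sub>v n" unfolding NMg using Mc by (auto simp: assoc_mult_mat_vec[OF Mc gc] intro!: eq_vecI)
    with N w show "w = 0\<^sub>v d" by (simp add: stiefel_def)
  qed
  with NMg that show ?thesis by blast
qed

lemma colspan_eqD:
  assumes "M \<in> stiefel n d" "N \<in> stiefel n d" "colspan M = colspan N"
  obtains g where "g \<in> GL d" "N = M * g"
  using colspan_colsD[OF assms(1,2)] col_in_colspan[OF stiefel_carrier[OF assms(2)]] assms(3) by metis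

lemma poly_fun_mult_right:
  assumes f: "f \<in> poly_fun n d" and g: "g \<in> carrier_mat d d"
  shows "\<exists>f'\<in>poly_fun n d. \<forall>M\<in>carrier_mat n d. f' M = f (M * g)"
proof -
  define \<phi> where "\<phi> M = mat n d (\<lambda>(i, j). \<Sum>k<d. M $$ (i, k) * g $$ (k, j))" for M
  have "(\<lambda>M. f (\<phi> M)) \<in> poly_fun n d"
    by (rule poly_fun_comp[OF f]) (auto simp: \<phi>_def intro!: poly_fun_sum poly_fun.intros)
  moreover have "\<phi> M = M * g" if "M \<in> carrier_mat n d" for M
    using that g by (intro eq_matI) (auto simp: \<phi>_def scalar_prod_def lessThan_atLeast0)
  ultimately show ?thesis by (intro bexI[of _ "\<lambda>M. f (\<phi> M)"]) auto
qed

text \<open>The condition ranges over all frames of \<open>W\<close>, so its preimage among the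
  frames is the common zero set of all right translates of \<open>F\<close> under
  \<open>GL d\<close>. Hence arbitrary polynomials define closed sets of subspaces, not only those
  with an invariant zero set.\<close>

lemma gr_closed_zero_set:
  assumes F: "F \<subseteq> poly_fun n d"
  shows "gr_closed n d {W \<in> grassmannian n d. \<forall>f\<in>F. \<forall>M\<in>stiefel n d. colspan M = W \<longrightarrow> f M = 0}"
    (is "gr_closed n d ?Z")
proof -
  define F' where "F' = {f' \<in> poly_fun n d. \<exists>f\<in>F. \<exists>g\<in>GL d. \<forall>M\<in>carrier_mat n d. f' M = f (M * g)}"
  define C where "C = {M \<in> carrier_mat n d. \<forall>f\<in>F'. f M = 0}"
  have "zariski_closed n d C" unfolding zariski_closed_def C_def by (rule exI[of _ F']) (auto simp: F'_def)
  moreover have "M \<in> C \<longleftrightarrow> colspan M \<in> ?Z" if M: "M \<in> stiefel n d" for M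
  proof
    assume MC: "M \<in> C"
    show "colspan M \<in> ?Z"
    proof (intro CollectI conjI ballI impI)
      show "colspan M \<in> grassmannian n d" using M by (auto simp: grassmannian_def)
      fix f N assume f: "f \<in> F" and N: "N \<in> stiefel n d" "colspan N = colspan M"
      from colspan_eqD[OF M N(1) N(2)[symmetric]] obtain g where g: "g \<in> GL d" "N = M * g" .
      from poly_fun_mult_right[of f n d g] f F g obtain f'
        where f': "f' \<in> poly_fun n d" "\<forall>M\<in>carrier_mat n d. f' M = f (M * g)" by (auto dest: GL_carrier)
      then have "f' \<in> F'" using f g by (auto simp: F'_def)
      with MC have "f' M = 0" by (auto simp: C_def)
      with f'(2) stiefel_carrier[OF M] g show "f N = 0" by simp
    qed
  next
    assume "colspan M \<in> ?Z"
    then have Z: "f N = 0" if "f \<in> F" "N \<in> stiefel n d" "colspan N = colspan M" for f N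
      using that by auto
    have "f' M = 0" if "f' \<in> F'" for f'
    proof -
      from that obtain f g where "f \<in> F" "g \<in> GL d" "f' M = f (M * g)"
        using stiefel_carrier[OF M] by (auto simp: F'_def)
      then show ?thesis using Z[of f "M * g"] stiefel_mult_GL[OF M] by simp
    qed
    then show "M \<in> C" using stiefel_carrier[OF M] by (auto simp: C_def)
  qed
  ultimately show ?thesis unfolding gr_closed_def by (intro conjI exI[of _ C]) auto
qed

section \<open>Closed sets of subspaces and their cones of frames\<close>

abbreviation gr_sub_closed :: "nat \<Rightarrow> nat \<Rightarrow> 'k::field vec set set \<Rightarrow> 'k vec set set \<Rightarrow> bool" where
  "gr_sub_closed n d Y \<equiv> subspace_closed (gr_closed n d) Y"

definition zeros_in :: "nat \<Rightarrow> nat \<Rightarrow> 'k::field vec set set \<Rightarrow> ('k mat \<Rightarrow> 'k) set \<Rightarrow> 'k vec set set" where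
  "zeros_in n d Y F = {W \<in> Y. \<forall>f\<in>F. \<forall>M\<in>stiefel n d. colspan M = W \<longrightarrow> f M = 0}"

lemma zeros_in_closed:
  assumes "Y \<subseteq> grassmannian n d" "F \<subseteq> poly_fun n d"
  shows "gr_sub_closed n d Y (zeros_in n d Y F)"
  unfolding subspace_closed_def zeros_in_def
  using gr_closed_zero_set[OF assms(2)] assms(1)
  by (intro conjI exI[of _ "{W \<in> grassmannian n d. \<forall>f\<in>F. \<forall>M\<in>stiefel n d. colspan M = W \<longrightarrow> f M = 0}"]) auto

text \<open>The last conclusion needs one frame only: these polynomials come from the preimage of a
  closed set, which contains either all frames of a subspace or none.\<close>

lemma closed_zeros_in:
  assumes "gr_sub_closed n d Y Z" "Y \<subseteq> grassmannian n d"
  obtains F where "F \<subseteq> poly_fun n d" "Z = zeros_in n d Y F"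
    "\<And>M. M \<in> stiefel n d \<Longrightarrow> colspan M \<in> Y \<Longrightarrow> \<forall>f\<in>F. f M = 0 \<Longrightarrow> colspan M \<in> Z"
proof -
  from assms(1) obtain C0 where C0: "gr_closed n d C0" "Z = Y \<inter> C0" unfolding subspace_closed_def by auto
  from C0(1) obtain C where C: "zariski_closed n d C"
    "{M \<in> stiefel n d. colspan M \<in> C0} = stiefel n d \<inter> C" unfolding gr_closed_def by auto
  from C(1) obtain F where F: "F \<subseteq> poly_fun n d" "C = {M \<in> carrier_mat n d. \<forall>f\<in>F. f M = 0}"
    unfolding zariski_closed_def by auto
  have iff: "colspan M \<in> C0 \<longleftrightarrow> (\<forall>f\<in>F. f M = 0)" if "M \<in> stiefel n d" for M
    using C(2) that stiefel_carrier[OF that] unfolding F(2) by blast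
  have "Z = zeros_in n d Y F"
  proof (intro equalityI subsetI)
    fix W assume "W \<in> Z"
    then show "W \<in> zeros_in n d Y F" using iff C0(2) by (auto simp: zeros_in_def)
  next
    fix W assume W: "W \<in> zeros_in n d Y F"
    then obtain M where M: "M \<in> stiefel n d" "W = colspan M"
      using assms(2) by (auto simp: zeros_in_def grassmannian_def)
    with W iff[OF M(1)] C0(2) show "W \<in> Z" by (auto simp: zeros_in_def)
  qed
  with F(1) iff C0(2) that show ?thesis by blast
qed

text \<open>All frames of the members of \<open>Z\<close>. Each member contributes one
  \<open>GL d\<close>-orbit, which accounts for \<open>d * d\<close> extra dimensions.\<close>

definition cone :: "nat \<Rightarrow> nat \<Rightarrow> 'k::field vec set set \<Rightarrow> 'k mat set" where
  "cone n d Z = {M \<in> stiefel n d. colspan M \<in> Z}"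

lemma GL_line_finite:
  fixes g h :: "'k::field mat"
  assumes g: "g \<in> GL d" and h: "h \<in> carrier_mat d d"
  shows "finite {s. g + s \<cdot>\<^sub>m h \<notin> GL d}"
proof -
  \<comment> \<open>Rebuilding the matrix entrywise makes it d x d for every argument, as
    \<open>poly_fun_det\<close> demands.\<close>
  have "(\<lambda>M. det (mat d d (\<lambda>(i, j). M $$ (i, j)))) \<in> poly_fun d d"
    by (rule poly_fun_det) (auto intro: poly_fun.coord)
  from poly_fun_line[OF this GL_carrier[OF g] h] obtain p
    where p: "\<And>s. det (mat d d (\<lambda>(i, j). (g + s \<cdot>\<^sub>m h) $$ (i, j))) = poly p s" by blast
  have "mat d d (\<lambda>(i, j). (g + s \<cdot>\<^sub>m h) $$ (i, j)) = g + s \<cdot>\<^sub>m h" for s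
    using GL_carrier[OF g] h by (intro eq_matI) auto
  with p have p: "det (g + s \<cdot>\<^sub>m h) = poly p s" for s by simp
  have "g + 0 \<cdot>\<^sub>m h = g" using GL_carrier[OF g] h by (intro eq_matI) auto
  with p[of 0] g have "p \<noteq> 0" by (auto simp: GL_def)
  then have "finite {s. poly p s = 0}" by (rule poly_roots_finite)
  moreover have "{s. g + s \<cdot>\<^sub>m h \<notin> GL d} = {s. poly p s = 0}"
    using p h GL_carrier[OF g] by (auto simp: GL_def)
  ultimately show ?thesis by simp
qed

text \<open>In both uses \<open>G\<close> is the part of an affine subspace inside
  \<open>GL d\<close>. A line through one of its elements leaves \<open>GL d\<close> at finitely
  many parameters, and \<open>M * g\<close> is affine in \<open>g\<close>.\<close>

lemma orbit_irreducible:
  fixes M :: "'k::field mat"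
  assumes inf: "infinite (UNIV :: 'k set)" and M: "M \<in> carrier_mat n d"
    and G: "G \<subseteq> GL d" "\<And>g h s. g \<in> G \<Longrightarrow> h \<in> G \<Longrightarrow> g + s \<cdot>\<^sub>m (h - g) \<in> GL d \<Longrightarrow> g + s \<cdot>\<^sub>m (h - g) \<in> G"
  shows "irreducible_set n d ((\<lambda>g. M * g) ` G)"
proof (rule irreducible_set_lines[OF inf])
  fix A B assume "A \<in> (\<lambda>g. M * g) ` G" "B \<in> (\<lambda>g. M * g) ` G"
  then obtain g h where gh: "g \<in> G" "h \<in> G" "A = M * g" "B = M * h" by auto
  from gh G(1) have c: "g \<in> carrier_mat d d" "h \<in> carrier_mat d d" "g \<in> GL d" by (auto dest: GL_carrier)
  have D: "h - g \<in> carrier_mat d d" using c by auto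
  have lin: "M * (g + s \<cdot>\<^sub>m (h - g)) = M * g + s \<cdot>\<^sub>m (M * (h - g))" for s
  proof -
    have sD: "s \<cdot>\<^sub>m (h - g) \<in> carrier_mat d d" using D by simp
    show ?thesis using mult_add_distrib_mat[OF M c(1) sD] mult_smult_distrib[OF M D] by simp
  qed
  have 0: "g + 0 \<cdot>\<^sub>m (h - g) = g" "g + 1 \<cdot>\<^sub>m (h - g) = h" using c by (auto intro!: eq_matI)
  show "\<exists>U W F s t. U \<in> carrier_mat n d \<and> W \<in> carrier_mat n d \<and> finite F \<and>
    (\<forall>s. s \<notin> F \<longrightarrow> U + s \<cdot>\<^sub>m W \<in> (\<lambda>g. M * g) ` G) \<and> A = U + s \<cdot>\<^sub>m W \<and> B = U + t \<cdot>\<^sub>m W"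
  proof (intro exI conjI)
    show "finite {s. g + s \<cdot>\<^sub>m (h - g) \<notin> GL d}" by (rule GL_line_finite[OF c(3) D])
    show "\<forall>s. s \<notin> {s. g + s \<cdot>\<^sub>m (h - g) \<notin> GL d} \<longrightarrow> M * g + s \<cdot>\<^sub>m (M * (h - g)) \<in> (\<lambda>g. M * g) ` G"
      using G(2)[OF gh(1,2)] by (auto simp flip: lin)
    show "A = M * g + 0 \<cdot>\<^sub>m (M * (h - g))" "B = M * g + 1 \<cdot>\<^sub>m (M * (h - g))"
      unfolding lin[symmetric] 0 gh(3,4) by (rule refl)+
    show "M * g \<in> carrier_mat n d" "M * (h - g) \<in> carrier_mat n d" using M c(1) D by auto
  qed
qed

text \<open>If a product vanishes on the cone, then on each orbit one factor vanishes throughout,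
  since orbits are irreducible. So \<open>Z\<close> is covered by two closed sets: the subspaces
  with \<open>f\<close> zero on all frames, and those with \<open>g\<close> zero on all
  frames.\<close>

lemma cone_irreducible:
  fixes Z :: "'k::field vec set set"
  assumes inf: "infinite (UNIV :: 'k set)" and Y: "Y \<subseteq> grassmannian n d"
    and Z: "irreducible_closed (gr_sub_closed n d Y) Z"
  shows "irreducible_set n d (cone n d Z)"
  unfolding irreducible_set_def
proof (intro ballI impI)
  fix f g :: "'k mat \<Rightarrow> 'k"
  assume f: "f \<in> poly_fun n d" and g: "g \<in> poly_fun n d" and fg: "\<forall>M\<in>cone n d Z. f M * g M = 0"
  from Z have cl: "gr_sub_closed n d Y Z" by (simp add: irreducible_closed_def)
  from closed_zeros_in[OF cl Y] obtain F where F: "F \<subseteq> poly_fun n d" "Z = zeros_in n d Y F" by blast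
  let ?D = "\<lambda>f. zeros_in n d Y (insert f F)"
  have "Z \<subseteq> ?D f \<union> ?D g"
  proof (rule ccontr)
    assume "\<not> Z \<subseteq> ?D f \<union> ?D g"
    then obtain W where W: "W \<in> Z" "W \<notin> ?D f" "W \<notin> ?D g" by auto
    then obtain M N where M: "M \<in> stiefel n d" "colspan M = W" "f M \<noteq> 0"
      and N: "N \<in> stiefel n d" "colspan N = W" "g N \<noteq> 0" unfolding F(2) by (auto simp: zeros_in_def)
    from M N obtain h where h: "h \<in> GL d" "N = M * h" by (metis colspan_eqD)
    have "irreducible_set n d ((\<lambda>g. M * g) ` GL d)"
      by (rule orbit_irreducible[OF inf stiefel_carrier[OF M(1)]]) auto
    moreover have "f A * g A = 0" if "A \<in> (\<lambda>g. M * g) ` GL d" for A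
    proof -
      from that have "A \<in> cone n d Z" using stiefel_mult_GL[OF M(1)] M(2) W(1) by (auto simp: cone_def)
      with fg show ?thesis by blast
    qed
    ultimately have "(\<forall>A\<in>(\<lambda>g. M * g) ` GL d. f A = 0) \<or> (\<forall>A\<in>(\<lambda>g. M * g) ` GL d. g A = 0)"
      using f g unfolding irreducible_set_def by blast
    moreover have "M \<in> (\<lambda>g. M * g) ` GL d"
      using one_GL stiefel_carrier[OF M(1)] by (intro image_eqI[of _ _ "1\<^sub>m d"]) auto
    moreover have "N \<in> (\<lambda>g. M * g) ` GL d" using h by auto
    ultimately show False using M N by blast
  qed
  moreover have "gr_sub_closed n d Y (?D f)" "gr_sub_closed n d Y (?D g)"
    using F(1) f g by (auto intro!: zeros_in_closed[OF Y])
  ultimately have "Z \<subseteq> ?D f \<or> Z \<subseteq> ?D g" using Z unfolding irreducible_closed_def by blast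
  then show "(\<forall>M\<in>cone n d Z. f M = 0) \<or> (\<forall>M\<in>cone n d Z. g M = 0)"
    by (auto simp: cone_def zeros_in_def)
qed

lemma index_mult_mat_sum:
  assumes "A \<in> carrier_mat n m" "B \<in> carrier_mat m p" "i < n" "j < p"
  shows "(A * B) $$ (i, j) = (\<Sum>k<m. A $$ (i, k) * B $$ (k, j))"
  using assms by (simp add: scalar_prod_def lessThan_atLeast0)

lemma index_mult_mat_vec_sum:
  assumes "A \<in> carrier_mat n m" "v \<in> carrier_vec m" "i < n"
  shows "(A *\<^sub>v v) $ i = (\<Sum>k<m. A $$ (i, k) * v $ k)"
  using assms by (simp add: scalar_prod_def lessThan_atLeast0)

lemma poly_map_power: "f \<in> poly_map R \<Longrightarrow> (\<lambda>x. f x ^ k) \<in> poly_map R"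
  by (induct k) (simp_all add: poly_map_const poly_map_mult)

lemma poly_map_prod:
  assumes "\<And>a. a \<in> A \<Longrightarrow> f a \<in> poly_map R"
  shows "(\<lambda>x. \<Prod>a\<in>A. f a x) \<in> poly_map R"
  using assms by (induct A rule: infinite_finite_induct) (simp_all add: poly_map_const poly_map_mult)

lemma poly_map_reindex:
  fixes f :: "('a \<Rightarrow> 'k::field) \<Rightarrow> 'k"
  assumes f: "f \<in> poly_map R" and \<iota>: "finite R'" "\<iota> ` R \<subseteq> R'"
  shows "(\<lambda>y. f (\<lambda>i. y (\<iota> i))) \<in> poly_map R'"
proof -
  let ?S = "{f :: ('a \<Rightarrow> 'k) \<Rightarrow> 'k. (\<lambda>y. f (\<lambda>i. y (\<iota> i))) \<in> poly_map R'}"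
  from f obtain B where "f \<in> fs.span (monoms R B)" unfolding poly_map_def by auto
  then show ?thesis
  proof (induct rule: fs.span_induct)
    case base
    show ?case
    proof (rule fs.subspaceI)
      show "0 \<in> ?S"
        using poly_map_const[of 0 R'] by simp
    next
      fix f g assume "f \<in> ?S"
        "g \<in> ?S"
      then show "f + g \<in> ?S"
        by (simp add: poly_map_add)
    next
      fix c f assume "f \<in> ?S"
      then show "(\<lambda>x. c * f x) \<in> ?S"
        by (simp add: poly_map_mult poly_map_const)
    qed
  next
    case (step m)
    then obtain \<alpha> where "m = (\<lambda>x. \<Prod>i\<in>R. x i ^ \<alpha> i)" unfolding monoms_def by auto
    moreover have "(\<lambda>y. \<Prod>i\<in>R. y (\<iota> i) ^ \<alpha> i) \<in> poly_map R'"
      by (intro poly_map_prod poly_map_power poly_map_var) (use \<iota> in auto)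
    ultimately show ?case by simp
  qed
qed

lemma poly_fun_left_entry:
  assumes L: "L \<in> carrier_mat k n" and ab: "a < k" "b < d"
  shows "\<exists>f\<in>poly_fun n d. \<forall>M\<in>carrier_mat n d. f M = (L * M) $$ (a, b)"
proof (rule bexI)
  show "(\<lambda>M. \<Sum>i<n. L $$ (a, i) * M $$ (i, b)) \<in> poly_fun n d"
    by (intro poly_fun_sum poly_fun.intros) (use ab in auto)
  show "\<forall>M\<in>carrier_mat n d. (\<Sum>i<n. L $$ (a, i) * M $$ (i, b)) = (L * M) $$ (a, b)"
    using L ab by (auto simp: scalar_prod_def lessThan_atLeast0)
qed

lemma alg_indep_mono: "alg_indep V fs \<Longrightarrow> V \<subseteq> V' \<Longrightarrow> alg_indep V' fs"
  unfolding alg_indep_def by (meson subsetD)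

text \<open>An orbit carries \<open>d\<^sup>2\<close> algebraically independent functions: free the entries of the
  group element one after the other.\<close>

lemma orbit_alg_indep:
  fixes M L :: "'k::field mat"
  assumes inf: "infinite (UNIV :: 'k set)" and M: "M \<in> carrier_mat n d"
    and L: "L \<in> carrier_mat d n" "L * M = 1\<^sub>m d"
  shows "\<exists>fs. length fs = d * d \<and> set fs \<subseteq> poly_fun n d \<and> alg_indep ((\<lambda>g. M * g) ` GL d) fs"
proof -
  let ?p = "\<lambda>k. (k div d, k mod d)"
  \<comment> \<open>Entries are numbered row by row, and those from number \<open>i\<close> on are
    frozen at their values in the identity: \<open>G 0\<close> is the identity alone and
    \<open>G (d * d)\<close> is \<open>GL d\<close>.\<close>
  define G :: "nat \<Rightarrow> 'k mat set"
    where "G i = {g \<in> GL d. \<forall>k. i \<le> k \<longrightarrow> k < d * d \<longrightarrow> g $$ ?p k = 1\<^sub>m d $$ ?p k}" for i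
  have idx: "k div d < d" "k mod d < d" if "k < d * d" for k
  proof -
    from that have "d > 0" by (cases d) auto
    with that show "k div d < d" "k mod d < d" by (auto simp: less_mult_imp_div_less)
  qed
  \<comment> \<open>The left inverse \<open>L\<close> makes the entries of \<open>g\<close>
    polynomial functions of the frame \<open>M * g\<close>.\<close>
  have LM: "L * (M * g) = g" if "g \<in> GL d" for g
    using assoc_mult_mat[OF L(1) M GL_carrier[OF that]] L(2) GL_carrier[OF that] by simp
  have "\<exists>fs. length fs = i \<and> set fs \<subseteq> poly_fun n d \<and> alg_indep ((\<lambda>g. M * g) ` G i) fs" if "i \<le> d * d" for i
    using that
  proof (induct i)
    case 0
    have "1\<^sub>m d \<in> G 0" by (simp add: G_def one_GL)
    then show ?case by (intro exI[of _ "[]"]) (auto intro!: alg_indep_Nil)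
  next
    case (Suc i)
    then obtain fs where fs: "length fs = i" "set fs \<subseteq> poly_fun n d" "alg_indep ((\<lambda>g. M * g) ` G i) fs" by auto
    from Suc have i: "i < d * d" by simp
    from poly_fun_left_entry[OF L(1) idx[OF i]] obtain \<phi>
      where \<phi>: "\<phi> \<in> poly_fun n d" "\<And>N. N \<in> carrier_mat n d \<Longrightarrow> \<phi> N = (L * N) $$ ?p i" by blast
    define f where "f N = \<phi> N + (- (1\<^sub>m d $$ ?p i))" for N
    have f: "f \<in> poly_fun n d" unfolding f_def[abs_def] by (intro poly_fun.intros \<phi>)
    have fval: "f (M * g) = g $$ ?p i - 1\<^sub>m d $$ ?p i" if "g \<in> GL d" for g
      using \<phi>(2)[of "M * g"] LM[OF that] M GL_carrier[OF that] by (simp add: f_def)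
    define E :: "'k mat" where "E = mat d d (\<lambda>ab. if ab = ?p i then 1 else 0)"
    \<comment> \<open>A witness that the newly freed entry is not constant: perturb the identity
      there by a nonzero \<open>s\<close> that keeps it invertible.\<close>
    have "finite (insert 0 {s. 1\<^sub>m d + s \<cdot>\<^sub>m E \<notin> GL d})"
      using GL_line_finite[OF one_GL, of E d] by (simp add: E_def)
    then obtain s where s: "s \<noteq> 0" "1\<^sub>m d + s \<cdot>\<^sub>m E \<in> GL d"
      using inf ex_new_if_finite[of "insert 0 {s. 1\<^sub>m d + s \<cdot>\<^sub>m E \<notin> GL d}"] by auto
    have ne: "?p k \<noteq> ?p i" if "k \<noteq> i" for k
      using that by (metis Pair_inject div_mult_mod_eq)
    have gs: "1\<^sub>m d + s \<cdot>\<^sub>m E \<in> G (Suc i)"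
      unfolding G_def using s(2) ne idx by (auto simp: E_def)
    have "alg_indep ((\<lambda>g. M * g) ` G (Suc i)) (f # fs)"
    proof (rule alg_indep_Cons[OF fs(3) _ _ f fs(2)])
      show "(\<lambda>g. M * g) ` G i \<subseteq> (\<lambda>g. M * g) ` G (Suc i)" by (intro image_mono) (auto simp: G_def)
      show "irreducible_set n d ((\<lambda>g. M * g) ` G (Suc i))"
      proof (rule orbit_irreducible[OF inf M])
        show "G (Suc i) \<subseteq> GL d" by (auto simp: G_def)
        fix g h s assume gh: "g \<in> G (Suc i)" "h \<in> G (Suc i)" "g + s \<cdot>\<^sub>m (h - g) \<in> GL d"
        then have "g \<in> carrier_mat d d" "h \<in> carrier_mat d d" by (auto simp: G_def GL_def)
        with gh idx show "g + s \<cdot>\<^sub>m (h - g) \<in> G (Suc i)" by (auto simp: G_def)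
      qed
      show "f N = 0" if "N \<in> (\<lambda>g. M * g) ` G i" for N
        using that fval i by (auto simp: G_def)
      show "M * (1\<^sub>m d + s \<cdot>\<^sub>m E) \<in> (\<lambda>g. M * g) ` G (Suc i)" using gs by blast
      show "f (M * (1\<^sub>m d + s \<cdot>\<^sub>m E)) \<noteq> 0"
        unfolding fval[OF s(2)] using s(1) idx[OF i] by (auto simp: E_def)
    qed
    with fs f show ?case by (intro exI[of _ "f # fs"]) auto
  qed
  from this[of "d * d"] obtain fs where "length fs = d * d" "set fs \<subseteq> poly_fun n d"
    "alg_indep ((\<lambda>g. M * g) ` G (d * d)) fs" by auto
  moreover have "G (d * d) \<subseteq> GL d" by (auto simp: G_def)
  ultimately show ?thesis using alg_indep_mono[OF _ image_mono] by blast
qed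

lemma stiefel_if_left_GL:
  assumes M: "M \<in> carrier_mat n d" and L: "L \<in> carrier_mat d n" and LM: "L * M \<in> GL d"
  shows "M \<in> stiefel n d"
proof -
  have "v = 0\<^sub>v d" if v: "v \<in> carrier_vec d" "M *\<^sub>v v = 0\<^sub>v n" for v
  proof (rule GL_inj[OF LM v(1)])
    show "L * M *\<^sub>v v = 0\<^sub>v d" using M L v by (auto simp: assoc_mult_mat_vec[OF L M] intro!: eq_vecI)
  qed
  with M show ?thesis by (simp add: stiefel_def)
qed

section \<open>Bounds for the Krull dimension\<close>

text \<open>The source of the new independent function at each inclusion of a chain.\<close>

lemma closed_strict_function:
  assumes Y: "Y \<subseteq> grassmannian n d" and Z: "gr_sub_closed n d Y Z" and Z': "Z' \<subseteq> Y" "Z \<subset> Z'"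
  shows "\<exists>f M. f \<in> poly_fun n d \<and> (\<forall>N\<in>cone n d Z. f N = 0) \<and> M \<in> cone n d Z' \<and> f M \<noteq> 0"
proof -
  from closed_zeros_in[OF Z Y] obtain F where F: "F \<subseteq> poly_fun n d" "Z = zeros_in n d Y F" by blast
  from Z'(2) obtain W where W: "W \<in> Z'" "W \<notin> Z" by auto
  with Z' F obtain f M where fM: "f \<in> F" "M \<in> stiefel n d" "colspan M = W" "f M \<noteq> 0"
    by (auto simp: zeros_in_def)
  show ?thesis
    by (rule exI[of _ f], rule exI[of _ M]) (use fM F W in \<open>auto simp: cone_def zeros_in_def\<close>)
qed

lemma krull_dim_upper:
  fixes \<Phi> :: "'s \<Rightarrow> ('i \<Rightarrow> 'k::field) \<Rightarrow> 'k mat"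
  assumes inf: "infinite (UNIV :: 'k set)" and Y: "Y \<subseteq> grassmannian n d"
    and S: "finite S" and R: "\<And>s. s \<in> S \<Longrightarrow> finite (R s) \<and> card (R s) \<le> E"
    and \<Phi>c: "\<And>s x. s \<in> S \<Longrightarrow> \<Phi> s x \<in> carrier_mat n d"
    and \<Phi>: "\<And>s i j. s \<in> S \<Longrightarrow> i < n \<Longrightarrow> j < d \<Longrightarrow> (\<lambda>x. \<Phi> s x $$ (i, j)) \<in> poly_map (R s)"
    and cov: "\<And>W. W \<in> Y \<Longrightarrow> \<exists>s\<in>S. \<exists>x. \<exists>L\<in>carrier_mat d n. W = colspan (\<Phi> s x) \<and> L * \<Phi> s x \<in> GL d"
  shows "krull_dim (gr_sub_closed n d Y) \<le> enat E"
  unfolding krull_dim_def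
proof (rule Sup_least)
  fix e assume "e \<in> {enat l |l. \<exists>Z. (\<forall>i\<le>l. irreducible_closed (gr_sub_closed n d Y) (Z i)) \<and> (\<forall>i<l. Z i \<subset> Z (Suc i))}"
  then obtain l Z where e: "e = enat l" and irr: "\<And>i. i \<le> l \<Longrightarrow> irreducible_closed (gr_sub_closed n d Y) (Z i)"
    and strict: "\<And>i. i < l \<Longrightarrow> Z i \<subset> Z (Suc i)" by auto
  have ZY: "Z i \<subseteq> Y" if "i \<le> l" for i
    using irr[OF that] by (auto simp: irreducible_closed_def subspace_closed_def)
  from irr[of 0] obtain W0 where W0: "W0 \<in> Z 0" by (auto simp: irreducible_closed_def)
  from cov[of W0] W0 ZY[of 0] obtain s0 x0 L where M0: "s0 \<in> S" "L \<in> carrier_mat d n"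
    "W0 = colspan (\<Phi> s0 x0)" "L * \<Phi> s0 x0 \<in> GL d" by blast
  \<comment> \<open>The frame is normalised so that \<open>L\<close> becomes its left inverse, as
    the orbit argument requires.\<close>
  from M0(4) obtain h where h: "h \<in> GL d" "L * \<Phi> s0 x0 * h = 1\<^sub>m d" by (rule GL_inverse)
  define M1 where "M1 = \<Phi> s0 x0 * h"
  from stiefel_mult_GL[OF stiefel_if_left_GL[OF \<Phi>c[OF M0(1)] M0(2,4)] h(1)] M0(3)
  have M1: "M1 \<in> stiefel n d" "colspan M1 = W0" by (auto simp: M1_def)
  have "L * M1 = 1\<^sub>m d" unfolding M1_def
    using assoc_mult_mat[OF M0(2) \<Phi>c[OF M0(1)] GL_carrier[OF h(1)]] h(2) by simp
  from orbit_alg_indep[OF inf stiefel_carrier[OF M1(1)] M0(2) this] obtain fs0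
    where fs0: "length fs0 = d * d" "set fs0 \<subseteq> poly_fun n d" "alg_indep ((\<lambda>g. M1 * g) ` GL d) fs0" by blast
  have orb: "(\<lambda>g. M1 * g) ` GL d \<subseteq> cone n d (Z 0)"
    using stiefel_mult_GL[OF M1(1)] M1(2) W0 by (auto simp: cone_def)
  have "\<exists>fs. length fs = d * d + i \<and> set fs \<subseteq> poly_fun n d \<and> alg_indep (cone n d (Z i)) fs" if "i \<le> l" for i
    using that
  proof (induct i)
    case 0
    show ?case using fs0 alg_indep_mono[OF fs0(3) orb] by (intro exI[of _ fs0]) auto
  next
    case (Suc i)
    then obtain fs where fs: "length fs = d * d + i" "set fs \<subseteq> poly_fun n d" "alg_indep (cone n d (Z i)) fs" by auto
    have il: "i < l" "i \<le> l" using Suc by auto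
    have "gr_sub_closed n d Y (Z i)" using irr[OF il(2)] by (simp add: irreducible_closed_def)
    from closed_strict_function[OF Y this ZY[OF Suc(2)] strict[OF il(1)]] obtain f M
      where f: "f \<in> poly_fun n d" "\<forall>N\<in>cone n d (Z i). f N = 0" "M \<in> cone n d (Z (Suc i))" "f M \<noteq> 0"
      by blast
    have sub: "cone n d (Z i) \<subseteq> cone n d (Z (Suc i))" using strict[OF il(1)] by (auto simp: cone_def)
    have "alg_indep (cone n d (Z (Suc i))) (f # fs)"
      by (rule alg_indep_Cons[OF fs(3) sub cone_irreducible[OF inf Y irr[OF Suc(2)]] f(1) fs(2) bspec[OF f(2)] f(3,4)])
    with fs f show ?case by (intro exI[of _ "f # fs"]) auto
  qed
  from this[of l] obtain fs where fs: "length fs = d * d + l" "set fs \<subseteq> poly_fun n d"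
    "alg_indep (cone n d (Z l)) fs" by auto
  \<comment> \<open>The cone needs the entries of a group element as further parameters. These
    \<open>d * d\<close> parameters cancel against the \<open>d * d\<close> functions that the orbit
    supplies.\<close>
  define R' where "R' s = Inl ` R s \<union> Inr ` ({..<d} \<times> {..<d})" for s
  define \<Psi> :: "'s \<Rightarrow> ('i + nat \<times> nat \<Rightarrow> 'k) \<Rightarrow> 'k mat"
    where "\<Psi> s y = \<Phi> s (\<lambda>i. y (Inl i)) * mat d d (\<lambda>ij. y (Inr ij))" for s y
  have "d * d + l \<le> E + d * d"
    unfolding fs(1)[symmetric]
  proof (rule alg_indep_image_bound[OF S _ _ _ fs(2,3), where \<Phi> = \<Psi> and R = R'])
    fix s assume s: "s \<in> S"
    have "card (R' s) \<le> card (R s) + d * d"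
      unfolding R'_def
      by (rule order.trans[OF card_Un_le]) (auto simp: card_image inj_on_def card_cartesian_product)
    then show "finite (R' s) \<and> card (R' s) \<le> E + d * d" using R[OF s] by (auto simp: R'_def)
    fix i j assume ij: "i < n" "j < d"
    have fin: "finite (R' s)" using R[OF s] by (simp add: R'_def)
    have "(\<lambda>y. \<Psi> s y $$ (i, j)) = (\<lambda>y. \<Sum>k<d. \<Phi> s (\<lambda>i. y (Inl i)) $$ (i, k) * y (Inr (k, j)))"
      unfolding \<Psi>_def
      by (intro ext, subst index_mult_mat_sum[OF \<Phi>c[OF s] _ ij]) (auto simp: ij)
    also have "\<dots> \<in> poly_map (R' s)"
    proof (intro poly_map_sum poly_map_mult)
      fix k assume k: "k \<in> {..<d}"
      show "(\<lambda>y. \<Phi> s (\<lambda>i. y (Inl i)) $$ (i, k)) \<in> poly_map (R' s)"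
        by (rule poly_map_reindex[OF \<Phi>[OF s ij(1)] fin]) (use k in \<open>auto simp: R'_def\<close>)
      show "(\<lambda>y. y (Inr (k, j))) \<in> poly_map (R' s)"
        by (rule poly_map_var[OF fin]) (use k ij in \<open>auto simp: R'_def\<close>)
    qed
    finally show "(\<lambda>y. \<Psi> s y $$ (i, j)) \<in> poly_map (R' s)" .
  next
    fix M assume M: "M \<in> cone n d (Z l)"
    then have "colspan M \<in> Y" using ZY[of l] by (auto simp: cone_def)
    from cov[OF this] obtain s x L where s: "s \<in> S" "L \<in> carrier_mat d n"
      "colspan M = colspan (\<Phi> s x)" "L * \<Phi> s x \<in> GL d" by blast
    from M have "M \<in> stiefel n d" by (simp add: cone_def)
    from colspan_eqD[OF stiefel_if_left_GL[OF \<Phi>c[OF s(1)] s(2,4)] this s(3)[symmetric]] obtain g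
      where g: "g \<in> GL d" "M = \<Phi> s x * g" .
    have "mat d d (\<lambda>ij. g $$ ij) = g" using GL_carrier[OF g(1)] by (intro eq_matI) auto
    then have "M = \<Psi> s (case_sum x (\<lambda>ij. g $$ ij))" using g by (simp add: \<Psi>_def)
    with s(1) show "\<exists>s\<in>S. \<exists>x. M = \<Psi> s x" by blast
  qed
  then show "e \<le> enat E" by (simp add: e)
qed

lemma krull_dim_lower:
  fixes \<Phi> :: "('i \<Rightarrow> 'k::field) \<Rightarrow> 'k mat"
  assumes inf: "infinite (UNIV :: 'k set)" and Y: "Y \<subseteq> grassmannian n d" and R: "finite R"
    and \<Phi>: "\<And>x. \<Phi> x \<in> stiefel n d" "\<And>x. colspan (\<Phi> x) \<in> Y"
    and aff: "\<And>x y. \<exists>U\<in>carrier_mat n d. \<exists>W\<in>carrier_mat n d. \<forall>s. \<Phi> (\<lambda>i. x i + s * (y i - x i)) = U + s \<cdot>\<^sub>m W"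
    and f: "\<And>\<rho>. \<rho> \<in> R \<Longrightarrow> f \<rho> \<in> poly_fun n d"
    and f0: "\<And>\<rho> x g. \<rho> \<in> R \<Longrightarrow> x \<rho> = 0 \<Longrightarrow> g \<in> GL d \<Longrightarrow> f \<rho> (\<Phi> x * g) = 0"
    and f1: "\<And>\<rho>. \<rho> \<in> R \<Longrightarrow> f \<rho> (\<Phi> (\<lambda>i. if i = \<rho> then 1 else 0)) \<noteq> 0"
  shows "enat (card R) \<le> krull_dim (gr_sub_closed n d Y)"
proof -
  from finite_distinct_list[OF R] obtain rs where rs: "set rs = R" "distinct rs" by blast
  have len: "length rs = card R" using rs distinct_card by fastforce
  define T where "T i = {x :: 'i \<Rightarrow> 'k. \<forall>\<rho>. \<rho> \<notin> set (take i rs) \<longrightarrow> x \<rho> = 0}" for i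
  \<comment> \<open>The polynomials vanishing on all frames over the image of the coordinate
    subspace \<open>T i\<close>; their zero set \<open>Z i\<close> is the closure of that
    image.\<close>
  define F where "F i = {f \<in> poly_fun n d. \<forall>x\<in>T i. \<forall>g\<in>GL d. f (\<Phi> x * g) = 0}" for i
  define Z where "Z i = zeros_in n d Y (F i)" for i
  have F: "F i \<subseteq> poly_fun n d" for i by (auto simp: F_def)
  have Tmono: "T i \<subseteq> T j" if "i \<le> j" for i j using set_take_subset_set_take[OF that, of rs] by (auto simp: T_def)
  have \<Phi>Z: "colspan (\<Phi> x) \<in> Z i" if x: "x \<in> T i" for x i
    unfolding Z_def zeros_in_def
  proof (intro CollectI conjI ballI impI)
    fix f M assume fM: "f \<in> F i" "M \<in> stiefel n d" "colspan M = colspan (\<Phi> x)"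
    from colspan_eqD[OF \<Phi>(1) fM(2) fM(3)[symmetric]] obtain g where "g \<in> GL d" "M = \<Phi> x * g" .
    with fM x show "f M = 0" by (auto simp: F_def)
  qed (rule \<Phi>(2))
  have irr: "irreducible_closed (gr_sub_closed n d Y) (Z i)" for i
    unfolding irreducible_closed_def
  proof (intro conjI allI impI)
    show "gr_sub_closed n d Y (Z i)" unfolding Z_def by (rule zeros_in_closed[OF Y F])
    have "(\<lambda>_. 0) \<in> T i" by (simp add: T_def)
    from \<Phi>Z[OF this] show "Z i \<noteq> {}" by auto
    \<comment> \<open>Minimality of the closure: a closed set containing the image of
      \<open>T i\<close> contains \<open>Z i\<close>.\<close>
    have sub: "Z i \<subseteq> C" if C: "gr_sub_closed n d Y C" and im: "\<And>x. x \<in> T i \<Longrightarrow> colspan (\<Phi> x) \<in> C" for C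
    proof
      fix W assume W: "W \<in> Z i"
      from closed_zeros_in[OF C Y] obtain H where H: "H \<subseteq> poly_fun n d" "C = zeros_in n d Y H" by blast
      have "H \<subseteq> F i"
      proof
        fix h assume h: "h \<in> H"
        have "h (\<Phi> x * g) = 0" if "x \<in> T i" "g \<in> GL d" for x g
          using im[OF that(1)] stiefel_mult_GL[OF \<Phi>(1) that(2)] h unfolding H(2) by (auto simp: zeros_in_def)
        with h H(1) show "h \<in> F i" by (auto simp: F_def)
      qed
      with W show "W \<in> C" unfolding H(2) Z_def by (auto simp: zeros_in_def)
    qed
    fix Z1 Z2 assume Z12: "gr_sub_closed n d Y Z1 \<and> gr_sub_closed n d Y Z2 \<and> Z i \<subseteq> Z1 \<union> Z2"
    show "Z i \<subseteq> Z1 \<or> Z i \<subseteq> Z2"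
    proof (rule ccontr)
      assume "\<not> ?thesis"
      then obtain x y where x: "x \<in> T i" "colspan (\<Phi> x) \<notin> Z1" and y: "y \<in> T i" "colspan (\<Phi> y) \<notin> Z2"
        using sub Z12 by blast
      from Z12 have c1: "gr_sub_closed n d Y Z1" and c2: "gr_sub_closed n d Y Z2" by auto
      have sep: "\<exists>h\<in>poly_fun n d. h (\<Phi> x) \<noteq> 0 \<and> (\<forall>M\<in>cone n d C. h M = 0)"
        if C: "gr_sub_closed n d Y C" and x: "colspan (\<Phi> x) \<notin> C" for C x
      proof -
        from closed_zeros_in[OF C Y] obtain H where H: "H \<subseteq> poly_fun n d" "C = zeros_in n d Y H"
          "\<And>M. M \<in> stiefel n d \<Longrightarrow> colspan M \<in> Y \<Longrightarrow> \<forall>f\<in>H. f M = 0 \<Longrightarrow> colspan M \<in> C" by blast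
        from H(3)[OF \<Phi>[of x]] x obtain h where h: "h \<in> H" "h (\<Phi> x) \<noteq> 0" by blast
        moreover have "h M = 0" if "M \<in> cone n d C" for M
          using that h(1) unfolding H(2) by (auto simp: cone_def zeros_in_def)
        ultimately show ?thesis using H(1) by blast
      qed
      from sep[OF c1 x(2)] obtain h1
        where h1: "h1 \<in> poly_fun n d" "h1 (\<Phi> x) \<noteq> 0" "\<forall>M\<in>cone n d Z1. h1 M = 0" by blast
      from sep[OF c2 y(2)] obtain h2
        where h2: "h2 \<in> poly_fun n d" "h2 (\<Phi> y) \<noteq> 0" "\<forall>M\<in>cone n d Z2. h2 M = 0" by blast
      \<comment> \<open>The line through \<open>x\<close> and \<open>y\<close> stays in
        \<open>T i\<close>, and frames are affine along it. Both functions become univariate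
        polynomials with product 0, but one is nonzero at 0 and the other at 1.\<close>
      define z where "z s i = x i + s * (y i - x i)" for s i
      from aff[of x y] obtain U W where UW: "U \<in> carrier_mat n d" "W \<in> carrier_mat n d"
        "\<And>s. \<Phi> (z s) = U + s \<cdot>\<^sub>m W" unfolding z_def by blast
      obtain p where p: "\<And>s. h1 (\<Phi> (z s)) = poly p s" using poly_fun_line[OF h1(1) UW(1,2)] UW(3) by auto
      obtain q where q: "\<And>s. h2 (\<Phi> (z s)) = poly q s" using poly_fun_line[OF h2(1) UW(1,2)] UW(3) by auto
      have z01: "z 0 = x" "z 1 = y" by (auto simp: z_def)
      have "p * q = 0"
      proof (rule poly_zero_of_infinite[OF inf finite.emptyI])
        fix s
        have "z s \<in> T i" using x y by (auto simp: T_def z_def)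
        from \<Phi>Z[OF this] Z12 have "\<Phi> (z s) \<in> cone n d Z1 \<or> \<Phi> (z s) \<in> cone n d Z2"
          using \<Phi>(1) by (auto simp: cone_def)
        then have "h1 (\<Phi> (z s)) = 0 \<or> h2 (\<Phi> (z s)) = 0" using h1(3) h2(3) by blast
        then show "poly (p * q) s = 0" by (simp add: p q)
      qed
      with p[of 0] q[of 1] h1 h2 z01 show False by auto
    qed
  qed
  have strict: "Z i \<subset> Z (Suc i)" if i: "i < card R" for i
  proof
    show "Z i \<subseteq> Z (Suc i)" using Tmono[of i "Suc i"] by (auto simp: Z_def zeros_in_def F_def)
    let ?\<rho> = "rs ! i"
    have \<rho>: "?\<rho> \<in> R" "?\<rho> \<notin> set (take i rs)" "?\<rho> \<in> set (take (Suc i) rs)"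
    proof -
      show "?\<rho> \<in> R" using rs len i by auto
      show "?\<rho> \<notin> set (take i rs)" using rs(2) len i by (auto simp: in_set_conv_nth nth_eq_iff_index_eq)
      show "?\<rho> \<in> set (take (Suc i) rs)" using len i by (auto simp: take_Suc_conv_app_nth)
    qed
    let ?x = "\<lambda>j. if j = ?\<rho> then 1 else 0 :: 'k"
    have "f ?\<rho> \<in> F i" using f[OF \<rho>(1)] f0[OF \<rho>(1)] \<rho>(2) by (auto simp: F_def T_def)
    with f1[OF \<rho>(1)] \<Phi>(1)[of ?x] have "colspan (\<Phi> ?x) \<notin> Z i" by (auto simp: Z_def zeros_in_def)
    moreover have "colspan (\<Phi> ?x) \<in> Z (Suc i)" by (rule \<Phi>Z) (use \<rho>(3) in \<open>auto simp: T_def\<close>)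
    ultimately show "Z i \<noteq> Z (Suc i)" by blast
  qed
  show ?thesis unfolding krull_dim_def by (rule Sup_upper) (use irr strict in auto)
qed

section \<open>Invariant subspaces of Jordan matrices\<close>

text \<open>A Jordan matrix is encoded by its basis positions: position \<open>k\<close> belongs to a block with eigenvalue
  \<^term>\<open>ev k\<close> and is the \<^term>\<open>lev k\<close>-th vector (counted from 0) of that block, so that blocks are
  maximal intervals on which \<^term>\<open>lev\<close> increases by one.\<close>

locale jordan_shape =
  fixes n :: nat and ev :: "nat \<Rightarrow> 'k::field" and lev :: "nat \<Rightarrow> nat"
  assumes pred: "\<And>k. k < n \<Longrightarrow> lev k > 0 \<Longrightarrow> k > 0 \<and> ev (k - 1) = ev k \<and> lev k = Suc (lev (k - 1))"
begin

definition jmat :: "'k mat" where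
  "jmat = mat n n (\<lambda>(i, k). if i = k then ev k else if Suc i = k \<and> lev k > 0 then 1 else 0)"

lemma jmat_carrier [simp]: "jmat \<in> carrier_mat n n" by (simp add: jmat_def)

lemma down:
  assumes "k < n" "t \<le> lev k"
  shows "t \<le> k \<and> ev (k - t) = ev k \<and> lev (k - t) = lev k - t"
  using assms(2)
proof (induct t)
  case (Suc t)
  then have IH: "t \<le> k" "ev (k - t) = ev k" "lev (k - t) = lev k - t" by auto
  have "k - t < n" "lev (k - t) > 0" using assms(1) IH Suc(2) by auto
  from pred[OF this] IH Suc(2) show ?case by auto
qed simp

lemma up_lev:
  assumes "i + t < n" "t \<le> lev (i + t)"
  shows "ev (i + t) = ev i" "lev (i + t) = lev i + t"
  using down[OF assms] assms by auto

lemma up_trans: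
  assumes "i + t < n" "t \<le> lev (i + t)" "s \<le> t"
  shows "i + s < n" "s \<le> lev (i + s)" "t - s \<le> lev (i + t)"
proof -
  have "lev (i + t - (t - s)) = lev (i + t) - (t - s)" using down[OF assms(1), of "t - s"] assms by auto
  moreover have "i + t - (t - s) = i + s" using assms by auto
  ultimately show "i + s < n" "s \<le> lev (i + s)" "t - s \<le> lev (i + t)" using assms by auto
qed

text \<open>The \<open>t\<close>-th power of the nilpotent part. The condition
  \<open>t \<le> lev (i + t)\<close> says that \<open>i\<close> and \<open>i + t\<close> lie in the
  same block.\<close>

definition shift :: "nat \<Rightarrow> (nat \<Rightarrow> 'k) \<Rightarrow> nat \<Rightarrow> 'k" where
  "shift t f i = (if i + t < n \<and> t \<le> lev (i + t) then f (i + t) else 0)"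

text \<open>The action of \<open>jmat\<close> on coordinate functions supported below
  \<open>n\<close>, which replace vectors throughout the echelon argument.\<close>

definition jop :: "(nat \<Rightarrow> 'k) \<Rightarrow> nat \<Rightarrow> 'k" where
  "jop f i = (if i < n then ev i * f i + (if Suc i < n \<and> lev (Suc i) > 0 then f (Suc i) else 0) else 0)"

end

section \<open>Subspaces with a prescribed pivot set\<close>

locale shift_closed = jordan_shape n ev lev
  for n :: nat and ev :: "nat \<Rightarrow> 'k::field" and lev :: "nat \<Rightarrow> nat" +
  fixes P :: "nat set"
  assumes PN: "P \<subseteq> {..<n}" and Pdown: "\<And>k. k \<in> P \<Longrightarrow> lev k > 0 \<Longrightarrow> k - 1 \<in> P"
begin

lemma finP [simp]: "finite P" using PN finite_subset by blast

lemma P_less: "p \<in> P \<Longrightarrow> p < n" using PN by auto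

lemma Pdown': "k \<in> P \<Longrightarrow> t \<le> lev k \<Longrightarrow> k - t \<in> P"
proof (induct t)
  case (Suc t)
  then have "k - t \<in> P" "lev (k - t) = lev k - t" using down[OF P_less[OF Suc(2)], of t] by auto
  with Suc Pdown[of "k - t"] show ?case by auto
qed simp

text \<open>The number of steps from \<open>p\<close> up to the topmost element of \<open>P\<close>
  in its block; that element is \<open>tip p\<close>.\<close>

definition height :: "nat \<Rightarrow> nat" where
  "height p = Max {t. p + t \<in> P \<and> t \<le> lev (p + t)}"

definition tip :: "nat \<Rightarrow> nat" where "tip p = p + height p"

lemma height:
  assumes p: "p \<in> P"
  shows "tip p \<in> P" "height p \<le> lev (tip p)" "\<And>t. p + t \<in> P \<Longrightarrow> t \<le> lev (p + t) \<Longrightarrow> t \<le> height p"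
proof -
  let ?S = "{t. p + t \<in> P \<and> t \<le> lev (p + t)}"
  have fin: "finite ?S" by (rule finite_subset[of _ "{..n}"]) (auto dest: P_less)
  moreover have "0 \<in> ?S" using p by simp
  ultimately have "Max ?S \<in> ?S" by (metis Max_in empty_iff)
  then show "tip p \<in> P" "height p \<le> lev (tip p)" by (auto simp: tip_def height_def)
  show "t \<le> height p" if "p + t \<in> P" "t \<le> lev (p + t)" for t
    unfolding height_def by (rule Max_ge[OF fin]) (use that in auto)
qed

lemma tip_lev:
  assumes p: "p \<in> P"
  shows "ev (tip p) = ev p" "lev (tip p) = lev p + height p"
  using up_lev[of p "height p"] height[OF p] P_less by (auto simp: tip_def)

lemma tip_down:
  assumes p: "p \<in> P" and s: "s \<le> lev p"
  shows "tip (p - s) = tip p"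
proof -
  have sp: "s \<le> p" "lev (p - s) = lev p - s" using down[OF P_less[OF p] s] by auto
  have ps: "p - s \<in> P" by (rule Pdown'[OF p s])
  note h = height[OF p] and h' = height[OF ps]
  have "s + height p \<le> height (p - s)"
  proof (rule h'(3))
    have e: "p - s + (s + height p) = tip p" using sp by (simp add: tip_def)
    show "p - s + (s + height p) \<in> P" unfolding e by (rule h)
    show "s + height p \<le> lev (p - s + (s + height p))"
      unfolding e using tip_lev[OF p] s by simp
  qed
  moreover have "height (p - s) - s \<le> height p"
  proof (cases "s \<le> height (p - s)")
    case True
    have e: "p + (height (p - s) - s) = tip (p - s)" using True sp by (simp add: tip_def)
    show ?thesis by (rule h(3); unfold e) (use h' in auto)
  qed simp
  ultimately show ?thesis using sp by (simp add: tip_def)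
qed

text \<open>For a set \<open>P\<close> of positions that is closed under going down in a block, the subspaces
  with pivot set \<open>P\<close> are generated as modules by the vectors \<^term>\<open>gen x q\<close>, where \<open>q\<close> is the
  topmost element of \<open>P\<close> in its block. The coefficient of position \<open>r\<close> is named by the
  pair of \<open>r\<close> and the element of \<open>P\<close> that lies below \<open>q\<close> at the level of \<open>r\<close>: in this way the
  parameters are the pairs in \<open>P\<close> times its complement on a common eigenvalue and level.\<close>

definition gen :: "(nat \<times> nat \<Rightarrow> 'k) \<Rightarrow> nat \<Rightarrow> nat \<Rightarrow> 'k" where
  "gen x q r = (if r = q then 1 else if r < n \<and> r \<notin> P \<and> ev r = ev q \<and> lev r \<le> lev q
     then x (q - (lev q - lev r), r) else 0)"

text \<open>The basis vector with pivot \<open>p\<close>: the generator of its block, pushed down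
  from the tip to \<open>p\<close> by the nilpotent part.\<close>

definition colf :: "(nat \<times> nat \<Rightarrow> 'k) \<Rightarrow> nat \<Rightarrow> nat \<Rightarrow> 'k" where
  "colf x p = shift (height p) (gen x (tip p))"

text \<open>Triangularity on the pivot rows, ordered by the level of the tip. A nonzero entry off
  the diagonal comes from the position \<open>p + height p'\<close> outside \<open>P\<close>, which
  must lie above the tip of \<open>p\<close>, while the generator reaches no higher than its own
  level.\<close>

lemma colf_P:
  assumes p: "p \<in> P" and p': "p' \<in> P" and nz: "colf x p' p \<noteq> 0" and ne: "p \<noteq> p'"
  shows "lev (tip p) < lev (tip p')"
proof -
  let ?t = "height p'"
  from nz have t: "p + ?t < n" "?t \<le> lev (p + ?t)" and g: "gen x (tip p') (p + ?t) \<noteq> 0"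
    by (auto simp: colf_def shift_def split: if_splits)
  have "p + ?t \<noteq> tip p'" using ne by (simp add: tip_def)
  with g have r: "p + ?t \<notin> P" "lev (p + ?t) \<le> lev (tip p')" by (auto simp: gen_def split: if_splits)
  have "height p < ?t"
  proof (rule ccontr)
    assume "\<not> height p < ?t"
    then have le: "?t \<le> height p" by simp
    have "tip p - (height p - ?t) \<in> P"
      by (rule Pdown'[OF height(1)[OF p]]) (use height(2)[OF p] in simp)
    moreover have "tip p - (height p - ?t) = p + ?t" using le by (simp add: tip_def)
    ultimately show False using r by simp
  qed
  then show ?thesis using tip_lev[OF p] up_lev[OF t] r by simp
qed

lemma colf_diag: "p \<in> P \<Longrightarrow> colf x p p = 1"
  using height[of p] P_less by (auto simp: colf_def shift_def gen_def tip_def)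

text \<open>By triangularity, a pivot whose tip has maximal level among those with nonzero
  coefficient sees only its own column.\<close>

lemma colf_inj:
  assumes y: "\<And>p. p \<in> P \<Longrightarrow> (\<Sum>p'\<in>P. y p' * colf x p' p) = 0" and p0: "p0 \<in> P"
  shows "y p0 = 0"
proof (rule ccontr)
  assume "y p0 \<noteq> 0"
  then have ne: "{p \<in> P. y p \<noteq> 0} \<noteq> {}" using p0 by auto
  define m where "m = Max ((\<lambda>p. lev (tip p)) ` {p \<in> P. y p \<noteq> 0})"
  have "m \<in> (\<lambda>p. lev (tip p)) ` {p \<in> P. y p \<noteq> 0}" unfolding m_def by (rule Max_in) (use ne in auto)
  then obtain p where p: "p \<in> P" "y p \<noteq> 0" "lev (tip p) = m" by auto
  have max: "lev (tip p') \<le> m" if "p' \<in> P" "y p' \<noteq> 0" for p' unfolding m_def by (rule Max_ge) (use that in auto)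
  have "(\<Sum>p'\<in>P. y p' * colf x p' p) = (\<Sum>p'\<in>{p}. y p' * colf x p' p)"
  proof (rule sum.mono_neutral_right)
    show "\<forall>i\<in>P - {p}. y i * colf x i p = 0"
    proof
      fix i assume i: "i \<in> P - {p}"
      show "y i * colf x i p = 0"
      proof (rule ccontr)
        assume "y i * colf x i p \<noteq> 0"
        with colf_P[OF p(1), of i x] i max[of i] p(3) show False by auto
      qed
    qed
  qed (use p in auto)
  with y[OF p(1)] colf_diag[OF p(1)] p(2) show False by simp
qed

lemma colf_less: "colf x p i \<noteq> 0 \<Longrightarrow> i < n"
  by (auto simp: colf_def shift_def split: if_splits)

lemma colf_ev:
  assumes "p \<in> P" "colf x p i \<noteq> 0"
  shows "ev i = ev p"
proof -
  from assms have t: "i + height p < n" "height p \<le> lev (i + height p)"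
    and "gen x (tip p) (i + height p) \<noteq> 0" by (auto simp: colf_def shift_def split: if_splits)
  then have "ev (i + height p) = ev (tip p)" by (auto simp: gen_def split: if_splits)
  with up_lev[OF t] tip_lev[OF assms(1)] show ?thesis by simp
qed

text \<open>The columns of one block form a Jordan chain, so their span is invariant whatever the
  parameters are.\<close>

lemma jop_colf:
  assumes p: "p \<in> P"
  shows "jop (colf x p) i = ev p * colf x p i + (if lev p > 0 then colf x (p - 1) i else 0)"
proof (cases "i < n")
  case False
  then have "colf x q i = 0" for q using colf_less by blast
  with False show ?thesis by (simp add: jop_def)
next
  case i: True
  let ?t = "height p"
  have "(if Suc i < n \<and> lev (Suc i) > 0 then colf x p (Suc i) else 0)
      = shift (Suc ?t) (gen x (tip p)) i" (is "?l = ?r")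
  proof (cases "Suc i + ?t < n \<and> ?t \<le> lev (Suc i + ?t)")
    case True
    then have "lev (Suc i + ?t) = lev (Suc i) + ?t" using up_lev[of "Suc i" ?t] by auto
    with True show ?thesis by (auto simp: colf_def shift_def)
  next
    case False
    then show ?thesis by (auto simp: colf_def shift_def)
  qed
  moreover have "?r = (if lev p > 0 then colf x (p - 1) i else 0)"
  proof (cases "lev p > 0")
    case True
    have "tip (p - 1) = tip p" using tip_down[OF p, of 1] True by simp
    moreover have "p > 0" using pred[OF P_less[OF p] True] by simp
    ultimately have "height (p - 1) = Suc ?t" by (simp add: tip_def)
    with \<open>tip (p - 1) = tip p\<close> True show ?thesis by (simp add: colf_def)
  next
    case False
    \<comment> \<open>At level 0 the height equals the level of the tip, and the generator has no
      entry on a higher level; one more shift kills it. This is the reason for the bound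
      \<open>lev r \<le> lev q\<close> in \<open>gen\<close>.\<close>
    have "shift (Suc ?t) (gen x (tip p)) i = 0"
      using tip_lev[OF p] False by (auto simp: shift_def gen_def)
    with False show ?thesis by simp
  qed
  moreover have "ev i * colf x p i = ev p * colf x p i" using colf_ev[OF p, of x i] by auto
  ultimately show ?thesis using i by (simp add: jop_def)
qed

definition params :: "(nat \<times> nat) set" where
  "params = {(p, r). p \<in> P \<and> r < n \<and> r \<notin> P \<and> ev p = ev r \<and> lev p = lev r}"

lemma finite_params [simp]: "finite params"
  by (rule finite_subset[of _ "P \<times> {..<n}"]) (auto simp: params_def)

lemma gen_poly:
  assumes q: "q \<in> P"
  shows "(\<lambda>x. gen x q r) \<in> poly_map params"
proof (cases "r \<noteq> q \<and> r < n \<and> r \<notin> P \<and> ev r = ev q \<and> lev r \<le> lev q")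
  case True
  have "(q - (lev q - lev r), r) \<in> params"
    using down[OF P_less[OF q], of "lev q - lev r"] Pdown'[OF q, of "lev q - lev r"] True
    by (auto simp: params_def)
  then have "(\<lambda>x. x (q - (lev q - lev r), r)) \<in> poly_map params" by (intro poly_map_var) auto
  with True show ?thesis by (simp add: gen_def)
next
  case False
  then show ?thesis by (cases "r = q") (auto simp: gen_def intro: poly_map_const)
qed

lemma colf_poly:
  assumes "p \<in> P"
  shows "(\<lambda>x. colf x p i) \<in> poly_map params"
  using gen_poly[OF height(1)[OF assms], of "i + height p"] poly_map_const[of 0 params]
  by (cases "i + height p < n \<and> height p \<le> lev (i + height p)") (auto simp: colf_def shift_def)

lemma colf_affine:
  "colf (\<lambda>j. x j + s * (y j - x j)) p i = colf x p i + s * (colf y p i - colf x p i)"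
  by (simp add: colf_def shift_def gen_def)

text \<open>On the pivot rows the column of a tip is a unit vector, and in row \<open>r\<close> it
  shows the parameter \<open>(p, r)\<close> unchanged. A minor can therefore test a single
  parameter.\<close>

lemma colf_tip:
  assumes "(p, r) \<in> params" and t: "t \<in> P \<or> t = r"
  shows "colf x (tip p) t = (if t = r then x (p, r) else if t = tip p then 1 else 0)"
proof -
  from assms have p: "p \<in> P" "r < n" "r \<notin> P" "ev p = ev r" "lev p = lev r" by (auto simp: params_def)
  note q = height(1)[OF p(1)]
  have "tip (tip p) = tip p"
    using tip_down[OF q, of "height p"] height(2)[OF p(1)] by (simp add: tip_def)
  then have "height (tip p) = 0" unfolding tip_def[of "tip p"] by simp
  with \<open>tip (tip p) = tip p\<close> have c: "colf x (tip p) t = (if t < n then gen x (tip p) t else 0)"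
    by (simp add: colf_def shift_def)
  have "tip p - (lev (tip p) - lev r) = p" using tip_lev[OF p(1)] p by (simp add: tip_def)
  then show ?thesis unfolding c using t p q P_less tip_lev[OF p(1)] by (auto simp: gen_def)
qed

end

section \<open>Splitting invariant subspaces over the eigenvalues\<close>

context jordan_shape
begin

lemma jmat_sum: "i < n \<Longrightarrow> (\<Sum>k<n. jmat $$ (i, k) * f k) = jop f i"
proof -
  assume i: "i < n"
  have "(\<Sum>k<n. jmat $$ (i, k) * f k)
    = (\<Sum>k<n. (if k = i then ev i * f i else 0) + (if k = Suc i then (if lev (Suc i) > 0 then f (Suc i) else 0) else 0))"
    by (rule sum.cong) (use i in \<open>auto simp: jmat_def\<close>)
  also have "\<dots> = jop f i" using i by (auto simp: sum.distrib jop_def)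
  finally show ?thesis .
qed

definition invariant :: "(nat \<Rightarrow> 'k) set \<Rightarrow> bool" where
  "invariant V \<longleftrightarrow> (\<lambda>_. 0) \<in> V \<and> (\<forall>f\<in>V. \<forall>g\<in>V. (\<lambda>i. f i + g i) \<in> V) \<and> (\<forall>c. \<forall>f\<in>V. (\<lambda>i. c * f i) \<in> V)
    \<and> (\<forall>f\<in>V. \<forall>i. n \<le> i \<longrightarrow> f i = 0) \<and> (\<forall>f\<in>V. jop f \<in> V)"

lemma invariantD:
  assumes "invariant V"
  shows "(\<lambda>_. 0) \<in> V" "\<And>f g. f \<in> V \<Longrightarrow> g \<in> V \<Longrightarrow> (\<lambda>i. f i + g i) \<in> V"
    "\<And>c f. f \<in> V \<Longrightarrow> (\<lambda>i. c * f i) \<in> V" "\<And>f i. f \<in> V \<Longrightarrow> n \<le> i \<Longrightarrow> f i = 0" "\<And>f. f \<in> V \<Longrightarrow> jop f \<in> V"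
    "\<And>f g c. f \<in> V \<Longrightarrow> g \<in> V \<Longrightarrow> (\<lambda>i. f i + c * g i) \<in> V"
proof -
  show 1: "(\<lambda>_. 0) \<in> V" "\<And>f g. f \<in> V \<Longrightarrow> g \<in> V \<Longrightarrow> (\<lambda>i. f i + g i) \<in> V"
    "\<And>c f. f \<in> V \<Longrightarrow> (\<lambda>i. c * f i) \<in> V" "\<And>f i. f \<in> V \<Longrightarrow> n \<le> i \<Longrightarrow> f i = 0" "\<And>f. f \<in> V \<Longrightarrow> jop f \<in> V"
    using assms unfolding invariant_def by auto
  show "(\<lambda>i. f i + c * g i) \<in> V" if "f \<in> V" "g \<in> V" for f g c
    using 1(2)[OF that(1) 1(3)[OF that(2), of c]] .
qed

lemma invariant_sum:
  assumes V: "invariant V" and f: "\<And>a. a \<in> A \<Longrightarrow> f a \<in> V"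
  shows "(\<lambda>i. \<Sum>a\<in>A. c a * f a i) \<in> V"
  using f
proof (induct A rule: infinite_finite_induct)
  case (insert a A)
  then have "(\<lambda>i. (\<Sum>a\<in>A. c a * f a i) + c a * f a i) \<in> V" by (intro invariantD(6)[OF V]) auto
  with insert show ?case by (simp add: add.commute)
qed (use invariantD(1)[OF V] in auto)

definition nop :: "(nat \<Rightarrow> 'k) \<Rightarrow> nat \<Rightarrow> 'k" where "nop = shift 1"

lemma jop_nop: "jop f i = (if i < n then ev i * f i + nop f i else 0)"
  by (auto simp: jop_def nop_def shift_def)

lemma nop_ge: "n \<le> i \<Longrightarrow> nop f i = 0" by (simp add: nop_def shift_def)

lemma nop_nz:
  assumes "nop f i \<noteq> 0"
  shows "Suc i < n" "f (Suc i) \<noteq> 0" "ev (Suc i) = ev i" "lev (Suc i) = Suc (lev i)" "nop f i = f (Suc i)"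
  using assms up_lev[of i 1] by (auto simp: nop_def shift_def split: if_splits)

definition proj :: "'k \<Rightarrow> (nat \<Rightarrow> 'k) \<Rightarrow> nat \<Rightarrow> 'k" where
  "proj l f i = (if ev i = l then f i else 0)"

lemma nop_proj: "nop (proj l f) = proj l (nop f)"
proof
  fix i
  show "nop (proj l f) i = proj l (nop f) i"
    using up_lev(1)[of i 1] by (auto simp: nop_def shift_def proj_def)
qed

text \<open>On a generalized eigenspace, \<open>J - \<mu>\<close> is invertible for all other \<open>\<mu>\<close>, and its inverse is
  a polynomial in \<open>J\<close>; the induction on the level replaces the geometric series.\<close>

lemma invariant_cancel:
  assumes V: "invariant V" and lm: "l \<noteq> m"
  shows "\<forall>i. z i \<noteq> 0 \<longrightarrow> i < n \<and> ev i = l \<and> lev i < b \<Longrightarrow> (\<lambda>i. (l - m) * z i + nop z i) \<in> V \<Longrightarrow> z \<in> V"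
proof (induct b arbitrary: z)
  case 0
  then have "z = (\<lambda>_. 0)" by auto
  then show ?case using invariantD(1)[OF V] by simp
next
  case (Suc b)
  let ?y = "\<lambda>i. (l - m) * z i + nop z i"
  \<comment> \<open>On the generalized eigenspace of \<open>l\<close> the nilpotent part is
    \<open>J - l\<close>. Applied to the hypothesis it gives the same relation for
    \<open>nop z\<close>, which lives one level lower.\<close>
  have "(\<lambda>i. (l - m) * nop z i + nop (nop z) i) = (\<lambda>i. jop ?y i + (- l) * ?y i)"
  proof
    fix i
    have nz: "ev i = l \<and> i < n" if "z i \<noteq> 0 \<or> nop z i \<noteq> 0 \<or> nop (nop z) i \<noteq> 0"
      using that Suc(2) nop_nz[of z i] nop_nz[of "nop z" i] nop_nz[of z "Suc i"] by (metis Suc_lessD)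
    have lin: "nop ?y i = (l - m) * nop z i + nop (nop z) i" by (simp add: nop_def shift_def)
    show "(l - m) * nop z i + nop (nop z) i = jop ?y i + (- l) * ?y i"
    proof (cases "z i \<noteq> 0 \<or> nop z i \<noteq> 0 \<or> nop (nop z) i \<noteq> 0")
      case True
      with nz have "ev i = l" "i < n" by auto
      then show ?thesis using lin by (simp add: jop_nop algebra_simps)
    next
      case False
      then show ?thesis using lin by (auto simp: jop_nop)
    qed
  qed
  also have "\<dots> \<in> V" by (intro invariantD(6)[OF V] invariantD(5)[OF V] Suc(3))
  finally have N: "(\<lambda>i. (l - m) * nop z i + nop (nop z) i) \<in> V" .
  have "nop z \<in> V"
  proof (rule Suc(1)[OF _ N])
    show "\<forall>i. nop z i \<noteq> 0 \<longrightarrow> i < n \<and> ev i = l \<and> lev i < b"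
    proof (intro allI impI)
      fix i assume "nop z i \<noteq> 0"
      from nop_nz[OF this] Suc(2)[rule_format, of "Suc i"] show "i < n \<and> ev i = l \<and> lev i < b" by auto
    qed
  qed
  then have "(\<lambda>i. ?y i + (- 1) * nop z i) \<in> V" by (intro invariantD(6)[OF V] Suc(3))
  then have "(\<lambda>i. inverse (l - m) * (?y i + (- 1) * nop z i)) \<in> V" by (rule invariantD(3)[OF V])
  moreover have "(\<lambda>i. inverse (l - m) * (?y i + (- 1) * nop z i)) = z"
    using lm by (simp add: fun_eq_iff mult.assoc[symmetric])
  ultimately show ?case by simp
qed

text \<open>Outer induction on the eigenvalues in the support, inner induction on the levels of the
  part at \<open>m\<close>. Applying \<open>J - m\<close> lowers that part by one level, so all
  projections of the result lie in \<open>V\<close>. On the other eigenvalues \<open>J - m\<close>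
  can be cancelled, which puts the other projections of \<open>f\<close> in
  \<open>V\<close>.\<close>

lemma invariant_proj:
  assumes V: "invariant V" and S: "finite S"
  shows "f \<in> V \<Longrightarrow> (\<And>i. f i \<noteq> 0 \<Longrightarrow> ev i \<in> S) \<Longrightarrow> proj l f \<in> V"
  using S
proof (induct S arbitrary: f l rule: finite_induct)
  case empty
  then have "f = (\<lambda>_. 0)" by auto
  then have "proj l f = (\<lambda>_. 0)" by (auto simp: proj_def)
  then show ?case using invariantD(1)[OF V] by simp
next
  case (insert m S)
  have "proj l f \<in> V" if "f \<in> V" "\<And>i. f i \<noteq> 0 \<Longrightarrow> ev i \<in> insert m S" "\<And>i. f i \<noteq> 0 \<Longrightarrow> ev i = m \<Longrightarrow> lev i < b"
    for b f l
    using that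
  proof (induct b arbitrary: f l)
    case 0
    show ?case
    proof (rule insert(3)[OF 0(1)])
      fix i assume "f i \<noteq> 0"
      from 0(2)[OF this] 0(3)[OF this] show "ev i \<in> S" by auto
    qed
  next
    case (Suc b)
    let ?g = "\<lambda>i. jop f i + (- m) * f i"
    have supp: "f i = 0" if "n \<le> i" for i using invariantD(4)[OF V Suc(2) that] .
    have g: "?g i = (ev i - m) * f i + nop f i" for i
      using supp[of i] nop_ge[of i f] by (cases "i < n") (auto simp: jop_nop algebra_simps)
    have gV: "?g \<in> V" by (intro invariantD(6)[OF V] invariantD(5)[OF V] Suc(2))
    have gp: "proj k ?g \<in> V" for k
    proof (rule Suc(1)[OF gV])
      fix i assume "?g i \<noteq> 0"
      then have nz: "(ev i - m) * f i \<noteq> 0 \<or> nop f i \<noteq> 0" unfolding g by auto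
      then show "ev i \<in> insert m S" using Suc(3)[of i] Suc(3)[of "Suc i"] nop_nz[of f i] by auto
      assume "ev i = m"
      with nz have "nop f i \<noteq> 0" by simp
      from nop_nz[OF this] Suc(4)[of "Suc i"] \<open>ev i = m\<close> show "lev i < b" by auto
    qed
    have other: "proj k f \<in> V" if k: "k \<noteq> m" for k
    proof (rule invariant_cancel[OF V k])
      show "\<forall>i. proj k f i \<noteq> 0 \<longrightarrow> i < n \<and> ev i = k \<and> lev i < Suc (Max (lev ` {..<n}))"
      proof (intro allI impI)
        fix i assume "proj k f i \<noteq> 0"
        then have "ev i = k" "f i \<noteq> 0" by (auto simp: proj_def split: if_splits)
        moreover from this supp have "i < n" by (meson not_le)
        moreover from this have "lev i \<le> Max (lev ` {..<n})" by (intro Max_ge) auto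
        ultimately show "i < n \<and> ev i = k \<and> lev i < Suc (Max (lev ` {..<n}))"
          by (simp add: less_Suc_eq_le)
      qed
      have "(\<lambda>i. (k - m) * proj k f i + nop (proj k f) i) = proj k ?g"
      proof
        fix i
        show "(k - m) * proj k f i + nop (proj k f) i = proj k ?g i"
          unfolding nop_proj proj_def g by simp
      qed
      then show "(\<lambda>i. (k - m) * proj k f i + nop (proj k f) i) \<in> V" using gp by simp
    qed
    show ?case
    proof (cases "l = m")
      case True
      \<comment> \<open>The part at \<open>m\<close> is what remains after removing all other
        parts.\<close>
      have "(\<lambda>i. f i + (- 1) * (\<Sum>k\<in>S. 1 * proj k f i)) \<in> V"
        by (intro invariantD(6)[OF V] invariant_sum[OF V] Suc(2) other) (use insert in auto)
      moreover have "(\<lambda>i. f i + (- 1) * (\<Sum>k\<in>S. 1 * proj k f i)) = proj m f"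
      proof
        fix i
        have "(\<Sum>k\<in>S. 1 * proj k f i) = (if ev i \<in> S then f i else 0)"
          using insert(1) by (simp add: proj_def)
        then show "f i + (- 1) * (\<Sum>k\<in>S. 1 * proj k f i) = proj m f i"
          using Suc(3)[of i] insert(2) by (auto simp: proj_def)
      qed
      ultimately show ?thesis using True by simp
    qed (rule other)
  qed
  note main = this
  show ?case
  proof (rule main[OF insert(4,5), where b = "Suc (Max (lev ` {..<n}))"])
    fix i assume "f i \<noteq> 0"
    then have "i < n" using invariantD(4)[OF V insert(4)] by (meson not_le)
    then show "lev i < Suc (Max (lev ` {..<n}))" by (simp add: less_Suc_eq_le)
  qed
qed

end

section \<open>Leading positions and reduced echelon vectors\<close>

context jordan_shape
begin

text \<open>Echelon forms are taken with respect to the order by level first: it is preserved by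
  shifting down, so that the set of leading positions of an invariant subspace is closed
  under going down.\<close>

definition key :: "nat \<Rightarrow> nat" where "key r = lev r * n + r"

lemma key_inj: "a < n \<Longrightarrow> b < n \<Longrightarrow> key a = key b \<Longrightarrow> a = b"
  unfolding key_def by (metis mod_less mod_mult_self3)

lemma key_lev: "a < n \<Longrightarrow> b < n \<Longrightarrow> key a \<le> key b \<Longrightarrow> lev a \<le> lev b"
proof (rule ccontr)
  assume *: "a < n" "b < n" "key a \<le> key b" "\<not> lev a \<le> lev b"
  then have "Suc (lev b) * n \<le> lev a * n" by (intro mult_le_mono1) simp
  with * show False unfolding key_def by simp
qed

text \<open>One step up in a block raises the key by the constant \<open>n + 1\<close>, so shifting
  down preserves the order of keys.\<close>

lemma key_shift: "Suc i < n \<Longrightarrow> 0 < lev (Suc i) \<Longrightarrow> key (Suc i) = Suc (key i) + n"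
  using pred[of "Suc i"] by (simp add: key_def)

definition leads :: "(nat \<Rightarrow> 'k) set \<Rightarrow> nat set" where
  "leads V = {p. \<exists>f\<in>V. f p = 1 \<and> (\<forall>i. f i \<noteq> 0 \<longrightarrow> key i \<le> key p)}"

context
  fixes V :: "(nat \<Rightarrow> 'k) set"
  assumes V: "invariant V"
begin

lemma V_less: "f \<in> V \<Longrightarrow> f i \<noteq> 0 \<Longrightarrow> i < n"
  using invariantD(4)[OF V] by (meson not_le)

lemma leads_less: "leads V \<subseteq> {..<n}"
  unfolding leads_def using V_less by force

lemma finite_leads: "finite (leads V)"
  using leads_less finite_subset by blast

lemma zero_on_leads:
  assumes f: "f \<in> V" and z: "\<And>p. p \<in> leads V \<Longrightarrow> f p = 0"
  shows "f i = 0"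
proof (rule ccontr)
  assume i: "f i \<noteq> 0"
  have fin: "finite {i. f i \<noteq> 0}" by (rule finite_subset[of _ "{..<n}"]) (use V_less[OF f] in auto)
  have "Max (key ` {i. f i \<noteq> 0}) \<in> key ` {i. f i \<noteq> 0}" by (rule Max_in) (use fin i in auto)
  then obtain p where p: "f p \<noteq> 0" "key p = Max (key ` {i. f i \<noteq> 0})" by auto
  have le: "key j \<le> key p" if "f j \<noteq> 0" for j unfolding p(2) by (rule Max_ge) (use fin that in auto)
  have "p \<in> leads V" unfolding leads_def
    using invariantD(3)[OF V f, of "inverse (f p)"] p(1) le
    by (intro CollectI bexI[of _ "\<lambda>i. inverse (f p) * f i"]) auto
  with z p(1) show False by auto
qed

lemma reduced_exists:
  assumes p: "p \<in> leads V"
  shows "\<exists>f\<in>V. f p = 1 \<and> (\<forall>i. f i \<noteq> 0 \<longrightarrow> key i \<le> key p) \<and> (\<forall>i\<in>leads V. i \<noteq> p \<longrightarrow> f i = 0)"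
proof -
  have pn: "i < n" if "i \<in> leads V" for i using leads_less that by auto
  \<comment> \<open>Other leading positions are cleared in order of decreasing key. Subtracting a
    vector that leads at \<open>i\<close> only touches keys up to \<open>key i\<close>, so positions
    already cleared stay clear.\<close>
  have "\<exists>f\<in>V. f p = 1 \<and> (\<forall>i. f i \<noteq> 0 \<longrightarrow> key i \<le> key p) \<and>
    (\<forall>i\<in>leads V. i \<noteq> p \<longrightarrow> key p \<le> key i + j \<longrightarrow> f i = 0)" for j
  proof (induct j)
    case 0
    from p obtain f where f: "f \<in> V" "f p = 1" "\<forall>i. f i \<noteq> 0 \<longrightarrow> key i \<le> key p" by (auto simp: leads_def)
    have "f i = 0" if i: "i \<in> leads V" "i \<noteq> p" "key p \<le> key i" for i
    proof (rule ccontr)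
      assume "f i \<noteq> 0"
      with f(3) i(3) have "key i = key p" by (auto intro: antisym)
      with key_inj[OF pn[OF i(1)] pn[OF p]] i(2) show False by simp
    qed
    with f show ?case by (intro bexI[of _ f]) auto
  next
    case (Suc j)
    then obtain f where f: "f \<in> V" "f p = 1" "\<And>i. f i \<noteq> 0 \<Longrightarrow> key i \<le> key p"
      "\<And>i. i \<in> leads V \<Longrightarrow> i \<noteq> p \<Longrightarrow> key p \<le> key i + j \<Longrightarrow> f i = 0" by blast
    show ?case
    proof (cases "\<exists>i\<in>leads V. key p = key i + Suc j")
      case False
      then have "key p \<le> key i + j" if "key p \<le> key i + Suc j" "i \<in> leads V" for i
        using that by (metis add_Suc_right le_SucE)
      with f show ?thesis by (intro bexI[of _ f]) auto
    next
      case True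
      then obtain i where i: "i \<in> leads V" "key p = key i + Suc j" by blast
      from i(1) obtain h where h: "h \<in> V" "h i = 1" "\<And>r. h r \<noteq> 0 \<Longrightarrow> key r \<le> key i" by (auto simp: leads_def)
      let ?f = "\<lambda>r. f r + (- f i) * h r"
      have "h p = 0" using h(3)[of p] i(2) by auto
      moreover have "key r \<le> key p" if "?f r \<noteq> 0" for r
        using that f(3)[of r] h(3)[of r] i(2) by (cases "f r = 0") auto
      moreover have "?f r = 0" if r: "r \<in> leads V" "r \<noteq> p" "key p \<le> key r + Suc j" for r
      proof (cases "r = i")
        case False
        then have "key r \<noteq> key i" using key_inj[OF pn[OF r(1)] pn[OF i(1)]] by auto
        then have "key i < key r" using r(3) i(2) by simp
        then have "h r = 0" "f r = 0" using h(3)[of r] f(4)[OF r(1,2)] i(2) by auto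
        then show ?thesis by simp
      qed (use h in simp)
      ultimately show ?thesis
        by (intro bexI[of _ ?f] conjI ballI allI impI invariantD(6)[OF V] f(1) h(1)) (use f in auto)
    qed
  qed
  from this[of "key p"] show ?thesis by auto
qed

definition red :: "nat \<Rightarrow> nat \<Rightarrow> 'k" where
  "red p = (SOME f. f \<in> V \<and> f p = 1 \<and> (\<forall>i. f i \<noteq> 0 \<longrightarrow> key i \<le> key p) \<and> (\<forall>i\<in>leads V. i \<noteq> p \<longrightarrow> f i = 0))"

lemma red:
  assumes "p \<in> leads V"
  shows "red p \<in> V" "red p p = 1" "\<And>i. red p i \<noteq> 0 \<Longrightarrow> key i \<le> key p" "\<And>i. i \<in> leads V \<Longrightarrow> i \<noteq> p \<Longrightarrow> red p i = 0"
proof -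
  have "\<exists>f. f \<in> V \<and> f p = 1 \<and> (\<forall>i. f i \<noteq> 0 \<longrightarrow> key i \<le> key p) \<and> (\<forall>i\<in>leads V. i \<noteq> p \<longrightarrow> f i = 0)"
    using reduced_exists[OF assms] by blast
  from someI_ex[OF this, folded red_def] show "red p \<in> V" "red p p = 1" "\<And>i. red p i \<noteq> 0 \<Longrightarrow> key i \<le> key p" "\<And>i. i \<in> leads V \<Longrightarrow> i \<noteq> p \<Longrightarrow> red p i = 0"
    by auto
qed

lemma red_expand:
  assumes f: "f \<in> V"
  shows "f i = (\<Sum>p\<in>leads V. f p * red p i)"
proof -
  have "(\<lambda>i. f i + (- 1) * (\<Sum>p\<in>leads V. f p * red p i)) \<in> V" (is "?h \<in> V")
    by (intro invariantD(6)[OF V] invariant_sum[OF V] f red)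
  moreover have "?h q = 0" if q: "q \<in> leads V" for q
  proof -
    have "(\<Sum>p\<in>leads V. f p * red p q) = (\<Sum>p\<in>{q}. f p * red p q)"
      by (rule sum.mono_neutral_right[OF finite_leads]) (use q red(4) in auto)
    then show ?thesis using red(2)[OF q] by simp
  qed
  ultimately have "?h i = 0" by (rule zero_on_leads)
  then show ?thesis by simp
qed

text \<open>The difference between a reduced vector and its projection to the eigenvalue of
  \<open>p\<close> lies in \<open>V\<close> and vanishes at all leading positions.\<close>

lemma red_ev:
  assumes p: "p \<in> leads V" and nz: "red p i \<noteq> 0"
  shows "ev i = ev p"
proof (rule ccontr)
  assume ne: "ev i \<noteq> ev p"
  have "proj (ev p) (red p) \<in> V"
    by (rule invariant_proj[OF V, of "ev ` {..<n}"]) (use red(1)[OF p] V_less in auto)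
  then have "(\<lambda>i. red p i + (- 1) * proj (ev p) (red p) i) \<in> V" by (intro invariantD(6)[OF V] red p)
  moreover have "red p q + (- 1) * proj (ev p) (red p) q = 0" if "q \<in> leads V" for q
    using red(2)[OF p] red(4)[OF p that] by (cases "q = p") (auto simp: proj_def)
  ultimately have "red p i + (- 1) * proj (ev p) (red p) i = 0" by (rule zero_on_leads)
  with ne nz show False by (simp add: proj_def)
qed

lemma nop_closed:
  assumes f: "f \<in> V" and e: "\<And>i. f i \<noteq> 0 \<Longrightarrow> ev i = l"
  shows "nop f \<in> V" "\<And>i. nop f i \<noteq> 0 \<Longrightarrow> ev i = l"
proof -
  have "(\<lambda>i. jop f i + (- l) * f i) \<in> V" by (intro invariantD(6)[OF V] invariantD(5)[OF V] f)
  moreover have "(\<lambda>i. jop f i + (- l) * f i) = nop f"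
  proof
    fix i show "jop f i + (- l) * f i = nop f i"
      using V_less[OF f, of i] e[of i] nop_ge[of i f] by (cases "f i = 0") (auto simp: jop_nop)
  qed
  ultimately show "nop f \<in> V" by simp
  show "ev i = l" if "nop f i \<noteq> 0" for i using nop_nz[OF that] e by auto
qed

lemma leads_down:
  assumes p: "p \<in> leads V" and l: "lev p > 0"
  shows "p - 1 \<in> leads V"
proof -
  have pn: "p < n" using leads_less p by auto
  then obtain q where q: "p = Suc q" using pred[OF pn l] by (cases p) auto
  have "nop (red p) q = 1" using q pn l red(2)[OF p] by (simp add: nop_def shift_def)
  moreover have "key i \<le> key q" if "nop (red p) i \<noteq> 0" for i
  proof -
    from nop_nz[OF that] have "Suc i < n" "0 < lev (Suc i)" "red p (Suc i) \<noteq> 0" by auto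
    with red(3)[OF p] key_shift[of i] key_shift[of q] q pn l show ?thesis by force
  qed
  moreover have "nop (red p) \<in> V" by (rule nop_closed(1)[OF red(1)[OF p] red_ev[OF p]])
  ultimately have "q \<in> leads V" unfolding leads_def by blast
  then show ?thesis by (simp add: q)
qed

lemma shift_Suc: "shift (Suc t) f = nop (shift t f)"
proof
  fix i
  show "shift (Suc t) f i = nop (shift t f) i"
  proof (cases "Suc i + t < n \<and> t \<le> lev (Suc i + t)")
    case True
    then have "lev (Suc i + t) = lev (Suc i) + t" using up_lev[of "Suc i" t] by auto
    with True show ?thesis by (auto simp: nop_def shift_def)
  qed (auto simp: nop_def shift_def)
qed

lemma shift_closed_V:
  assumes f: "f \<in> V" and e: "\<And>i. f i \<noteq> 0 \<Longrightarrow> ev i = l"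
  shows "shift t f \<in> V \<and> (\<forall>i. shift t f i \<noteq> 0 \<longrightarrow> ev i = l)"
proof (induct t)
  case 0
  have "shift 0 f = f" by (rule ext) (use V_less[OF f] in \<open>force simp: shift_def\<close>)
  with assms show ?case by auto
next
  case (Suc t)
  then show ?case unfolding shift_Suc using nop_closed[of "shift t f" l] by blast
qed

lemma leads_shift_closed: "shift_closed n ev lev (leads V)"
  by unfold_locales (use leads_less leads_down in auto)

text \<open>The parameters are read off from the reduced vectors at the tips. Reducedness, the
  single eigenvalue and the order by level give exactly the support allowed by \<open>gen\<close>;
  the vectors below a tip are replaced by its shifts.\<close>

lemma colf_leads:
  assumes p: "p \<in> leads V"
  shows "shift_closed.colf n ev lev (leads V) (\<lambda>(p', r). red (shift_closed.tip lev (leads V) p') r) p \<in> V"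
proof -
  interpret shift_closed n ev lev "leads V" by (rule leads_shift_closed)
  note q = height(1)[OF p]
  have tt: "tip (tip p) = tip p"
    using tip_down[OF q, of "height p"] height(2)[OF p] by (simp add: tip_def)
  have "gen (\<lambda>(p', r). red (tip p') r) (tip p) r = red (tip p) r" for r
  proof -
    consider "r = tip p" | "r \<noteq> tip p" "r < n \<and> r \<notin> leads V \<and> ev r = ev (tip p) \<and> lev r \<le> lev (tip p)"
      | "r \<noteq> tip p" "\<not> (r < n \<and> r \<notin> leads V \<and> ev r = ev (tip p) \<and> lev r \<le> lev (tip p))" by blast
    then show ?thesis
    proof cases
      case 1
      then show ?thesis using red(2)[OF q] by (simp add: gen_def)
    next
      case 2
      have "tip (tip p - (lev (tip p) - lev r)) = tip p" by (subst tip_down[OF q]) (use tt in auto)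
      with 2 show ?thesis by (simp add: gen_def)
    next
      case 3
      have "red (tip p) r = 0"
      proof (rule ccontr)
        assume nz: "red (tip p) r \<noteq> 0"
        have "r < n" using V_less[OF red(1)[OF q] nz] .
        moreover have "r \<notin> leads V" using red(4)[OF q _ 3(1)] nz by auto
        moreover have "ev r = ev (tip p)" by (rule red_ev[OF q nz])
        moreover have "lev r \<le> lev (tip p)"
          using key_lev[OF \<open>r < n\<close> P_less[OF q] red(3)[OF q nz]] .
        ultimately show False using 3 by blast
      qed
      with 3 show ?thesis by (auto simp: gen_def)
    qed
  qed
  then have "gen (\<lambda>(p', r). red (tip p') r) (tip p) = red (tip p)" by (rule ext)
  then show ?thesis unfolding colf_def using shift_closed_V[OF red(1)[OF q] red_ev[OF q]] by simp
qed

end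

end

section \<open>Frames of the subspaces with a given pivot set\<close>

context shift_closed
begin

definition plist :: "nat list" where "plist = sorted_list_of_set P"

lemma plist: "set plist = P" "distinct plist" "length plist = card P"
  by (simp_all add: plist_def)

lemma plist_nth: "c < card P \<Longrightarrow> plist ! c \<in> P"
  using plist nth_mem by metis

lemma plist_nth_eq: "c < card P \<Longrightarrow> c' < card P \<Longrightarrow> plist ! c = plist ! c' \<longleftrightarrow> c = c'"
  using plist(2,3) nth_eq_iff_index_eq by metis

lemma plist_ex: "p \<in> P \<Longrightarrow> \<exists>c<card P. plist ! c = p"
  using plist by (metis in_set_conv_nth)

lemma sum_plist: "(\<Sum>c<card P. h (plist ! c)) = (\<Sum>p\<in>P. h p)"
proof -
  have "bij_betw ((!) plist) {..<card P} P"
    by (rule bij_betw_nth) (use plist in auto)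
  then show ?thesis by (rule sum.reindex_bij_betw)
qed

definition MP :: "(nat \<times> nat \<Rightarrow> 'k) \<Rightarrow> 'k mat" where
  "MP x = mat n (card P) (\<lambda>(i, c). colf x (plist ! c) i)"

text \<open>Selects the pivot rows. They form an invertible matrix for all parameters, so one left
  factor works for the whole stratum.\<close>

definition rowsel :: "'k mat" where
  "rowsel = mat (card P) n (\<lambda>(c, i). if i = plist ! c then 1 else 0)"

lemma MP_carrier [simp]: "MP x \<in> carrier_mat n (card P)" by (simp add: MP_def)
lemma MP_dim [simp]: "dim_row (MP x) = n" "dim_col (MP x) = card P" by (simp_all add: MP_def)
lemma rowsel_carrier [simp]: "rowsel \<in> carrier_mat (card P) n" by (simp add: rowsel_def)

lemma MP_mult:
  assumes "v \<in> carrier_vec (card P)" "i < n"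
  shows "(MP x *\<^sub>v v) $ i = (\<Sum>c<card P. colf x (plist ! c) i * v $ c)"
  unfolding index_mult_mat_vec_sum[OF MP_carrier assms]
  by (rule sum.cong) (use assms in \<open>auto simp: MP_def\<close>)

lemma rowsel_mult:
  assumes "w \<in> carrier_vec n" "c < card P"
  shows "(rowsel *\<^sub>v w) $ c = w $ (plist ! c)"
proof -
  have "(rowsel *\<^sub>v w) $ c = (\<Sum>k<n. rowsel $$ (c, k) * w $ k)"
    by (rule index_mult_mat_vec_sum[OF rowsel_carrier assms])
  also have "\<dots> = (\<Sum>k<n. if k = plist ! c then w $ k else 0)"
    by (rule sum.cong) (use assms in \<open>auto simp: rowsel_def\<close>)
  also have "\<dots> = w $ (plist ! c)" using P_less[OF plist_nth[OF assms(2)]] by simp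
  finally show ?thesis .
qed

lemma MP_rows_zero:
  assumes v: "v \<in> carrier_vec (card P)" and z: "\<And>p. p \<in> P \<Longrightarrow> (MP x *\<^sub>v v) $ p = 0"
  shows "v = 0\<^sub>v (card P)"
proof (rule eq_vecI)
  define y where "y p = v $ (inv_into {..<card P} ((!) plist) p)" for p
  have inj: "inj_on ((!) plist) {..<card P}" using plist_nth_eq by (auto simp: inj_on_def)
  have y: "y (plist ! c) = v $ c" if "c < card P" for c
    unfolding y_def using inv_into_f_f[OF inj, of c] that by simp
  have rel: "(\<Sum>p'\<in>P. y p' * colf x p' p) = 0" if p: "p \<in> P" for p
  proof -
    have "(\<Sum>p'\<in>P. y p' * colf x p' p) = (\<Sum>c<card P. y (plist ! c) * colf x (plist ! c) p)"
      by (rule sum_plist[symmetric])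
    also have "\<dots> = (\<Sum>c<card P. colf x (plist ! c) p * v $ c)"
      by (rule sum.cong) (auto simp: y)
    also have "\<dots> = 0" using MP_mult[OF v P_less[OF p]] z[OF p] by simp
    finally show ?thesis .
  qed
  fix c assume "c < dim_vec (0\<^sub>v (card P))"
  then have c: "c < card P" by simp
  from colf_inj[of y x, OF rel plist_nth[OF c]] y[OF c] c show "v $ c = 0\<^sub>v (card P) $ c" by simp
qed (use v in simp)

lemma rowsel_GL: "rowsel * MP x \<in> GL (card P)"
proof (rule GL_of_inj)
  show "rowsel * MP x \<in> carrier_mat (card P) (card P)" by (rule mult_carrier_mat[OF rowsel_carrier MP_carrier])
  fix v :: "'k vec" assume v: "v \<in> carrier_vec (card P)" "rowsel * MP x *\<^sub>v v = 0\<^sub>v (card P)"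
  have w: "MP x *\<^sub>v v \<in> carrier_vec n" by (rule mult_mat_vec_carrier[OF MP_carrier v(1)])
  show "v = 0\<^sub>v (card P)"
  proof (rule MP_rows_zero[OF v(1)])
    fix p assume "p \<in> P"
    then obtain c where c: "c < card P" "plist ! c = p" using plist_ex by blast
    have "(rowsel *\<^sub>v (MP x *\<^sub>v v)) $ c = 0"
      using v(2) c unfolding assoc_mult_mat_vec[OF rowsel_carrier MP_carrier v(1)] by simp
    with rowsel_mult[OF w c(1)] c show "(MP x *\<^sub>v v) $ p = 0" by simp
  qed
qed

lemma jmat_MP:
  "\<exists>K\<in>carrier_mat (card P) (card P). jmat * MP x = MP x * K"
proof (rule bexI)
  \<comment> \<open>The Jordan matrix restricted to the rows and columns in
    \<open>P\<close>.\<close>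
  let ?e = "\<lambda>p p'. if p = p' then ev p' else if lev p' > 0 \<and> p = p' - 1 then 1 else 0"
  let ?K = "mat (card P) (card P) (\<lambda>(c, c'). ?e (plist ! c) (plist ! c'))"
  show "?K \<in> carrier_mat (card P) (card P)" by simp
  show "jmat * MP x = MP x * ?K"
  proof (rule eq_matI)
    fix i c assume "i < dim_row (MP x * ?K)" "c < dim_col (MP x * ?K)"
    then have i: "i < n" and c: "c < card P" by (auto simp: MP_def)
    let ?p = "plist ! c"
    note p = plist_nth[OF c]
    have "(jmat * MP x) $$ (i, c) = (\<Sum>k<n. jmat $$ (i, k) * colf x ?p k)"
      by (subst index_mult_mat_sum[OF jmat_carrier MP_carrier i c]) (simp add: MP_def c)
    also have "\<dots> = jop (colf x ?p) i" by (rule jmat_sum[OF i])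
    also have "\<dots> = ev ?p * colf x ?p i + (if lev ?p > 0 then colf x (?p - 1) i else 0)"
      by (rule jop_colf[OF p])
    also have "\<dots> = (\<Sum>q\<in>P. colf x q i * ?e q ?p)"
    proof (cases "lev ?p > 0")
      case True
      have p1: "?p - 1 \<in> P" "?p - 1 \<noteq> ?p" using Pdown[OF p True] pred[OF P_less[OF p] True] by auto
      have "(\<Sum>q\<in>P. colf x q i * ?e q ?p) = (\<Sum>q\<in>{?p, ?p - 1}. colf x q i * ?e q ?p)"
        by (rule sum.mono_neutral_right) (use p p1 in auto)
      then show ?thesis using p1 True by (simp add: mult.commute)
    next
      case False
      have "(\<Sum>q\<in>P. colf x q i * ?e q ?p) = (\<Sum>q\<in>{?p}. colf x q i * ?e q ?p)"
        by (rule sum.mono_neutral_right) (use p False in auto)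
      then show ?thesis using False by (simp add: mult.commute)
    qed
    also have "\<dots> = (\<Sum>k<card P. colf x (plist ! k) i * ?e (plist ! k) ?p)" by (rule sum_plist[symmetric])
    also have "\<dots> = (MP x * ?K) $$ (i, c)"
      by (subst index_mult_mat_sum[OF MP_carrier _ i c]) (simp_all add: MP_def c i)
    finally show "(jmat * MP x) $$ (i, c) = (MP x * ?K) $$ (i, c)" .
  qed (auto simp: MP_def jmat_def)
qed

end

section \<open>Transport to a matrix similar to a Jordan matrix\<close>

locale jordan_similar = jordan_shape n ev lev
  for n :: nat and ev :: "nat \<Rightarrow> 'k::field" and lev :: "nat \<Rightarrow> nat" +
  fixes A S S' :: "'k mat"
  assumes carr: "A \<in> carrier_mat n n" "S \<in> carrier_mat n n" "S' \<in> carrier_mat n n"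
    and SS': "S * S' = 1\<^sub>m n" "S' * S = 1\<^sub>m n" and A_eq: "A = S * jmat * S'"
    and inf: "infinite (UNIV :: 'k set)"
begin

lemma AS: "A * S = S * jmat"
proof -
  have "A * S = S * jmat * (S' * S)"
    unfolding A_eq by (rule assoc_mult_mat[OF mult_carrier_mat[OF carr(2) jmat_carrier] carr(3,2)])
  then show ?thesis using right_mult_one_mat[OF mult_carrier_mat[OF carr(2) jmat_carrier]] SS' by simp
qed

lemma S'A: "S' * A = jmat * S'"
proof -
  have "S' * A = (S' * S) * (jmat * S')"
    unfolding A_eq assoc_mult_mat[OF carr(2) jmat_carrier carr(3)]
    by (rule assoc_mult_mat[symmetric, OF carr(3,2) mult_carrier_mat[OF jmat_carrier carr(3)]])
  then show ?thesis using left_mult_one_mat[OF mult_carrier_mat[OF jmat_carrier carr(3)]] SS' by simp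
qed

text \<open>The maximal minor of \<open>S' * M\<close> on the pivot rows, with row
  \<open>tip p\<close> replaced by row \<open>r\<close> for \<open>pr = (p, r)\<close>. The factor
  \<open>S'\<close> undoes the change of basis.\<close>

definition minor :: "nat set \<Rightarrow> nat \<times> nat \<Rightarrow> 'k mat \<Rightarrow> 'k" where
  "minor P pr M = det (mat (card P) (card P) (\<lambda>(c, c').
     \<Sum>k<n. S' $$ (if shift_closed.plist P ! c = shift_closed.tip lev P (fst pr) then snd pr else shift_closed.plist P ! c, k)
       * M $$ (k, c')))"

lemma minor_poly: "minor P pr \<in> poly_fun n (card P)"
  unfolding minor_def[abs_def]
  by (rule poly_fun_det) (auto intro!: poly_fun_sum poly_fun.intros)

end

locale jordan_similar_closed = jordan_similar n ev lev A S S' + shift_closed n ev lev P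
  for n :: nat and ev :: "nat \<Rightarrow> 'k::field" and lev :: "nat \<Rightarrow> nat" and A S S' :: "'k mat" and P :: "nat set"
begin

lemma S'_S_cancel: "M \<in> carrier_mat n m \<Longrightarrow> S' * (S * M) = M"
  using assoc_mult_mat[OF carr(3,2), of M m] SS' by simp

lemma left_GL: "rowsel * S' * (S * MP x) \<in> GL (card P)"
proof -
  have "rowsel * S' * (S * MP x) = rowsel * (S' * (S * MP x))"
    by (rule assoc_mult_mat[OF rowsel_carrier carr(3)]) (rule mult_carrier_mat[OF carr(2) MP_carrier])
  then show ?thesis using S'_S_cancel[OF MP_carrier] rowsel_GL by simp
qed

lemma SMP_carrier: "S * MP x \<in> carrier_mat n (card P)" by (rule mult_carrier_mat[OF carr(2) MP_carrier])

lemma SMP_stiefel: "S * MP x \<in> stiefel n (card P)"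
  by (rule stiefel_if_left_GL[OF SMP_carrier _ left_GL]) (rule mult_carrier_mat[OF rowsel_carrier carr(3)])

lemma SMP_invariant: "colspan (S * MP x) \<in> invariant_subspaces A (card P)"
proof -
  from jmat_MP obtain K where K: "K \<in> carrier_mat (card P) (card P)" "jmat * MP x = MP x * K" by blast
  have "A * (S * MP x) = S * MP x * K"
  proof -
    have "A * (S * MP x) = (A * S) * MP x" by (rule assoc_mult_mat[symmetric, OF carr(1,2) MP_carrier])
    also have "\<dots> = S * (jmat * MP x)" unfolding AS by (rule assoc_mult_mat[OF carr(2) jmat_carrier MP_carrier])
    also have "\<dots> = S * MP x * K" unfolding K(2) by (rule assoc_mult_mat[symmetric, OF carr(2) MP_carrier K(1)])
    finally show ?thesis .
  qed
  then have inv: "A *\<^sub>v w \<in> colspan (S * MP x)" if "w \<in> colspan (S * MP x)" for w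
  proof -
    from that obtain v where v: "v \<in> carrier_vec (card P)" "w = S * MP x *\<^sub>v v"
      using SMP_carrier[of x] by (auto simp: colspan_def)
    have "A *\<^sub>v w = (A * (S * MP x)) *\<^sub>v v" unfolding v(2)
      by (rule assoc_mult_mat_vec[symmetric, OF carr(1) SMP_carrier v(1)])
    also have "\<dots> = S * MP x *\<^sub>v (K *\<^sub>v v)" unfolding \<open>A * (S * MP x) = S * MP x * K\<close>
      by (rule assoc_mult_mat_vec[OF SMP_carrier K(1) v(1)])
    finally show ?thesis using K(1) v(1) unfolding colspan_def by (auto intro!: exI[of _ "K *\<^sub>v v"])
  qed
  moreover have "colspan (S * MP x) \<in> grassmannian (dim_row A) (card P)"
    using SMP_stiefel[of x] carr(1) by (auto simp: grassmannian_def)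
  ultimately show ?thesis unfolding invariant_subspaces_def by blast
qed

text \<open>In this form the vanishing visibly depends only on the column space, hence not on the
  chosen frame.\<close>

lemma minor_zero_iff:
  assumes M: "M \<in> carrier_mat n (card P)" and pr: "(p, r) \<in> params"
  shows "minor P (p, r) (S * M) = 0 \<longleftrightarrow> (\<exists>v\<in>carrier_vec (card P). v \<noteq> 0\<^sub>v (card P) \<and>
    (\<forall>q\<in>P. q \<noteq> tip p \<longrightarrow> (M *\<^sub>v v) $ q = 0) \<and> (M *\<^sub>v v) $ r = 0)"
proof -
  from pr have p: "p \<in> P" "r < n" by (auto simp: params_def)
  let ?\<sigma> = "\<lambda>c. if plist ! c = tip p then r else plist ! c"
  have \<sigma>: "?\<sigma> c < n" if "c < card P" for c using p(2) P_less[OF plist_nth[OF that]] by simp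
  let ?N = "mat (card P) (card P) (\<lambda>(c, c'). M $$ (?\<sigma> c, c'))"
  have "mat (card P) (card P) (\<lambda>(c, c'). \<Sum>k<n. S' $$ (?\<sigma> c, k) * (S * M) $$ (k, c')) = ?N"
  proof (rule eq_matI)
    fix c c' assume "c < dim_row ?N" "c' < dim_col ?N"
    then have c: "c < card P" "c' < card P" by auto
    have "(\<Sum>k<n. S' $$ (?\<sigma> c, k) * (S * M) $$ (k, c')) = (S' * (S * M)) $$ (?\<sigma> c, c')"
      by (rule index_mult_mat_sum[symmetric, OF carr(3) mult_carrier_mat[OF carr(2) M] \<sigma>[OF c(1)] c(2)])
    then show "mat (card P) (card P) (\<lambda>(c, c'). \<Sum>k<n. S' $$ (?\<sigma> c, k) * (S * M) $$ (k, c')) $$ (c, c') = ?N $$ (c, c')"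
      using c by (simp add: S'_S_cancel[OF M])
  qed auto
  then have m: "minor P (p, r) (S * M) = det ?N" unfolding minor_def by (simp only: fst_conv snd_conv)
  have "det ?N = 0 \<longleftrightarrow> (\<exists>v. v \<in> carrier_vec (card P) \<and> v \<noteq> 0\<^sub>v (card P) \<and> ?N *\<^sub>v v = 0\<^sub>v (card P))"
    by (rule det_0_iff_vec_prod_zero_field) simp
  also have "\<dots> \<longleftrightarrow> (\<exists>v\<in>carrier_vec (card P). v \<noteq> 0\<^sub>v (card P) \<and>
    (\<forall>q\<in>P. q \<noteq> tip p \<longrightarrow> (M *\<^sub>v v) $ q = 0) \<and> (M *\<^sub>v v) $ r = 0)"
  proof -
    have "?N *\<^sub>v v = 0\<^sub>v (card P) \<longleftrightarrow> (\<forall>q\<in>P. q \<noteq> tip p \<longrightarrow> (M *\<^sub>v v) $ q = 0) \<and> (M *\<^sub>v v) $ r = 0"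
      if v: "v \<in> carrier_vec (card P)" for v
    proof -
      have Nv: "(?N *\<^sub>v v) $ c = (M *\<^sub>v v) $ (?\<sigma> c)" if c: "c < card P" for c
      proof -
        have "(?N *\<^sub>v v) $ c = (\<Sum>k<card P. ?N $$ (c, k) * v $ k)"
          by (rule index_mult_mat_vec_sum[OF _ v c]) simp
        also have "\<dots> = (\<Sum>k<card P. M $$ (?\<sigma> c, k) * v $ k)"
          by (rule sum.cong) (use c in auto)
        also have "\<dots> = (M *\<^sub>v v) $ (?\<sigma> c)"
          by (rule index_mult_mat_vec_sum[symmetric, OF M v \<sigma>[OF c]])
        finally show ?thesis .
      qed
      have "?N *\<^sub>v v = 0\<^sub>v (card P) \<longleftrightarrow> (\<forall>c<card P. (M *\<^sub>v v) $ (?\<sigma> c) = 0)"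
      proof
        assume z: "?N *\<^sub>v v = 0\<^sub>v (card P)"
        show "\<forall>c<card P. (M *\<^sub>v v) $ (?\<sigma> c) = 0"
          by (intro allI impI) (subst Nv[symmetric], assumption, simp only: z, simp)
      next
        assume z: "\<forall>c<card P. (M *\<^sub>v v) $ (?\<sigma> c) = 0"
        show "?N *\<^sub>v v = 0\<^sub>v (card P)"
          by (rule eq_vecI) (use z Nv in auto)
      qed
      also have "\<dots> \<longleftrightarrow> (\<forall>q\<in>P. (M *\<^sub>v v) $ (if q = tip p then r else q) = 0)"
      proof
        assume z: "\<forall>c<card P. (M *\<^sub>v v) $ (?\<sigma> c) = 0"
        show "\<forall>q\<in>P. (M *\<^sub>v v) $ (if q = tip p then r else q) = 0"
        proof
          fix q assume "q \<in> P"
          then obtain c where "c < card P" "plist ! c = q" using plist_ex by blast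
          with z show "(M *\<^sub>v v) $ (if q = tip p then r else q) = 0" by auto
        qed
      next
        assume z: "\<forall>q\<in>P. (M *\<^sub>v v) $ (if q = tip p then r else q) = 0"
        show "\<forall>c<card P. (M *\<^sub>v v) $ (?\<sigma> c) = 0" using z plist_nth by blast
      qed
      also have "\<dots> \<longleftrightarrow> (\<forall>q\<in>P. q \<noteq> tip p \<longrightarrow> (M *\<^sub>v v) $ q = 0) \<and> (M *\<^sub>v v) $ r = 0"
        using height(1)[OF p(1)] by auto
      finally show ?thesis .
    qed
    then show ?thesis by blast
  qed
  finally show ?thesis unfolding m .
qed

lemma SMP_affine:
  "\<exists>U\<in>carrier_mat n (card P). \<exists>W\<in>carrier_mat n (card P).
    \<forall>s. S * MP (\<lambda>i. x i + s * (y i - x i)) = U + s \<cdot>\<^sub>m W"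
proof -
  have D: "MP y - MP x \<in> carrier_mat n (card P)" by (rule carrier_matI) simp_all
  have M: "S * MP (\<lambda>i. x i + s * (y i - x i)) = S * MP x + s \<cdot>\<^sub>m (S * (MP y - MP x))" for s
  proof -
    have e: "MP (\<lambda>i. x i + s * (y i - x i)) = MP x + s \<cdot>\<^sub>m (MP y - MP x)"
      by (rule eq_matI) (simp_all add: MP_def colf_affine[of x s y])
    have "S * (MP x + s \<cdot>\<^sub>m (MP y - MP x)) = S * MP x + S * (s \<cdot>\<^sub>m (MP y - MP x))"
      by (rule mult_add_distrib_mat[OF carr(2) MP_carrier smult_carrier_mat[OF D]])
    then show ?thesis using e mult_smult_distrib[OF carr(2) D, of s] by simp
  qed
  show ?thesis
  proof (rule bexI[of _ "S * MP x"])
    show "\<exists>W\<in>carrier_mat n (card P). \<forall>s. S * MP (\<lambda>i. x i + s * (y i - x i)) = S * MP x + s \<cdot>\<^sub>m W"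
      by (rule bexI[of _ "S * (MP y - MP x)"]) (use M mult_carrier_mat[OF carr(2) D] in auto)
  qed (rule SMP_carrier)
qed

lemma inv_grass_dim_lower_closed: "enat (card params) \<le> inv_grass_dim A (card P)"
proof -
  have n: "dim_row A = n" using carr(1) by simp
  let ?d = "card P"
  have "enat (card params) \<le> krull_dim (gr_sub_closed n ?d (invariant_subspaces A ?d))"
  proof (rule krull_dim_lower[OF inf, where \<Phi> = "\<lambda>x. S * MP x" and f = "minor P"])
    show "invariant_subspaces A ?d \<subseteq> grassmannian n ?d" using n by (auto simp: invariant_subspaces_def)
    show "S * MP x \<in> stiefel n ?d" for x by (rule SMP_stiefel)
    show "colspan (S * MP x) \<in> invariant_subspaces A ?d" for x by (rule SMP_invariant)
    show "\<exists>U\<in>carrier_mat n ?d. \<exists>W\<in>carrier_mat n ?d. \<forall>s. S * MP (\<lambda>i. x i + s * (y i - x i)) = U + s \<cdot>\<^sub>m W" for x y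
      by (rule SMP_affine)
    show "finite params" by simp
    show "minor P \<rho> \<in> poly_fun n ?d" for \<rho> by (rule minor_poly)
  next
    fix \<rho> and x :: "nat \<times> nat \<Rightarrow> 'k" and g :: "'k mat" assume \<rho>: "\<rho> \<in> params" "x \<rho> = 0" and g: "g \<in> GL ?d"
    obtain p r where pr: "\<rho> = (p, r)" by force
    from \<rho> pr have p: "p \<in> P" and r: "r < n" and prm: "(p, r) \<in> params" by (auto simp: params_def)
    from plist_ex[OF height(1)[OF p]] obtain c where c: "c < ?d" "plist ! c = tip p" by blast
    from g obtain h where h: "h \<in> GL ?d" "g * h = 1\<^sub>m ?d" by (rule GL_inverse)
    \<comment> \<open>This \<open>v\<close> makes \<open>MP x * g *\<^sub>v v\<close> the column of
      \<open>tip p\<close>. It vanishes at the other pivots, and at \<open>r\<close> because the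
      parameter is 0.\<close>
    define v where "v = h *\<^sub>v unit_vec ?d c"
    have gc: "g \<in> carrier_mat ?d ?d" and hc: "h \<in> carrier_mat ?d ?d" using g h by (auto dest: GL_carrier)
    have v: "v \<in> carrier_vec ?d" unfolding v_def using hc by simp
    have gv: "g *\<^sub>v v = unit_vec ?d c"
      unfolding v_def using assoc_mult_mat_vec[OF gc hc, of "unit_vec ?d c"] h(2) by simp
    have "v \<noteq> 0\<^sub>v ?d"
    proof
      assume "v = 0\<^sub>v ?d"
      then have "g *\<^sub>v v = 0\<^sub>v ?d" using gc by (intro eq_vecI) auto
      with gv have "unit_vec ?d c = (0\<^sub>v ?d :: 'k vec)" by simp
      with c(1) show False by simp
    qed
    moreover have val: "(MP x * g *\<^sub>v v) $ q = colf x (tip p) q" if q: "q < n" for q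
    proof -
      have "MP x * g *\<^sub>v v = col (MP x) c"
        unfolding assoc_mult_mat_vec[OF MP_carrier gc v] gv by (rule mult_mat_unit_vec[OF MP_carrier c(1)])
      then show ?thesis using q c by (simp add: MP_def)
    qed
    ultimately have "minor P (p, r) (S * (MP x * g)) = 0"
      unfolding minor_zero_iff[OF mult_carrier_mat[OF MP_carrier gc] prm]
      using v r colf_tip[OF prm, of _ x] \<rho> P_less pr prm
      by (intro bexI[of _ v]) (auto simp: params_def)
    then show "minor P \<rho> (S * MP x * g) = 0" unfolding pr assoc_mult_mat[OF carr(2) MP_carrier gc] .
  next
    fix \<rho> assume \<rho>: "\<rho> \<in> params"
    obtain p r where pr: "\<rho> = (p, r)" by force
    let ?x = "\<lambda>i. if i = \<rho> then 1 else 0 :: 'k"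
    from \<rho> pr have p: "p \<in> P" and r: "r < n" "r \<notin> P" and prm: "(p, r) \<in> params" by (auto simp: params_def)
    from plist_ex[OF height(1)[OF p]] obtain c where c: "c < ?d" "plist ! c = tip p" by blast
    show "minor P \<rho> (S * MP ?x) \<noteq> 0"
    proof
      assume "minor P \<rho> (S * MP ?x) = 0"
      then obtain v where v: "v \<in> carrier_vec ?d" "v \<noteq> 0\<^sub>v ?d"
        "\<And>q. q \<in> P \<Longrightarrow> q \<noteq> tip p \<Longrightarrow> (MP ?x *\<^sub>v v) $ q = 0" "(MP ?x *\<^sub>v v) $ r = 0"
        unfolding pr minor_zero_iff[OF MP_carrier prm] by blast
      \<comment> \<open>Subtracting \<open>a\<close> times the column of the tip leaves a vector
        that is 0 on all pivot rows, hence 0. Row \<open>r\<close>, where the parameter is 1, then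
        gives \<open>a = 0\<close>.\<close>
      define a where "a = (MP ?x *\<^sub>v v) $ tip p"
      have uc: "unit_vec ?d c \<in> carrier_vec ?d" by simp
      define w where "w = v + (- a) \<cdot>\<^sub>v unit_vec ?d c"
      have w: "w \<in> carrier_vec ?d" unfolding w_def using v(1) by simp
      have Mw: "(MP ?x *\<^sub>v w) $ q = (MP ?x *\<^sub>v v) $ q + (- a) * colf ?x (tip p) q" if q: "q < n" for q
      proof -
        have "MP ?x *\<^sub>v w = MP ?x *\<^sub>v v + (- a) \<cdot>\<^sub>v (MP ?x *\<^sub>v unit_vec ?d c)"
          unfolding w_def using mult_add_distrib_mat_vec[OF MP_carrier v(1), of "(- a) \<cdot>\<^sub>v unit_vec ?d c"]
            mult_mat_vec[OF MP_carrier uc] by simp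
        also have "\<dots> = MP ?x *\<^sub>v v + (- a) \<cdot>\<^sub>v col (MP ?x) c"
          using mult_mat_unit_vec[OF MP_carrier c(1)] by simp
        finally show ?thesis using q c v(1) by (simp add: MP_def)
      qed
      have "w = 0\<^sub>v ?d"
      proof (rule MP_rows_zero[OF w])
        fix q assume q: "q \<in> P"
        show "(MP ?x *\<^sub>v w) $ q = 0"
          using Mw[OF P_less[OF q]] v(3)[OF q] colf_tip[OF prm, of q ?x] q r(2) a_def by (cases "q = tip p") auto
      qed
      then have "(MP ?x *\<^sub>v w) $ r = 0" using r(1) index_mult_mat_vec_sum[OF MP_carrier w r(1)] by simp
      then have "a = 0" using Mw[OF r(1)] v(4) colf_tip[OF prm, of r ?x] pr by simp
      then have "w = v" unfolding w_def using v(1) by (intro eq_vecI) auto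
      with \<open>w = 0\<^sub>v ?d\<close> v(2) show False by simp
    qed
  qed
  then show ?thesis unfolding inv_grass_dim_def n .
qed

end

lemma stiefel_mult_left:
  fixes S :: "'k::field mat"
  assumes M: "M \<in> stiefel n d" and S: "S \<in> carrier_mat n n" "S' \<in> carrier_mat n n" "S' * S = 1\<^sub>m n"
  shows "S * M \<in> stiefel n d"
proof -
  have Mc: "M \<in> carrier_mat n d" by (rule stiefel_carrier[OF M])
  have "v = 0\<^sub>v d" if v: "v \<in> carrier_vec d" "S * M *\<^sub>v v = 0\<^sub>v n" for v
  proof -
    have Mv: "M *\<^sub>v v \<in> carrier_vec n" by (rule mult_mat_vec_carrier[OF Mc v(1)])
    have "S *\<^sub>v (M *\<^sub>v v) = 0\<^sub>v n" using v(2) unfolding assoc_mult_mat_vec[OF S(1) Mc v(1)] .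
    then have "S' * S *\<^sub>v (M *\<^sub>v v) = S' *\<^sub>v 0\<^sub>v n" unfolding assoc_mult_mat_vec[OF S(2,1) Mv] by simp
    also have "\<dots> = 0\<^sub>v n" using S(2) by (intro eq_vecI) auto
    finally have "M *\<^sub>v v = 0\<^sub>v n" using S(3) Mv by simp
    with M v(1) show ?thesis by (simp add: stiefel_def)
  qed
  then show ?thesis using mult_carrier_mat[OF S(1) Mc] by (simp add: stiefel_def)
qed

text \<open>Extension by zero identifies vectors with functions supported below
  \<open>n\<close>.\<close>

definition vec_fun :: "nat \<Rightarrow> 'k::zero vec \<Rightarrow> nat \<Rightarrow> 'k" where
  "vec_fun n w i = (if i < n then w $ i else 0)"


context jordan_shape
begin

lemma jmat_vec_fun:
  assumes "w \<in> carrier_vec n"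
  shows "vec_fun n (jmat *\<^sub>v w) = jop (vec_fun n w)"
proof
  fix i
  show "vec_fun n (jmat *\<^sub>v w) i = jop (vec_fun n w) i"
  proof (cases "i < n")
    case True
    have "(jmat *\<^sub>v w) $ i = (\<Sum>k<n. jmat $$ (i, k) * w $ k)"
      by (rule index_mult_mat_vec_sum[OF jmat_carrier assms True])
    also have "\<dots> = (\<Sum>k<n. jmat $$ (i, k) * vec_fun n w k)" by (rule sum.cong) (auto simp: vec_fun_def)
    also have "\<dots> = jop (vec_fun n w) i" by (rule jmat_sum[OF True])
    finally show ?thesis using True by (simp add: vec_fun_def)
  qed (simp add: vec_fun_def jop_def)
qed

lemma invariant_vec_fun:
  assumes M: "M \<in> carrier_mat n d" and inv: "\<And>w. w \<in> colspan M \<Longrightarrow> jmat *\<^sub>v w \<in> colspan M"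
  shows "invariant (vec_fun n ` colspan M)"
proof -
  have c: "w \<in> carrier_vec n" if "w \<in> colspan M" for w using that M by (auto simp: colspan_def)
  have add: "v + w \<in> colspan M" if vw: "v \<in> colspan M" "w \<in> colspan M" for v w
  proof -
    from vw M obtain a b where ab: "a \<in> carrier_vec d" "v = M *\<^sub>v a" "b \<in> carrier_vec d" "w = M *\<^sub>v b"
      by (auto simp: colspan_def)
    then have "v + w = M *\<^sub>v (a + b)" by (simp add: mult_add_distrib_mat_vec[OF M])
    then show ?thesis using ab M by (auto simp: colspan_def intro!: exI[of _ "a + b"])
  qed
  have smult: "k \<cdot>\<^sub>v v \<in> colspan M" if v: "v \<in> colspan M" for v k
  proof -
    from v M obtain a where a: "a \<in> carrier_vec d" "v = M *\<^sub>v a" by (auto simp: colspan_def)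
    then have "k \<cdot>\<^sub>v v = M *\<^sub>v (k \<cdot>\<^sub>v a)" by (simp add: mult_mat_vec[OF M])
    then show ?thesis using a M by (auto simp: colspan_def intro!: exI[of _ "k \<cdot>\<^sub>v a"])
  qed
  have zero: "0\<^sub>v n \<in> colspan M"
    using M by (auto simp: colspan_def intro!: exI[of _ "0\<^sub>v d"] eq_vecI)
  show ?thesis
    unfolding invariant_def
  proof (intro conjI ballI allI impI)
    show "(\<lambda>_. 0) \<in> vec_fun n ` colspan M"
      by (rule image_eqI[OF _ zero]) (auto simp: vec_fun_def)
    fix f assume "f \<in> vec_fun n ` colspan M"
    then obtain v where v: "v \<in> colspan M" "f = vec_fun n v" by auto
    show "(\<lambda>i. k * f i) \<in> vec_fun n ` colspan M" for k
      by (rule image_eqI[OF _ smult[OF v(1), of k]]) (use c[OF v(1)] in \<open>auto simp: v vec_fun_def\<close>)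
    show "f i = 0" if "n \<le> i" for i using that by (simp add: v vec_fun_def)
    show "jop f \<in> vec_fun n ` colspan M"
      by (rule image_eqI[OF _ inv[OF v(1)]]) (simp add: v jmat_vec_fun[OF c[OF v(1)]])
    fix g assume "g \<in> vec_fun n ` colspan M"
    then obtain w where w: "w \<in> colspan M" "g = vec_fun n w" by auto
    show "(\<lambda>i. f i + g i) \<in> vec_fun n ` colspan M"
      by (rule image_eqI[OF _ add[OF v(1) w(1)]]) (use c[OF v(1)] c[OF w(1)] in \<open>auto simp: v w vec_fun_def\<close>)
  qed
qed

text \<open>Two applications of Steinitz: the reduced vectors are independent since each is 1 at its
  own pivot and 0 at the others, and the columns of a frame are independent. Each family lies in the
  span of the other.\<close>

lemma card_leads:
  assumes M: "M \<in> stiefel n d" and V: "invariant (vec_fun n ` colspan M)"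
  shows "card (leads (vec_fun n ` colspan M)) = d"
proof -
  let ?V = "vec_fun n ` colspan M"
  let ?P = "leads ?V"
  note Mc = stiefel_carrier[OF M]
  have colV: "vec_fun n (col M j) \<in> ?V" if "j < d" for j using col_in_colspan[OF Mc that] by blast
  have "card ?P \<le> d"
  proof (rule ccontr)
    let ?B = "(\<lambda>j. vec_fun n (col M j)) ` {..<d}"
    assume "\<not> card ?P \<le> d"
    moreover have "card ?B \<le> d" using card_image_le[of "{..<d}" "\<lambda>j. vec_fun n (col M j)"] by simp
    ultimately have lt: "card ?B < card ?P" by linarith
    have sp: "red ?V p \<in> fs.span ?B" if p: "p \<in> ?P" for p
    proof -
      from red(1)[OF V p] obtain v where v: "v \<in> carrier_vec d" "red ?V p = vec_fun n (M *\<^sub>v v)"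
        using Mc by (auto simp: colspan_def)
      have "vec_fun n (M *\<^sub>v v) = (\<Sum>j<d. (\<lambda>i. v $ j * vec_fun n (col M j) i))"
      proof
        fix i
        show "vec_fun n (M *\<^sub>v v) i = (\<Sum>j<d. (\<lambda>i. v $ j * vec_fun n (col M j) i)) i"
        proof (cases "i < n")
          case True
          then show ?thesis unfolding sum_fun_apply using index_mult_mat_vec_sum[OF Mc v(1) True] Mc
            by (simp add: vec_fun_def mult.commute)
        qed (simp add: vec_fun_def sum_fun_apply)
      qed
      also have "\<dots> \<in> fs.span ?B" by (intro fs.span_sum fs.span_scale fs.span_base) auto
      finally show ?thesis using v(2) by simp
    qed
    have "\<exists>c. (\<exists>a\<in>?P. c a \<noteq> 0) \<and> (\<forall>x. (\<Sum>a\<in>?P. c a * red ?V a x) = 0)"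
      by (rule linear_relation_exists[OF finite_leads[OF V] sp _ lt]) auto
    then obtain c p where c: "p \<in> ?P" "c p \<noteq> 0" "\<And>x. (\<Sum>a\<in>?P. c a * red ?V a x) = 0" by blast
    have "(\<Sum>a\<in>?P. c a * red ?V a p) = (\<Sum>a\<in>{p}. c a * red ?V a p)"
      by (rule sum.mono_neutral_right[OF finite_leads[OF V]]) (use c(1) red(4)[OF V] in auto)
    with c red(2)[OF V c(1)] show False by simp
  qed
  moreover have "d \<le> card ?P"
  proof (rule ccontr)
    let ?B = "red ?V ` ?P"
    assume "\<not> d \<le> card ?P"
    then have lt: "card ?B < card {..<d}"
      using card_image_le[OF finite_leads[OF V], of "red ?V"] by simp
    have sp: "vec_fun n (col M j) \<in> fs.span ?B" if "j \<in> {..<d}" for j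
    proof -
      let ?f = "vec_fun n (col M j)"
      have fV: "?f \<in> ?V" using colV that by simp
      have "?f = (\<Sum>p\<in>?P. (\<lambda>i. ?f p * red ?V p i))"
        by (rule ext, unfold sum_fun_apply, rule red_expand[OF V fV])
      also have "\<dots> \<in> fs.span ?B" by (intro fs.span_sum fs.span_scale fs.span_base) auto
      finally show ?thesis .
    qed
    have "\<exists>c. (\<exists>a\<in>{..<d}. c a \<noteq> 0) \<and> (\<forall>x. (\<Sum>a<d. c a * vec_fun n (col M a) x) = 0)"
      by (rule linear_relation_exists[OF _ sp _ lt]) (use finite_leads[OF V] in auto)
    then obtain c j where c: "j < d" "c j \<noteq> 0" "\<And>x. (\<Sum>a<d. c a * vec_fun n (col M a) x) = 0" by auto
    have "M *\<^sub>v vec d c = 0\<^sub>v n"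
    proof (rule eq_vecI)
      fix i assume "i < dim_vec (0\<^sub>v n)"
      then have i: "i < n" by simp
      have "(M *\<^sub>v vec d c) $ i = (\<Sum>k<d. M $$ (i, k) * vec d c $ k)"
        by (rule index_mult_mat_vec_sum[OF Mc _ i]) simp
      also have "\<dots> = (\<Sum>a<d. c a * vec_fun n (col M a) i)"
        by (rule sum.cong) (use i Mc in \<open>auto simp: vec_fun_def\<close>)
      finally show "(M *\<^sub>v vec d c) $ i = 0\<^sub>v n $ i" using c(3) i by simp
    qed (use Mc in auto)
    with M have "vec d c = 0\<^sub>v d" by (simp add: stiefel_def)
    then have "vec d c $ j = 0" using c(1) by simp
    with c show False by simp
  qed
  ultimately show ?thesis by simp
qed

end

context jordan_similar
begin

text \<open>The frame \<open>S' * M\<close> spans a subspace invariant under the Jordan matrix. The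
  echelon columns lie in that subspace and are as many as its dimension, so they form another frame
  of it.\<close>

lemma invariant_subspace_cover:
  assumes W: "W \<in> invariant_subspaces A d"
  shows "\<exists>P. shift_closed n ev lev P \<and> card P = d \<and> (\<exists>x. W = colspan (S * shift_closed.MP n ev lev P x))"
proof -
  have n: "dim_row A = n" using carr by simp
  from W obtain M where M: "M \<in> stiefel n d" "W = colspan M" and AW: "\<And>w. w \<in> W \<Longrightarrow> A *\<^sub>v w \<in> W"
    by (auto simp: invariant_subspaces_def grassmannian_def n)
  note Mc = stiefel_carrier[OF M(1)]
  define M0 where "M0 = S' * M"
  have M0: "M0 \<in> stiefel n d" unfolding M0_def by (rule stiefel_mult_left[OF M(1) carr(3,2) SS'(1)])
  note M0c = stiefel_carrier[OF M0]
  have inv: "jmat *\<^sub>v w \<in> colspan M0" if w: "w \<in> colspan M0" for w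
  proof -
    from w M0c obtain v where v: "v \<in> carrier_vec d" "w = M0 *\<^sub>v v" by (auto simp: colspan_def)
    have Mv: "M *\<^sub>v v \<in> carrier_vec n" by (rule mult_mat_vec_carrier[OF Mc v(1)])
    have wS: "w = S' *\<^sub>v (M *\<^sub>v v)" unfolding v(2) M0_def by (rule assoc_mult_mat_vec[OF carr(3) Mc v(1)])
    have "M *\<^sub>v v \<in> W" unfolding M(2) colspan_def using v(1) Mc by auto
    from AW[OF this] obtain u where u: "u \<in> carrier_vec d" "A *\<^sub>v (M *\<^sub>v v) = M *\<^sub>v u"
      unfolding M(2) colspan_def using Mc by auto
    have "jmat *\<^sub>v w = (jmat * S') *\<^sub>v (M *\<^sub>v v)"
      unfolding wS by (rule assoc_mult_mat_vec[symmetric, OF jmat_carrier carr(3) Mv])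
    also have "\<dots> = S' *\<^sub>v (A *\<^sub>v (M *\<^sub>v v))"
      unfolding S'A[symmetric] by (rule assoc_mult_mat_vec[OF carr(3,1) Mv])
    also have "\<dots> = M0 *\<^sub>v u"
      unfolding u(2) M0_def by (rule assoc_mult_mat_vec[symmetric, OF carr(3) Mc u(1)])
    finally show ?thesis unfolding colspan_def using u(1) M0c by auto
  qed
  let ?V = "vec_fun n ` colspan M0"
  let ?P = "leads ?V"
  have V: "invariant ?V" by (rule invariant_vec_fun[OF M0c inv])
  have cd: "card ?P = d" by (rule card_leads[OF M0 V])
  interpret P: shift_closed n ev lev ?P by (rule leads_shift_closed[OF V])
  interpret J: jordan_similar_closed n ev lev A S S' ?P by unfold_locales
  define x where "x = (\<lambda>(p', r). red ?V (P.tip p') r)"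
  have MPst: "P.MP x \<in> stiefel n d"
    using stiefel_if_left_GL[OF P.MP_carrier P.rowsel_carrier P.rowsel_GL] cd by simp
  have "col (P.MP x) c \<in> colspan M0" if c: "c < d" for c
  proof -
    have p: "P.plist ! c \<in> ?P" using P.plist_nth cd c by simp
    have "P.colf x (P.plist ! c) \<in> ?V" unfolding x_def by (rule colf_leads[OF V p])
    then obtain w where w: "w \<in> colspan M0" "P.colf x (P.plist ! c) = vec_fun n w" by auto
    have wc: "w \<in> carrier_vec n" using w(1) M0c by (auto simp: colspan_def)
    have "col (P.MP x) c = w"
    proof (rule eq_vecI)
      fix i assume i: "i < dim_vec w"
      then have "i < n" using wc by simp
      then have "col (P.MP x) c $ i = P.colf x (P.plist ! c) i" using c cd by (simp add: P.MP_def)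
      then show "col (P.MP x) c $ i = w $ i" using \<open>i < n\<close> by (simp add: w(2) vec_fun_def)
    qed (use wc in simp)
    with w(1) show ?thesis by simp
  qed
  from colspan_colsD[OF M0 MPst this] obtain g where g: "g \<in> GL d" "P.MP x = M0 * g" by blast
  have "M0 * g = S' * (M * g)" unfolding M0_def by (rule assoc_mult_mat[OF carr(3) Mc GL_carrier[OF g(1)]])
  with g(2) have "S * P.MP x = S * (S' * (M * g))" by simp
  also have "\<dots> = (S * S') * (M * g)"
    by (rule assoc_mult_mat[symmetric, OF carr(2,3) mult_carrier_mat[OF Mc GL_carrier[OF g(1)]]])
  also have "\<dots> = M * g"
    unfolding SS' by (rule left_mult_one_mat[OF mult_carrier_mat[OF Mc GL_carrier[OF g(1)]]])
  finally have "colspan (S * P.MP x) = W" using stiefel_mult_GL(2)[OF M(1) g(1)] M(2) by simp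
  then show ?thesis using P.shift_closed_axioms cd by blast
qed

lemma inv_grass_dim_upper:
  assumes E: "\<And>P. shift_closed n ev lev P \<Longrightarrow> card P = d \<Longrightarrow> card (shift_closed.params n ev lev P) \<le> E"
  shows "inv_grass_dim A d \<le> enat E"
proof -
  have n: "dim_row A = n" using carr(1) by simp
  let ?S = "{P. shift_closed n ev lev P \<and> card P = d}"
  let ?\<Phi> = "\<lambda>P x. S * shift_closed.MP n ev lev P x"
  have cl: "jordan_similar_closed n ev lev A S S' P" if "shift_closed n ev lev P" for P
    using that jordan_similar_axioms by (simp add: jordan_similar_closed_def)
  have "krull_dim (gr_sub_closed n d (invariant_subspaces A d)) \<le> enat E"
  proof (rule krull_dim_upper[OF inf, where S = ?S and \<Phi> = ?\<Phi> and R = "shift_closed.params n ev lev"])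
    show "invariant_subspaces A d \<subseteq> grassmannian n d" using n by (auto simp: invariant_subspaces_def)
    show "finite ?S"
    proof (rule finite_subset)
      show "?S \<subseteq> Pow {..<n}" by (auto dest: shift_closed.P_less)
    qed simp
    fix P assume P: "P \<in> ?S"
    then interpret jordan_similar_closed n ev lev A S S' P using cl by simp
    from P have d: "card P = d" by simp
    show "finite params \<and> card params \<le> E" using E P by simp
    show "S * MP x \<in> carrier_mat n d" for x using SMP_carrier d by simp
    fix i j assume ij: "i < n" "j < d"
    have "(\<lambda>x. (S * MP x) $$ (i, j)) = (\<lambda>x. \<Sum>k<n. S $$ (i, k) * colf x (plist ! j) k)"
    proof
      fix x
      have "(S * MP x) $$ (i, j) = (\<Sum>k<n. S $$ (i, k) * MP x $$ (k, j))"
        by (rule index_mult_mat_sum[OF carr(2) MP_carrier]) (use ij d in auto)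
      also have "\<dots> = (\<Sum>k<n. S $$ (i, k) * colf x (plist ! j) k)"
        by (rule sum.cong) (use ij d in \<open>auto simp: MP_def\<close>)
      finally show "(S * MP x) $$ (i, j) = (\<Sum>k<n. S $$ (i, k) * colf x (plist ! j) k)" .
    qed
    also have "\<dots> \<in> poly_map params"
      by (intro poly_map_sum poly_map_mult poly_map_const colf_poly plist_nth) (use ij d in simp)
    finally show "(\<lambda>x. (S * MP x) $$ (i, j)) \<in> poly_map params" .
  next
    fix W assume "W \<in> invariant_subspaces A d"
    from invariant_subspace_cover[OF this] obtain P x where P: "shift_closed n ev lev P" "card P = d" "W = colspan (?\<Phi> P x)" by blast
    interpret jordan_similar_closed n ev lev A S S' P by (rule cl[OF P(1)])
    show "\<exists>P\<in>?S. \<exists>x. \<exists>L\<in>carrier_mat d n. W = colspan (?\<Phi> P x) \<and> L * ?\<Phi> P x \<in> GL d"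
    proof (intro bexI exI conjI)
      show "W = colspan (?\<Phi> P x)" by (rule P(3))
      show "rowsel * S' * ?\<Phi> P x \<in> GL d" using left_GL P(2) by simp
      show "rowsel * S' \<in> carrier_mat d n" using mult_carrier_mat[OF rowsel_carrier carr(3)] P(2) by simp
    qed (use P in simp)
  qed
  then show ?thesis unfolding inv_grass_dim_def n .
qed

lemma inv_grass_dim_lower:
  assumes "shift_closed n ev lev P"
  shows "enat (card (shift_closed.params n ev lev P)) \<le> inv_grass_dim A (card P)"
proof -
  interpret jordan_similar_closed n ev lev A S S' P
    using assms jordan_similar_axioms by (simp add: jordan_similar_closed_def)
  show ?thesis by (rule inv_grass_dim_lower_closed)
qed

end

section \<open>The dimension formula\<close>

text \<open>A pair \<open>(c, a)\<close> in the multiset stands for a graded piece of dimension \<open>c\<close> of the kernel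
  filtration that meets the subspace in dimension \<open>a\<close>.\<close>

definition feasible :: "nat multiset \<Rightarrow> nat \<Rightarrow> nat \<Rightarrow> bool" where
  "feasible M d v \<longleftrightarrow> (\<exists>K. image_mset fst K = M \<and> (\<forall>(c, a)\<in>#K. a \<le> c) \<and>
     sum_mset (image_mset snd K) = d \<and> sum_mset (image_mset (\<lambda>(c, a). a * (c - a)) K) = v)"

text \<open>Pairs in a multiset carry no labels. They are attached to the elements of
  \<open>S\<close> again, and among equal values of \<open>c\<close> any matching will do.\<close>

lemma image_mset_fst_lift:
  assumes "finite S" "image_mset fst K = image_mset c (mset_set S)"
  shows "\<exists>a. K = image_mset (\<lambda>l. (c l, a l)) (mset_set S)"
  using assms
proof (induct S arbitrary: K rule: finite_induct)
  case (insert l S)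
  then have "image_mset fst K = add_mset (c l) (image_mset c (mset_set S))" by simp
  then obtain K' p where K: "K = add_mset p K'" "fst p = c l" "image_mset fst K' = image_mset c (mset_set S)"
    by (auto dest!: msed_map_invR)
  from insert(3)[OF K(3)] obtain a where a: "K' = image_mset (\<lambda>l. (c l, a l)) (mset_set S)" by blast
  have "image_mset (\<lambda>l'. (c l', (a(l := snd p)) l')) (mset_set S) = K'"
    unfolding a by (rule image_mset_cong) (use insert(1,2) in auto)
  then have "K = image_mset (\<lambda>l'. (c l', (a(l := snd p)) l')) (mset_set (insert l S))"
    using K insert(1,2) by (simp add: prod_eq_iff)
  then show ?case by blast
qed simp

section \<open>Counting pivots on the levels\<close>

context jordan_shape
begin

definition L :: "nat \<Rightarrow> 'k \<times> nat" where "L k = (ev k, lev k)"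
definition LS :: "('k \<times> nat) set" where "LS = L ` {..<n}"
text \<open>For \<open>l = (e, j)\<close> this is the dimension of ker \<open>(J - e)^(j+1)\<close>
  modulo ker \<open>(J - e)^j\<close>, where \<open>J\<close> is \<open>jmat\<close>.\<close>

definition cnt :: "('k \<times> nat) \<Rightarrow> nat" where "cnt l = card {k. k < n \<and> L k = l}"
definition levels :: "nat multiset" where "levels = image_mset cnt (mset_set LS)"

lemma finite_LS [simp]: "finite LS" by (simp add: LS_def)

lemma L_Suc:
  assumes "k < n" "L k = (e, Suc j)"
  shows "0 < k" "L (k - 1) = (e, j)"
  using pred[of k] assms by (auto simp: L_def)

lemma LS_pred: "(e, Suc j) \<in> LS \<Longrightarrow> (e, j) \<in> LS"
proof -
  assume "(e, Suc j) \<in> LS"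
  then obtain k where k: "(e, Suc j) = L k" "k \<in> {..<n}" unfolding LS_def by (rule imageE)
  then have "L (k - 1) = (e, j)" using L_Suc(2)[of k e j] by simp
  moreover have "k - 1 \<in> {..<n}" using k(2) by auto
  ultimately show "(e, j) \<in> LS" unfolding LS_def by (metis imageI)
qed

lemma L_in_LS: "k < n \<Longrightarrow> L k \<in> LS" by (simp add: LS_def)

lemma cnt_Suc: "cnt (e, Suc j) \<le> cnt (e, j)"
  unfolding cnt_def
proof (rule card_inj_on_le[where f = "\<lambda>k. k - 1"])
  show "inj_on (\<lambda>k. k - 1) {k. k < n \<and> L k = (e, Suc j)}"
  proof (rule inj_onI)
    fix x y assume xy: "x \<in> {k. k < n \<and> L k = (e, Suc j)}" "y \<in> {k. k < n \<and> L k = (e, Suc j)}" "x - 1 = y - 1"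
    then have "0 < x" "0 < y" using L_Suc(1) by auto
    with xy(3) show "x = y" by simp
  qed
  show "(\<lambda>k. k - 1) ` {k. k < n \<and> L k = (e, Suc j)} \<subseteq> {k. k < n \<and> L k = (e, j)}"
    using L_Suc(2) by auto
qed simp

definition pcnt :: "nat set \<Rightarrow> ('k \<times> nat) \<Rightarrow> nat" where "pcnt P l = card {k \<in> P. L k = l}"

lemma pcnt_le: "P \<subseteq> {..<n} \<Longrightarrow> pcnt P l \<le> cnt l"
  unfolding pcnt_def cnt_def by (rule card_mono) auto

lemma sum_pcnt:
  assumes "P \<subseteq> {..<n}"
  shows "(\<Sum>l\<in>LS. pcnt P l) = card P"
proof -
  have fin: "finite P" using assms finite_subset by blast
  have "card P = card (\<Union>l\<in>LS. {k \<in> P. L k = l})"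
    by (rule arg_cong[of _ _ card]) (use assms in \<open>auto simp: LS_def\<close>)
  also have "\<dots> = (\<Sum>l\<in>LS. pcnt P l)" unfolding pcnt_def
    by (rule card_UN_disjoint) (use fin in auto)
  finally show ?thesis by simp
qed

lemma card_params:
  assumes P: "shift_closed n ev lev P"
  shows "card (shift_closed.params n ev lev P) = (\<Sum>l\<in>LS. pcnt P l * (cnt l - pcnt P l))"
proof -
  interpret shift_closed n ev lev P by (rule P)
  have eq: "params = (\<Union>l\<in>LS. {k \<in> P. L k = l} \<times> {k. k < n \<and> k \<notin> P \<and> L k = l})"
  proof (rule Set.set_eqI)
    fix pr :: "nat \<times> nat"
    obtain p r where pr: "pr = (p, r)" by force
    have "L p \<in> LS" if "p \<in> P" using that P_less L_in_LS by blast
    then show "pr \<in> params \<longleftrightarrow> pr \<in> (\<Union>l\<in>LS. {k \<in> P. L k = l} \<times> {k. k < n \<and> k \<notin> P \<and> L k = l})"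
      unfolding pr by (auto simp: params_def L_def)
  qed
  have "card params = (\<Sum>l\<in>LS. card ({k \<in> P. L k = l} \<times> {k. k < n \<and> k \<notin> P \<and> L k = l}))"
    unfolding eq by (rule card_UN_disjoint) auto
  also have "\<dots> = (\<Sum>l\<in>LS. pcnt P l * (cnt l - pcnt P l))"
  proof (rule sum.cong[OF refl])
    fix l
    have "{k. k < n \<and> k \<notin> P \<and> L k = l} = {k. k < n \<and> L k = l} - {k \<in> P. L k = l}" by auto
    then have "card {k. k < n \<and> k \<notin> P \<and> L k = l} = cnt l - pcnt P l"
      unfolding cnt_def pcnt_def using PN by (simp only:) (rule card_Diff_subset, auto)
    then show "card ({k \<in> P. L k = l} \<times> {k. k < n \<and> k \<notin> P \<and> L k = l}) = pcnt P l * (cnt l - pcnt P l)"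
      by (simp add: card_cartesian_product pcnt_def)
  qed
  finally show ?thesis .
qed

lemma params_feasible:
  assumes P: "shift_closed n ev lev P"
  shows "feasible levels (card P) (card (shift_closed.params n ev lev P))"
  unfolding feasible_def
proof (intro exI conjI)
  from P have PN: "P \<subseteq> {..<n}" by (simp add: shift_closed_def shift_closed_axioms_def)
  let ?K = "image_mset (\<lambda>l. (cnt l, pcnt P l)) (mset_set LS)"
  show "image_mset fst ?K = levels" by (simp add: levels_def multiset.map_comp o_def)
  show "\<forall>(c, a)\<in>#?K. a \<le> c" using pcnt_le[OF PN] by auto
  show "sum_mset (image_mset snd ?K) = card P"
    using sum_pcnt[OF PN] by (simp add: multiset.map_comp o_def sum_unfold_sum_mset)
  show "sum_mset (image_mset (\<lambda>(c, a). a * (c - a)) ?K) = card (shift_closed.params n ev lev P)"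
    unfolding card_params[OF P] by (simp add: multiset.map_comp o_def sum_unfold_sum_mset)
qed

text \<open>Exchanging the values of \<^term>\<open>a\<close> on two consecutive levels where it increases does not
  decrease \<open>\<Sum>a(c - a)\<close>, because \<^term>\<open>cnt\<close> is nonincreasing in the level.\<close>

lemma decreasing_optimum:
  assumes a: "\<And>l. l \<in> LS \<Longrightarrow> a l \<le> cnt l"
  shows "\<exists>b. (\<forall>l\<in>LS. b l \<le> cnt l) \<and> (\<Sum>l\<in>LS. b l) = (\<Sum>l\<in>LS. a l) \<and>
    (\<Sum>l\<in>LS. a l * (cnt l - a l)) \<le> (\<Sum>l\<in>LS. b l * (cnt l - b l)) \<and>
    (\<forall>e j. (e, Suc j) \<in> LS \<longrightarrow> b (e, Suc j) \<le> b (e, j))"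
  using a
proof (induct "\<Sum>l\<in>LS. a l * snd l" arbitrary: a rule: less_induct)
  case less
  show ?case
  proof (cases "\<exists>e j. (e, Suc j) \<in> LS \<and> a (e, j) < a (e, Suc j)")
    case False
    then show ?thesis using less(2) by (intro exI[of _ a]) (auto simp: not_less)
  next
    case True
    then obtain e j where ej: "(e, Suc j) \<in> LS" "a (e, j) < a (e, Suc j)" by blast
    define l l' where "l = (e, j)" and "l' = (e, Suc j)"
    have ll: "l \<in> LS" "l' \<in> LS" "l \<noteq> l'" using ej LS_pred by (auto simp: l_def l'_def)
    define b where "b = a(l := a l', l' := a l)"
    have b: "b l = a l'" "b l' = a l" "\<And>k. k \<noteq> l \<Longrightarrow> k \<noteq> l' \<Longrightarrow> b k = a k"
      using ll by (auto simp: b_def)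
    have lt: "a l < a l'" using ej by (simp add: l_def l'_def)
    have cc: "cnt l' \<le> cnt l" using cnt_Suc by (simp add: l_def l'_def)
    have split: "(\<Sum>k\<in>LS. f k) = f l + f l' + (\<Sum>k\<in>LS - {l, l'}. f k)" for f :: "'k \<times> nat \<Rightarrow> nat"
      using ll by (simp add: sum.remove[of LS l] sum.remove[of "LS - {l}" l'] Diff_insert2[symmetric])
    have rest: "(\<Sum>k\<in>LS - {l, l'}. g k (b k)) = (\<Sum>k\<in>LS - {l, l'}. g k (a k))" for g :: "'k \<times> nat \<Rightarrow> nat \<Rightarrow> nat"
      by (rule sum.cong) (use b in auto)
    have bc: "b k \<le> cnt k" if "k \<in> LS" for k
      using b(3)[of k] less(2)[OF that] less(2)[OF ll(2)] b(1,2) lt cc by (cases "k = l"; cases "k = l'") auto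
    \<comment> \<open>The swap moves the larger value to the lower level; this weighted sum is the
      measure for termination.\<close>
    have w: "(\<Sum>k\<in>LS. b k * snd k) < (\<Sum>k\<in>LS. a k * snd k)"
      unfolding split rest[of "\<lambda>k x. x * snd k"] b(1,2) using lt by (simp add: l_def l'_def)
    have s: "(\<Sum>k\<in>LS. b k) = (\<Sum>k\<in>LS. a k)"
      unfolding split rest[of "\<lambda>k x. x"] b(1,2) by simp
    have v: "(\<Sum>k\<in>LS. a k * (cnt k - a k)) \<le> (\<Sum>k\<in>LS. b k * (cnt k - b k))"
    proof -
      obtain y where y: "a l' = a l + y" using lt le_Suc_ex[of "a l" "a l'"] by auto
      obtain z where z: "cnt l' = a l' + z" using less(2)[OF ll(2)] le_Suc_ex[of "a l'" "cnt l'"] by auto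
      obtain t where t: "cnt l = cnt l' + t" using cc le_Suc_ex[of "cnt l'" "cnt l"] by auto
      \<comment> \<open>The gain of the swap is exactly \<open>y * t\<close>.\<close>
      have "a l * (cnt l - a l) + a l' * (cnt l' - a l') \<le> a l' * (cnt l - a l') + a l * (cnt l' - a l)"
        unfolding t z y by (simp add: algebra_simps)
      then show ?thesis unfolding split[of "\<lambda>k. a k * (cnt k - a k)"] split[of "\<lambda>k. b k * (cnt k - b k)"]
          rest[of "\<lambda>k x. x * (cnt k - x)"] b(1,2) by simp
    qed
    from less(1)[OF w bc] obtain b' where b': "\<forall>l\<in>LS. b' l \<le> cnt l" "(\<Sum>l\<in>LS. b' l) = (\<Sum>l\<in>LS. b l)"
      "(\<Sum>l\<in>LS. b l * (cnt l - b l)) \<le> (\<Sum>l\<in>LS. b' l * (cnt l - b' l))"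
      "\<forall>e j. (e, Suc j) \<in> LS \<longrightarrow> b' (e, Suc j) \<le> b' (e, j)" by blast
    show ?thesis
      by (rule exI[of _ b'], intro conjI b'(1,4) order_trans[OF v b'(3)] trans[OF b'(2) s])
  qed
qed

text \<open>The set is built from the top level down. On level \<open>m\<close> one must include the
  predecessors of the positions chosen above; by the hypotheses on \<open>b\<close> they are few
  enough, and there is room to enlarge them to the required number.\<close>

lemma shift_closed_of_counts:
  assumes bc: "\<And>l. l \<in> LS \<Longrightarrow> b l \<le> cnt l" and dec: "\<And>e j. (e, Suc j) \<in> LS \<Longrightarrow> b (e, Suc j) \<le> b (e, j)"
  shows "\<exists>P. shift_closed n ev lev P \<and> (\<forall>l\<in>LS. pcnt P l = b l)"
proof -
  define N where "N = Suc (Max (insert 0 (lev ` {..<n})))"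
  have N: "lev k < N" if "k < n" for k
    unfolding N_def less_Suc_eq_le by (rule Max_ge) (use that in auto)
  define Q where "Q m P \<longleftrightarrow> P \<subseteq> {k. k < n \<and> m \<le> lev k} \<and> (\<forall>k\<in>P. m < lev k \<longrightarrow> k - 1 \<in> P) \<and>
    (\<forall>l\<in>LS. m \<le> snd l \<longrightarrow> pcnt P l = b l)" for m P
  have "\<exists>P. Q 0 P"
  proof (rule inc_induct[of 0 N "\<lambda>m. \<exists>P. Q m P"])
    have "\<not> N \<le> snd l" if "l \<in> LS" for l using that N by (auto simp: LS_def L_def not_le)
    then show "\<exists>P. Q N P" by (intro exI[of _ "{}"]) (auto simp: Q_def)
  next
    fix m assume "\<exists>P. Q (Suc m) P"
    then obtain P where P: "P \<subseteq> {k. k < n \<and> Suc m \<le> lev k}" "\<And>k. k \<in> P \<Longrightarrow> Suc m < lev k \<Longrightarrow> k - 1 \<in> P"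
      "\<And>l. l \<in> LS \<Longrightarrow> Suc m \<le> snd l \<Longrightarrow> pcnt P l = b l" unfolding Q_def by blast
    define D where "D e = (\<lambda>k. k - 1) ` {k \<in> P. L k = (e, Suc m)}" for e
    have "\<exists>B. D e \<subseteq> B \<and> B \<subseteq> {k. k < n \<and> L k = (e, m)} \<and> card B = b (e, m)" if e: "(e, m) \<in> LS" for e
    proof (rule exists_subset_between)
      have sub: "{k \<in> P. L k = (e, Suc m)} \<subseteq> {..<n}" using P(1) by auto
      have "card (D e) \<le> pcnt P (e, Suc m)"
        unfolding D_def pcnt_def by (rule card_image_le) (rule finite_subset[OF sub], simp)
      also have "\<dots> \<le> b (e, m)"
      proof (cases "(e, Suc m) \<in> LS")
        case True
        then show ?thesis using P(3)[OF True] dec[OF True] by simp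
      next
        case False
        have "L k \<noteq> (e, Suc m)" if "k \<in> P" for k
        proof
          assume "L k = (e, Suc m)"
          moreover have "k < n" using P(1) that by auto
          ultimately show False using False L_in_LS[of k] by simp
        qed
        then have "{k \<in> P. L k = (e, Suc m)} = {}" by blast
        then have "pcnt P (e, Suc m) = 0" unfolding pcnt_def by (simp only: card.empty)
        then show ?thesis by simp
      qed
      finally show "card (D e) \<le> b (e, m)" .
      show "b (e, m) \<le> card {k. k < n \<and> L k = (e, m)}" using bc[OF e] by (simp add: cnt_def)
      show "D e \<subseteq> {k. k < n \<and> L k = (e, m)}"
      proof
        fix k' assume "k' \<in> D e"
        then obtain k where k: "k' = k - 1" "k \<in> P" "L k = (e, Suc m)" unfolding D_def by blast
        then have "k < n" using P(1) by auto
        with L_Suc(2)[OF this k(3)] k(1) show "k' \<in> {k. k < n \<and> L k = (e, m)}" by auto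
      qed
    qed simp
    then have "\<forall>e\<in>{e. (e, m) \<in> LS}. \<exists>B. D e \<subseteq> B \<and> B \<subseteq> {k. k < n \<and> L k = (e, m)} \<and> card B = b (e, m)" by blast
    from bchoice[OF this] obtain B where B: "\<And>e. (e, m) \<in> LS \<Longrightarrow> D e \<subseteq> B e"
      "\<And>e. (e, m) \<in> LS \<Longrightarrow> B e \<subseteq> {k. k < n \<and> L k = (e, m)}" "\<And>e. (e, m) \<in> LS \<Longrightarrow> card (B e) = b (e, m)" by blast
    define P' where "P' = P \<union> (\<Union>e\<in>{e. (e, m) \<in> LS}. B e)"
    have "Q m P'" unfolding Q_def
    proof (intro conjI ballI impI)
      show "P' \<subseteq> {k. k < n \<and> m \<le> lev k}"
      proof
        fix k assume "k \<in> P'"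
        then consider "k \<in> P" | e where "(e, m) \<in> LS" "k \<in> B e" unfolding P'_def by blast
        then show "k \<in> {k. k < n \<and> m \<le> lev k}"
        proof cases
          case 1
          then have "k < n \<and> Suc m \<le> lev k" using P(1) by blast
          then show ?thesis by simp
        next
          case 2
          then have "k < n \<and> L k = (e, m)" using B(2) by blast
          then show ?thesis by (simp add: L_def)
        qed
      qed
      fix k assume k: "k \<in> P'" "m < lev k"
      have kP: "k \<in> P"
      proof (rule ccontr)
        assume "k \<notin> P"
        then obtain e where "(e, m) \<in> LS" "k \<in> B e" using k(1) unfolding P'_def by blast
        then have "L k = (e, m)" using B(2) by blast
        with k(2) show False by (simp add: L_def)
      qed
      show "k - 1 \<in> P'"
      proof (cases "Suc m < lev k")
        case True
        then show ?thesis using P(2)[OF kP] by (simp add: P'_def)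
      next
        case False
        then have Lk: "L k = (ev k, Suc m)" using k by (simp add: L_def)
        have kn: "k < n" using kP P(1) by auto
        have "(ev k, Suc m) \<in> LS" using L_in_LS[OF kn] Lk by simp
        then have e: "(ev k, m) \<in> LS" by (rule LS_pred)
        have "k - 1 \<in> D (ev k)" unfolding D_def using kP Lk by blast
        with B(1)[OF e] e show ?thesis unfolding P'_def by blast
      qed
    next
      fix l assume l: "l \<in> LS" "m \<le> snd l"
      show "pcnt P' l = b l"
      proof (cases "snd l = m")
        case False
        have "L k \<noteq> l" if "(e, m) \<in> LS" "k \<in> B e" for k e
        proof -
          have "L k = (e, m)" using B(2)[OF that(1)] that(2) by blast
          with False show ?thesis by auto
        qed
        then have "{k \<in> P'. L k = l} = {k \<in> P. L k = l}" unfolding P'_def by blast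
        then show ?thesis using P(3)[OF l(1)] l(2) False by (simp add: pcnt_def)
      next
        case True
        then obtain e where e: "l = (e, m)" by (cases l) auto
        have "{k \<in> P'. L k = l} = B e"
        proof (intro equalityI subsetI)
          fix k assume k: "k \<in> {k \<in> P'. L k = l}"
          have "k \<notin> P"
          proof
            assume "k \<in> P"
            then have "Suc m \<le> lev k" using P(1) by blast
            with k e show False by (simp add: L_def)
          qed
          then obtain e' where e': "(e', m) \<in> LS" "k \<in> B e'" using k unfolding P'_def by blast
          then have "L k = (e', m)" using B(2) by blast
          with k e e' show "k \<in> B e" by simp
        next
          fix k assume "k \<in> B e"
          then show "k \<in> {k \<in> P'. L k = l}" using B(2) l(1) e unfolding P'_def by blast
        qed
        then show ?thesis using B(3) l(1) e by (simp add: pcnt_def)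
      qed
    qed
    then show "\<exists>P. Q m P" by blast
  qed simp
  then obtain P where P: "Q 0 P" by blast
  have "shift_closed n ev lev P"
    by unfold_locales (use P in \<open>auto simp: Q_def\<close>)
  with P show ?thesis unfolding Q_def by auto
qed

text \<open>A feasible choice need not come from a pivot set. After the exchange it does, and its
  value may have grown, hence the inequality.\<close>

lemma feasible_params:
  assumes "feasible levels d v"
  shows "\<exists>P. shift_closed n ev lev P \<and> card P = d \<and> v \<le> card (shift_closed.params n ev lev P)"
proof -
  from assms obtain K where K: "image_mset fst K = levels" "\<forall>(c, a)\<in>#K. a \<le> c"
    "sum_mset (image_mset snd K) = d" "sum_mset (image_mset (\<lambda>(c, a). a * (c - a)) K) = v"
    unfolding feasible_def by blast
  from image_mset_fst_lift[OF finite_LS K(1)[unfolded levels_def]] obtain a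
    where a: "K = image_mset (\<lambda>l. (cnt l, a l)) (mset_set LS)" by blast
  have ac: "a l \<le> cnt l" if "l \<in> LS" for l using K(2) that unfolding a by auto
  have d: "(\<Sum>l\<in>LS. a l) = d" using K(3) unfolding a by (simp add: multiset.map_comp o_def sum_unfold_sum_mset)
  have v: "(\<Sum>l\<in>LS. a l * (cnt l - a l)) = v"
    using K(4) unfolding a by (simp add: multiset.map_comp o_def sum_unfold_sum_mset)
  from decreasing_optimum[of a, OF ac] obtain b where b: "\<And>l. l \<in> LS \<Longrightarrow> b l \<le> cnt l" "(\<Sum>l\<in>LS. b l) = d"
    "v \<le> (\<Sum>l\<in>LS. b l * (cnt l - b l))" "\<And>e j. (e, Suc j) \<in> LS \<Longrightarrow> b (e, Suc j) \<le> b (e, j)"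
    unfolding d v by blast
  from shift_closed_of_counts[of b, OF b(1,4)] obtain P
    where P: "shift_closed n ev lev P" "\<And>l. l \<in> LS \<Longrightarrow> pcnt P l = b l" by blast
  from P(1) have PN: "P \<subseteq> {..<n}" by (simp add: shift_closed_def shift_closed_axioms_def)
  have "card P = d" using sum_pcnt[OF PN] b(2) P(2) by simp
  moreover have "v \<le> card (shift_closed.params n ev lev P)"
    unfolding card_params[OF P(1)] using b(3) P(2) by simp
  ultimately show ?thesis using P(1) by blast
qed

end

lemma (in jordan_similar) inv_grass_dim_eq:
  "inv_grass_dim A d = Sup {enat v |v. feasible levels d v}"
proof (rule antisym)
  let ?S = "{P. shift_closed n ev lev P \<and> card P = d}"
  \<comment> \<open>The inserted 0 keeps the maximum defined if no pivot set has \<open>d\<close>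
    elements; it agrees with the supremum of the empty set in \<open>enat\<close>.\<close>
  define E where "E = Max (insert 0 ((\<lambda>P. card (shift_closed.params n ev lev P)) ` ?S))"
  have fin: "finite ?S"
  proof (rule finite_subset)
    show "?S \<subseteq> Pow {..<n}" by (auto dest: shift_closed.P_less)
  qed simp
  have "inv_grass_dim A d \<le> enat E"
    by (rule inv_grass_dim_upper) (use fin in \<open>auto simp: E_def\<close>)
  also have "\<dots> \<le> Sup {enat v |v. feasible levels d v}"
  proof -
    have "E \<in> insert 0 ((\<lambda>P. card (shift_closed.params n ev lev P)) ` ?S)"
      unfolding E_def by (rule Max_in) (use fin in auto)
    then consider "E = 0" | P where "P \<in> ?S" "E = card (shift_closed.params n ev lev P)" by blast
    then show ?thesis
    proof cases
      case 1
      then show ?thesis by (simp add: zero_enat_def[symmetric])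
    next
      case 2
      then have "feasible levels d E" using params_feasible by auto
      then show ?thesis by (intro Sup_upper) blast
    qed
  qed
  finally show "inv_grass_dim A d \<le> Sup {enat v |v. feasible levels d v}" .
  show "Sup {enat v |v. feasible levels d v} \<le> inv_grass_dim A d"
  proof (rule Sup_least)
    fix x assume "x \<in> {enat v |v. feasible levels d v}"
    then obtain v where v: "x = enat v" "feasible levels d v" by blast
    from feasible_params[OF v(2)] obtain P where P: "shift_closed n ev lev P" "card P = d"
      "v \<le> card (shift_closed.params n ev lev P)" by blast
    have "x \<le> enat (card (shift_closed.params n ev lev P))" using v(1) P(3) by simp
    also have "\<dots> \<le> inv_grass_dim A d" using inv_grass_dim_lower[OF P(1)] P(2) by simp
    finally show "x \<le> inv_grass_dim A d" .
  qed
qed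

section \<open>Centralizers\<close>

definition mat_form :: "nat \<Rightarrow> nat \<Rightarrow> (nat \<Rightarrow> nat \<Rightarrow> 'k::comm_ring_1) \<Rightarrow> 'k mat \<Rightarrow> 'k" where
  "mat_form r c w N = (\<Sum>i<r. \<Sum>j<c. w i j * N $$ (i, j))"

lemma mat_form_lincomb:
  assumes "finite T"
  shows "mat_form r c w (mat r c (\<lambda>ij. \<Sum>B\<in>T. co B * B $$ ij)) = (\<Sum>B\<in>T. co B * mat_form r c w B)"
proof -
  have "mat_form r c w (mat r c (\<lambda>ij. \<Sum>B\<in>T. co B * B $$ ij))
    = (\<Sum>i<r. \<Sum>j<c. \<Sum>B\<in>T. co B * (w i j * B $$ (i, j)))"
    unfolding mat_form_def by (intro sum.cong refl) (simp add: sum_distrib_left mult.left_commute)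
  also have "\<dots> = (\<Sum>i<r. \<Sum>B\<in>T. \<Sum>j<c. co B * (w i j * B $$ (i, j)))"
    by (intro sum.cong refl sum.swap)
  also have "\<dots> = (\<Sum>B\<in>T. \<Sum>i<r. \<Sum>j<c. co B * (w i j * B $$ (i, j)))" by (rule sum.swap)
  also have "\<dots> = (\<Sum>B\<in>T. co B * mat_form r c w B)"
    unfolding mat_form_def by (intro sum.cong refl) (simp add: sum_distrib_left)
  finally show ?thesis .
qed

text \<open>The functionals \<open>w\<close> embed \<open>V\<close> in a space of dimension
  \<open>card I\<close>, which bounds independent sets; the dual elements \<open>b\<close> are
  independent and attain the bound.\<close>

lemma mat_space_dim_dual_basis:
  fixes V :: "'k::field mat set" and w :: "'i \<Rightarrow> nat \<Rightarrow> nat \<Rightarrow> 'k"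
  assumes I: "finite I" and V: "V \<subseteq> carrier_mat r c"
    and comb: "\<And>T co. finite T \<Longrightarrow> T \<subseteq> V \<Longrightarrow> mat r c (\<lambda>ij. \<Sum>B\<in>T. co B * B $$ ij) \<in> V"
    and inj: "\<And>N i j. N \<in> V \<Longrightarrow> (\<And>k. k \<in> I \<Longrightarrow> mat_form r c (w k) N = 0) \<Longrightarrow> i < r \<Longrightarrow> j < c \<Longrightarrow> N $$ (i, j) = 0"
    and b: "\<And>k. k \<in> I \<Longrightarrow> b k \<in> V"
    and dual: "\<And>k k'. k \<in> I \<Longrightarrow> k' \<in> I \<Longrightarrow> mat_form r c (w k) (b k') = (if k = k' then 1 else 0)"
  shows "mat_space_dim r c V = card I"
  unfolding mat_space_dim_def
proof (rule cSup_eq_maximum)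
  have injb: "inj_on b I"
  proof (rule inj_onI)
    fix k k' assume kk: "k \<in> I" "k' \<in> I" "b k = b k'"
    show "k = k'"
    proof (rule ccontr)
      assume "k \<noteq> k'"
      with dual[OF kk(1,2)] dual[OF kk(1,1)] kk(3) show False by simp
    qed
  qed
  have "lin_indep_mats r c (b ` I)"
    unfolding lin_indep_mats_def
  proof (intro conjI allI impI ballI)
    show "finite (b ` I)" "b ` I \<subseteq> carrier_mat r c" using I V b by auto
    fix co B assume rel: "\<forall>i<r. \<forall>j<c. (\<Sum>B\<in>b ` I. co B * B $$ (i, j)) = 0" and "B \<in> b ` I"
    then obtain k where k: "k \<in> I" "B = b k" by blast
    have "(\<Sum>B\<in>b ` I. co B * mat_form r c (w k) B) = mat_form r c (w k) (mat r c (\<lambda>ij. \<Sum>B\<in>b ` I. co B * B $$ ij))"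
      by (rule mat_form_lincomb[symmetric]) (use I in simp)
    also have "\<dots> = 0" unfolding mat_form_def using rel by (intro sum.neutral ballI) auto
    finally have "0 = (\<Sum>k'\<in>I. co (b k') * mat_form r c (w k) (b k'))"
      by (simp add: sum.reindex[OF injb])
    also have "\<dots> = (\<Sum>k'\<in>I. if k = k' then co (b k') else 0)"
      by (rule sum.cong) (use dual k in auto)
    also have "\<dots> = co B" using I k by simp
    finally show "co B = 0" by simp
  qed
  then show "card I \<in> {card T |T. T \<subseteq> V \<and> lin_indep_mats r c T}"
    using b card_image[OF injb] by (intro CollectI exI[of _ "b ` I"]) auto
next
  fix m assume "m \<in> {card T |T. T \<subseteq> V \<and> lin_indep_mats r c T}"
  then obtain T where T: "m = card T" "T \<subseteq> V" "lin_indep_mats r c T" by blast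
  then have fin: "finite T" by (simp add: lin_indep_mats_def)
  show "m \<le> card I"
  proof (rule ccontr)
    define \<delta> :: "'i \<Rightarrow> 'i \<Rightarrow> 'k" where "\<delta> k = (\<lambda>x. if x = k then 1 else 0)" for k
    assume "\<not> m \<le> card I"
    then have lt: "card (\<delta> ` I) < card T" using T(1) card_image_le[OF I, of \<delta>] by simp
    define g where "g B x = (if x \<in> I then mat_form r c (w x) B else 0)" for B x
    have sp: "g B \<in> fs.span (\<delta> ` I)" for B
    proof -
      have "g B = (\<Sum>k\<in>I. (\<lambda>x. mat_form r c (w k) B * \<delta> k x))"
      proof
        fix x
        have "(\<Sum>k\<in>I. mat_form r c (w k) B * \<delta> k x) = (\<Sum>k\<in>I. if x = k then mat_form r c (w k) B else 0)"
          by (rule sum.cong) (auto simp: \<delta>_def)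
        then show "g B x = (\<Sum>k\<in>I. (\<lambda>x. mat_form r c (w k) B * \<delta> k x)) x"
          using I by (simp add: sum_fun_apply g_def)
      qed
      also have "\<dots> \<in> fs.span (\<delta> ` I)" by (intro fs.span_sum fs.span_scale fs.span_base) auto
      finally show ?thesis .
    qed
    have "\<exists>co. (\<exists>B\<in>T. co B \<noteq> 0) \<and> (\<forall>x. (\<Sum>B\<in>T. co B * g B x) = 0)"
      by (rule linear_relation_exists[OF fin sp _ lt]) (use I in simp)
    then obtain co where co: "\<exists>B\<in>T. co B \<noteq> 0" and rel: "\<And>x. (\<Sum>B\<in>T. co B * g B x) = 0" by blast
    let ?N = "mat r c (\<lambda>ij. \<Sum>B\<in>T. co B * B $$ ij)"
    have "?N $$ (i, j) = 0" if ij: "i < r" "j < c" for i j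
    proof (rule inj[OF comb[OF fin T(2)] _ ij])
      fix k assume "k \<in> I"
      then show "mat_form r c (w k) ?N = 0"
        unfolding mat_form_lincomb[OF fin] using rel[of k] by (simp add: g_def)
    qed
    then have "\<forall>i<r. \<forall>j<c. (\<Sum>B\<in>T. co B * B $$ (i, j)) = 0" by auto
    with T(3) co show False unfolding lin_indep_mats_def by blast
  qed
qed

section \<open>Matrices commuting with a Jordan matrix\<close>

context jordan_shape
begin

lemma whole: "shift_closed n ev lev {..<n}"
  by unfold_locales auto

definition commuting :: "'k mat \<Rightarrow> bool" where
  "commuting B \<longleftrightarrow> (\<forall>i<n. \<forall>k<n. ev k * B $$ (i, k) + (if lev k > 0 then B $$ (i, k - 1) else 0)
     = ev i * B $$ (i, k) + (if Suc i < n \<and> lev (Suc i) > 0 then B $$ (Suc i, k) else 0))"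

lemma commuting_iff:
  assumes B: "B \<in> carrier_mat n n"
  shows "jmat * B = B * jmat \<longleftrightarrow> commuting B"
proof -
  have l: "(jmat * B) $$ (i, k) = ev i * B $$ (i, k) + (if Suc i < n \<and> lev (Suc i) > 0 then B $$ (Suc i, k) else 0)"
    if "i < n" "k < n" for i k
    using index_mult_mat_sum[OF jmat_carrier B that] jmat_sum[OF that(1), of "\<lambda>j. B $$ (j, k)"] that
    by (simp add: jop_def)
  have r: "(B * jmat) $$ (i, k) = ev k * B $$ (i, k) + (if lev k > 0 then B $$ (i, k - 1) else 0)"
    if "i < n" "k < n" for i k
  proof -
    have "(B * jmat) $$ (i, k) = (\<Sum>j<n. B $$ (i, j) * jmat $$ (j, k))"
      by (rule index_mult_mat_sum[OF B jmat_carrier that])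
    also have "\<dots> = (\<Sum>j<n. (if j = k then ev k * B $$ (i, k) else 0)
        + (if j = k - 1 then (if lev k > 0 then B $$ (i, k - 1) else 0) else 0))"
    proof (rule sum.cong[OF refl])
      fix j assume "j \<in> {..<n}"
      then show "B $$ (i, j) * jmat $$ (j, k) = (if j = k then ev k * B $$ (i, k) else 0)
        + (if j = k - 1 then (if lev k > 0 then B $$ (i, k - 1) else 0) else 0)"
        using that pred[OF that(2)] by (auto simp: jmat_def)
    qed
    also have "\<dots> = ev k * B $$ (i, k) + (if lev k > 0 then B $$ (i, k - 1) else 0)"
      using that by (auto simp: sum.distrib)
    finally show ?thesis .
  qed
  show ?thesis
  proof
    assume eq: "jmat * B = B * jmat"
    show "commuting B" unfolding commuting_def
    proof (intro allI impI)
      fix i k assume ik: "i < n" "k < n"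
      show "ev k * B $$ (i, k) + (if lev k > 0 then B $$ (i, k - 1) else 0)
        = ev i * B $$ (i, k) + (if Suc i < n \<and> lev (Suc i) > 0 then B $$ (Suc i, k) else 0)"
        unfolding l[OF ik, symmetric] r[OF ik, symmetric] eq ..
    qed
  next
    assume c: "commuting B"
    have e: "(jmat * B) $$ (i, k) = (B * jmat) $$ (i, k)" if "i < n" "k < n" for i k
      unfolding l[OF that] r[OF that] using c that unfolding commuting_def by simp
    show "jmat * B = B * jmat"
    proof (rule eq_matI)
      fix i k assume "i < dim_row (B * jmat)" "k < dim_col (B * jmat)"
      then have "i < n" "k < n" using B carrier_matD(2)[OF jmat_carrier] by auto
      then show "(jmat * B) $$ (i, k) = (B * jmat) $$ (i, k)" by (rule e)
    qed (use B carrier_matD[OF jmat_carrier] in auto)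
  qed
qed

definition cidx :: "(nat \<times> nat) set" where "cidx = {(p, r). p < n \<and> r < n \<and> L p = L r}"

lemma finite_cidx [simp]: "finite cidx"
  by (rule finite_subset[of _ "{..<n} \<times> {..<n}"]) (auto simp: cidx_def)

lemma card_cidx: "card cidx = (\<Sum>l\<in>LS. (cnt l)\<^sup>2)"
proof -
  have eq: "cidx = (\<Union>l\<in>LS. {k. k < n \<and> L k = l} \<times> {k. k < n \<and> L k = l})"
    unfolding cidx_def using L_in_LS by auto
  have "card cidx = (\<Sum>l\<in>LS. card ({k. k < n \<and> L k = l} \<times> {k. k < n \<and> L k = l}))"
    unfolding eq by (rule card_UN_disjoint) auto
  also have "\<dots> = (\<Sum>l\<in>LS. (cnt l)\<^sup>2)"
    by (simp add: card_cartesian_product cnt_def power2_eq_square)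
  finally show ?thesis .
qed

text \<open>The top of the block of \<open>p\<close>: the tip when all positions count as
  pivots.\<close>

definition btop :: "nat \<Rightarrow> nat" where "btop = shift_closed.tip lev {..<n}"

lemma btop:
  assumes "p < n"
  shows "btop p < n" "p \<le> btop p" "ev (btop p) = ev p" "lev (btop p) = lev p + (btop p - p)"
    "\<And>s. s \<le> lev p \<Longrightarrow> btop (p - s) = btop p" "btop (btop p) = btop p"
    "btop p = p \<Longrightarrow> \<not> (Suc p < n \<and> lev (Suc p) > 0)"
    "btop p \<noteq> p \<Longrightarrow> Suc p < n \<and> lev (Suc p) > 0"
proof -
  interpret shift_closed n ev lev "{..<n}" by (rule whole)
  from assms have p: "p \<in> {..<n}" by simp
  note h = height[OF p]
  show 1: "btop p < n" using h(1) by (simp add: btop_def)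
  show 2: "p \<le> btop p" "ev (btop p) = ev p" "lev (btop p) = lev p + (btop p - p)"
    using tip_lev[OF p] by (simp_all add: btop_def tip_def)
  show "btop (p - s) = btop p" if "s \<le> lev p" for s
    unfolding btop_def by (rule tip_down[OF p that])
  show "btop (btop p) = btop p"
    using tip_down[OF h(1), of "height p"] h(2) by (simp add: btop_def tip_def)
  show "\<not> (Suc p < n \<and> lev (Suc p) > 0)" if "btop p = p"
  proof
    assume "Suc p < n \<and> lev (Suc p) > 0"
    with h(3)[of 1] have "1 \<le> height p" by simp
    with that show False by (simp add: btop_def tip_def)
  qed
  show "Suc p < n \<and> lev (Suc p) > 0" if "btop p \<noteq> p"
  proof -
    have t: "p + height p < n" "height p \<le> lev (p + height p)" "1 \<le> height p"
      using h(1,2) that by (auto simp: tip_def btop_def)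
    from up_trans[OF t] show ?thesis by simp
  qed
qed

lemma btop_inj:
  assumes "p < n" "p' < n" "btop p = btop p'" "lev p = lev p'"
  shows "p = p'"
  using btop(2,4)[OF assms(1)] btop(2,4)[OF assms(2)] assms(3,4) by simp

text \<open>A commuting matrix is determined by the images of the block tops. Only rows
  \<open>r\<close> with the same eigenvalue and no higher level matter; such a row and a block are
  encoded by the pair \<open>(p, r)\<close>, where \<open>p\<close> is the position of that block on
  the level of \<open>r\<close>.\<close>

lemma commuting_zero:
  assumes B: "commuting B" and z: "\<And>p r. (p, r) \<in> cidx \<Longrightarrow> B $$ (r, btop p) = 0"
    and ik: "i < n" "k < n"
  shows "B $$ (i, k) = 0"
proof -
  have rel: "ev k * B $$ (i, k) + (if lev k > 0 then B $$ (i, k - 1) else 0)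
     = ev i * B $$ (i, k) + (if Suc i < n \<and> lev (Suc i) > 0 then B $$ (Suc i, k) else 0)"
    if "i < n" "k < n" for i k using B that unfolding commuting_def by blast
  \<comment> \<open>Between different eigenvalues, the relation expresses an entry by those to its
    left and below, inside their blocks.\<close>
  have C1: "B $$ (i, k) = 0" if "i < n" "k < n" "ev i \<noteq> ev k" for i k
    using that
  proof (induct "lev k + (n - i)" arbitrary: i k rule: less_induct)
    case less
    have a: "(if lev k > 0 then B $$ (i, k - 1) else 0) = 0"
    proof (cases "lev k > 0")
      case True
      from pred[OF less(3) True] less(1)[of "k - 1" i] less(2-4) show ?thesis by auto
    qed simp
    have b: "(if Suc i < n \<and> lev (Suc i) > 0 then B $$ (Suc i, k) else 0) = 0"
    proof (cases "Suc i < n \<and> lev (Suc i) > 0")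
      case True
      from pred[of "Suc i"] True less(1)[of k "Suc i"] less(2-4) show ?thesis by auto
    qed auto
    from rel[OF less(2,3)] have "(ev k - ev i) * B $$ (i, k) = 0" unfolding a b by (simp add: algebra_simps)
    with less(4) show ?case by simp
  qed
  \<comment> \<open>Along a diagonal towards the block bottoms, the column reaches level 0 before
    the row does.\<close>
  have C2: "B $$ (i, k) = 0" if "i < n" "k < n" "ev i = ev k" "lev i > lev k" for i k
    using that
  proof (induct "lev k" arbitrary: i k rule: less_induct)
    case less
    have li: "lev i > 0" using less(5) by simp
    note pi = pred[OF less(2) li]
    have "(if lev k > 0 then B $$ (i - 1, k - 1) else 0) = B $$ (i, k)"
      using rel[of "i - 1" k] less(2-5) pi li by auto
    moreover have "(if lev k > 0 then B $$ (i - 1, k - 1) else 0) = 0"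
    proof (cases "lev k > 0")
      case True
      from pred[OF less(3) True] less(1)[of "k - 1" "i - 1"] less(2-5) pi show ?thesis by auto
    qed simp
    ultimately show ?case by simp
  qed
  \<comment> \<open>Along a diagonal towards the block tops, the column reaches the top of its
    block, where \<open>z\<close> applies, or the row leaves its block first.\<close>
  have C3: "B $$ (i, k) = 0" if "i < n" "k < n" "ev i = ev k" "lev i \<le> lev k" for i k
    using that
  proof (induct "n - k" arbitrary: i k rule: less_induct)
    case less
    show ?case
    proof (cases "btop k = k")
      case True
      let ?p = "k - (lev k - lev i)"
      have "(?p, i) \<in> cidx"
        using down[OF less(3), of "lev k - lev i"] less(2-5) by (auto simp: cidx_def L_def)
      moreover have "btop ?p = k" using btop(5)[OF less(3), of "lev k - lev i"] True by simp
      ultimately show ?thesis using z by metis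
    next
      case False
      from btop(8)[OF less(3) False] have k: "Suc k < n" "lev (Suc k) > 0" by auto
      note pk = pred[OF k]
      have "B $$ (i, k) = (if Suc i < n \<and> lev (Suc i) > 0 then B $$ (Suc i, Suc k) else 0)"
        using rel[OF less(2) k(1)] pk k(2) less(4) by auto
      moreover have "(if Suc i < n \<and> lev (Suc i) > 0 then B $$ (Suc i, Suc k) else 0) = 0"
      proof (cases "Suc i < n \<and> lev (Suc i) > 0")
        case True
        from pred[of "Suc i"] True pk less(1)[of "Suc k" "Suc i"] less(2-5) k show ?thesis by auto
      qed auto
      ultimately show ?thesis by simp
    qed
  qed
  from C1[OF ik] C2[OF ik] C3[OF ik] show ?thesis by (cases "ev i = ev k"; cases "lev i \<le> lev k") auto
qed

text \<open>The commuting matrix that sends the top vector of the block of \<open>p\<close> to the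
  vector at \<open>r\<close> and kills the other blocks; commutation forces its values further down
  the block.\<close>

definition cbas :: "nat \<times> nat \<Rightarrow> 'k mat" where
  "cbas pr = mat n n (\<lambda>(i, k). if \<exists>s\<le>lev (snd pr). i = snd pr - s \<and> k = btop (fst pr) - s then 1 else 0)"

lemma cbas_commuting:
  assumes pr: "(p, r) \<in> cidx"
  shows "commuting (cbas (p, r))"
  unfolding commuting_def
proof (intro allI impI)
  fix i k assume ik: "i < n" "k < n"
  from pr have p: "p < n" "r < n" "ev p = ev r" "lev p = lev r" by (auto simp: cidx_def L_def)
  let ?q = "btop p"
  note q = btop[OF p(1)]
  have lq: "lev r \<le> lev ?q" using q(4) p(4) by simp
  let ?B = "cbas (p, r)"
  let ?R = "\<lambda>i k. \<exists>s\<le>lev r. i = r - s \<and> k = ?q - s"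
  have ent: "?B $$ (i, k) = (if ?R i k then 1 else 0)" if "i < n" "k < n" for i k
    using that by (simp add: cbas_def)
  have dr: "s \<le> r \<and> ev (r - s) = ev r \<and> lev (r - s) = lev r - s" if "s \<le> lev r" for s
    by (rule down[OF p(2) that])
  have dq: "s \<le> ?q \<and> ev (?q - s) = ev p \<and> lev (?q - s) = lev ?q - s" if "s \<le> lev r" for s
    using down[OF q(1), of s] that lq q(3) by simp
  have evs: "ev k * ?B $$ (i, k) = ev i * ?B $$ (i, k)"
    using ent[OF ik] dr dq p(3) by auto
  have "(lev k > 0 \<and> ?R i (k - 1)) \<longleftrightarrow> (Suc i < n \<and> lev (Suc i) > 0 \<and> ?R (Suc i) k)"
  proof
    assume l: "lev k > 0 \<and> ?R i (k - 1)"
    then obtain s where s: "s \<le> lev r" "i = r - s" "k - 1 = ?q - s" by blast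
    have k0: "k > 0" using pred[OF ik(2)] l by simp
    have "s \<noteq> 0"
    proof
      assume "s = 0"
      with s k0 have "k = Suc ?q" by simp
      with btop(7)[OF q(1,6)] l ik(2) show False by simp
    qed
    then obtain s' where s': "s = Suc s'" by (cases s) auto
    have "Suc i = r - s'" "k = ?q - s'" using s s' k0 dr[OF s(1)] dq[OF s(1)] by auto
    moreover have "lev (r - s') > 0" using dr[of s'] s(1) s' by simp
    moreover have "r - s' < n" using p(2) by simp
    moreover have "s' \<le> lev r" using s(1) s' by simp
    ultimately show "Suc i < n \<and> lev (Suc i) > 0 \<and> ?R (Suc i) k" by auto
  next
    assume r: "Suc i < n \<and> lev (Suc i) > 0 \<and> ?R (Suc i) k"
    then obtain s where s: "s \<le> lev r" "Suc i = r - s" "k = ?q - s" by blast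
    from dr[OF s(1)] r s(2) have lt: "s < lev r" by simp
    have "lev k > 0" using dq[OF s(1)] s(3) lt lq by simp
    moreover have "i = r - Suc s" "k - 1 = ?q - Suc s" using s by auto
    ultimately show "lev k > 0 \<and> ?R i (k - 1)" using lt by (auto intro!: exI[of _ "Suc s"])
  qed
  then have "(if lev k > 0 then ?B $$ (i, k - 1) else 0)
    = (if Suc i < n \<and> lev (Suc i) > 0 then ?B $$ (Suc i, k) else 0)"
    using ent[of i "k - 1"] ent[of "Suc i" k] ik by (auto simp del: One_nat_def)
  with evs show "ev k * ?B $$ (i, k) + (if lev k > 0 then ?B $$ (i, k - 1) else 0)
     = ev i * ?B $$ (i, k) + (if Suc i < n \<and> lev (Suc i) > 0 then ?B $$ (Suc i, k) else 0)" by simp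
qed

lemma cbas_dual:
  assumes pr: "(p, r) \<in> cidx" and pr': "(p', r') \<in> cidx"
  shows "cbas (p', r') $$ (r, btop p) = (if (p, r) = (p', r') then 1 else 0)"
proof -
  from pr have p: "p < n" "r < n" "ev p = ev r" "lev p = lev r" by (auto simp: cidx_def L_def)
  from pr' have p': "p' < n" "r' < n" "ev p' = ev r'" "lev p' = lev r'" by (auto simp: cidx_def L_def)
  note q = btop[OF p(1)] and q' = btop[OF p'(1)]
  have "(\<exists>s\<le>lev r'. r = r' - s \<and> btop p = btop p' - s) \<longleftrightarrow> (p, r) = (p', r')"
  proof
    assume "\<exists>s\<le>lev r'. r = r' - s \<and> btop p = btop p' - s"
    then obtain s where s: "s \<le> lev r'" "r = r' - s" "btop p = btop p' - s" by blast
    have "btop (btop p' - s) = btop (btop p')"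
      by (rule btop(5)[OF q'(1)]) (use s(1) p'(4) q'(4) in simp)
    then have eq: "btop p = btop p'" using s(3) q(6) q'(6) by simp
    have "s \<le> btop p'" using down[OF q'(1), of s] s(1) p'(4) q'(4) by simp
    then have "s = 0" using eq s(3) by simp
    then have "r = r'" using s(2) by simp
    moreover have "p = p'" by (rule btop_inj[OF p(1) p'(1) eq]) (use p(4) p'(4) \<open>r = r'\<close> in simp)
    ultimately show "(p, r) = (p', r')" by simp
  qed auto
  then show ?thesis using p(2) q(1) by (simp add: cbas_def)
qed

end

lemma (in jordan_similar) dim_centralizer:
  "mat_space_dim n n (centralizer A) = (\<Sum>l\<in>LS. (cnt l)\<^sup>2)"
proof -
  have dimA: "dim_row A = n" using carr by simp
  \<comment> \<open>The functional that reads entry \<open>(r, btop p)\<close> after conjugation by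
    \<open>S\<close>.\<close>
  define w where "w = (\<lambda>(p, r) i j. S' $$ (r, i) * S $$ (j, btop p))"
  have form: "mat_form n n (w (p, r)) N = (S' * N * S) $$ (r, btop p)"
    if N: "N \<in> carrier_mat n n" and pr: "(p, r) \<in> cidx" for N p r
  proof -
    from pr have p: "p < n" "r < n" by (auto simp: cidx_def)
    have "(S' * N * S) $$ (r, btop p) = (\<Sum>j<n. (S' * N) $$ (r, j) * S $$ (j, btop p))"
      by (rule index_mult_mat_sum[OF mult_carrier_mat[OF carr(3) N] carr(2) p(2) btop(1)[OF p(1)]])
    also have "\<dots> = (\<Sum>j<n. \<Sum>i<n. w (p, r) i j * N $$ (i, j))"
    proof (rule sum.cong[OF refl])
      fix j assume "j \<in> {..<n}"
      then show "(S' * N) $$ (r, j) * S $$ (j, btop p) = (\<Sum>i<n. w (p, r) i j * N $$ (i, j))"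
        by (subst index_mult_mat_sum[OF carr(3) N p(2)], simp, unfold sum_distrib_right)
          (auto simp: w_def mult_ac intro!: sum.cong)
    qed
    also have "\<dots> = mat_form n n (w (p, r)) N" unfolding mat_form_def by (rule sum.swap)
    finally show ?thesis by simp
  qed
  have conj: "S' * N * S \<in> carrier_mat n n \<and> jmat * (S' * N * S) = S' * N * S * jmat"
    if N: "N \<in> carrier_mat n n" "A * N = N * A" for N
  proof -
    note mc = mult_carrier_mat[of _ n n _ n] carr jmat_carrier N(1)
    have "jmat * (S' * N * S) = (jmat * S') * N * S"
      by (simp add: mc assoc_mult_mat[of _ n n _ n _ n])
    also have "\<dots> = S' * (A * N) * S"
      unfolding S'A[symmetric] by (simp add: mc assoc_mult_mat[of _ n n _ n _ n])
    also have "\<dots> = S' * N * (A * S)"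
      unfolding N(2) by (simp add: mc assoc_mult_mat[of _ n n _ n _ n])
    also have "\<dots> = S' * N * S * jmat"
      unfolding AS by (simp add: mc assoc_mult_mat[of _ n n _ n _ n])
    finally show ?thesis by (simp add: mc)
  qed
  have conj': "S * B * S' \<in> centralizer A \<and> S' * (S * B * S') * S = B"
    if B: "B \<in> carrier_mat n n" "jmat * B = B * jmat" for B
  proof -
    note mc = mult_carrier_mat[of _ n n _ n] carr jmat_carrier B(1)
    have "A * (S * B * S') = (A * S) * B * S'" by (simp add: mc assoc_mult_mat[of _ n n _ n _ n])
    also have "\<dots> = S * (jmat * B) * S'" unfolding AS by (simp add: mc assoc_mult_mat[of _ n n _ n _ n])
    also have "\<dots> = S * B * (jmat * S')" unfolding B(2) by (simp add: mc assoc_mult_mat[of _ n n _ n _ n])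
    also have "\<dots> = S * B * S' * A" unfolding S'A[symmetric] by (simp add: mc assoc_mult_mat[of _ n n _ n _ n])
    finally have c: "A * (S * B * S') = S * B * S' * A" .
    have "S' * (S * B * S') * S = (S' * S) * B * (S' * S)"
      by (simp add: mc assoc_mult_mat[of _ n n _ n _ n])
    also have "\<dots> = B" unfolding SS' using B(1) by simp
    finally show ?thesis using c dimA by (simp add: centralizer_def mc)
  qed
  have "mat_space_dim n n (centralizer A) = card cidx"
  proof (rule mat_space_dim_dual_basis[where w = w and b = "\<lambda>pr. S * cbas pr * S'"])
    show "finite cidx" by simp
    show sub: "centralizer A \<subseteq> carrier_mat n n" by (auto simp: centralizer_def dimA)
    fix T :: "'k mat set" and co :: "'k mat \<Rightarrow> 'k" assume T: "finite T" "T \<subseteq> centralizer A"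
    let ?N = "mat n n (\<lambda>ij. \<Sum>B\<in>T. co B * B $$ ij)"
    have "A * ?N = ?N * A"
    proof (rule eq_matI)
      fix i j assume "i < dim_row (?N * A)" "j < dim_col (?N * A)"
      then have ij: "i < n" "j < n" using carr by auto
      have "(A * ?N) $$ (i, j) = (\<Sum>k<n. A $$ (i, k) * (\<Sum>B\<in>T. co B * B $$ (k, j)))"
        by (subst index_mult_mat_sum[OF carr(1) _ ij]) (auto simp: ij)
      also have "\<dots> = (\<Sum>B\<in>T. co B * (\<Sum>k<n. A $$ (i, k) * B $$ (k, j)))"
        unfolding sum_distrib_left by (subst sum.swap) (simp add: mult.left_commute)
      also have "\<dots> = (\<Sum>B\<in>T. co B * (\<Sum>k<n. B $$ (i, k) * A $$ (k, j)))"
      proof (rule sum.cong[OF refl])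
        fix B assume "B \<in> T"
        then have B: "B \<in> carrier_mat n n" "A * B = B * A" using T(2) by (auto simp: centralizer_def dimA)
        show "co B * (\<Sum>k<n. A $$ (i, k) * B $$ (k, j)) = co B * (\<Sum>k<n. B $$ (i, k) * A $$ (k, j))"
          using index_mult_mat_sum[OF carr(1) B(1) ij] index_mult_mat_sum[OF B(1) carr(1) ij] B(2) by simp
      qed
      also have "\<dots> = (\<Sum>k<n. (\<Sum>B\<in>T. co B * B $$ (i, k)) * A $$ (k, j))"
        unfolding sum_distrib_left sum_distrib_right by (subst sum.swap) (simp add: mult.assoc)
      also have "\<dots> = (?N * A) $$ (i, j)"
        by (subst index_mult_mat_sum[OF _ carr(1) ij]) (auto simp: ij)
      finally show "(A * ?N) $$ (i, j) = (?N * A) $$ (i, j)" .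
    qed (use carr in auto)
    then show "?N \<in> centralizer A" by (simp add: centralizer_def dimA)
  next
    fix N i j assume N: "N \<in> centralizer A" and z: "\<And>pr. pr \<in> cidx \<Longrightarrow> mat_form n n (w pr) N = 0"
      and ij: "i < n" "j < n"
    from N have Nc: "N \<in> carrier_mat n n" "A * N = N * A" by (auto simp: centralizer_def dimA)
    let ?B = "S' * N * S"
    from conj[OF Nc] have B: "?B \<in> carrier_mat n n" "commuting ?B" using commuting_iff by auto
    have "?B $$ (i, j) = 0" if "i < n" "j < n" for i j
      by (rule commuting_zero[OF B(2) _ that]) (use z form[OF Nc(1)] in auto)
    then have "?B = 0\<^sub>m n n" using B(1) by (intro eq_matI) auto
    moreover have "S * ?B * S' = (S * S') * N * (S * S')"
      using carr Nc(1) by (simp add: mult_carrier_mat[of _ n n _ n] assoc_mult_mat[of _ n n _ n _ n])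
    ultimately have "N = S * 0\<^sub>m n n * S'" unfolding SS' using Nc(1) by simp
    also have "\<dots> = 0\<^sub>m n n" using carr by simp
    finally show "N $$ (i, j) = 0" using ij by simp
  next
    fix pr assume pr: "pr \<in> cidx"
    obtain p r where e: "pr = (p, r)" by force
    have c: "cbas pr \<in> carrier_mat n n" by (simp add: cbas_def)
    have cm: "jmat * cbas pr = cbas pr * jmat"
      using commuting_iff[OF c] cbas_commuting pr unfolding e by blast
    show "S * cbas pr * S' \<in> centralizer A" using conj'[OF c cm] by simp
    fix pr' assume pr': "pr' \<in> cidx"
    obtain p' r' where e': "pr' = (p', r')" by force
    have sc: "S * cbas pr * S' \<in> carrier_mat n n" using carr c by (simp add: mult_carrier_mat[of _ n n _ n])
    show "mat_form n n (w pr') (S * cbas pr * S') = (if pr' = pr then 1 else 0)"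
      unfolding e' form[OF sc pr'[unfolded e']] using conj'[OF c cm] cbas_dual[of p' r' p r] pr pr'
      by (simp add: e e')
  qed
  then show ?thesis by (simp add: card_cidx)
qed

section \<open>Jordan types\<close>

text \<open>A common form for Jordan blocks and for their deformations, in which only the diagonal
  changes.\<close>

definition bidiag :: "'k::{zero,one} list \<Rightarrow> 'k mat" where
  "bidiag l = mat (length l) (length l) (\<lambda>(i, j). if i = j then l ! i else if Suc i = j then 1 else 0)"

lemma bidiag_dim [simp]: "dim_row (bidiag l) = length l" "dim_col (bidiag l) = length l"
  by (simp_all add: bidiag_def)

definition pos :: "'k list list \<Rightarrow> ('k \<times> nat) list" where
  "pos ls = concat (map (\<lambda>l. zip l [0..<length l]) ls)"

lemma pos_Nil [simp]: "pos [] = []" by (simp add: pos_def)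
lemma pos_Cons: "pos (l # ls) = zip l [0..<length l] @ pos ls" by (simp add: pos_def)

lemma pos_Cons_nth:
  "pos (l # ls) ! k = (if k < length l then (l ! k, k) else pos ls ! (k - length l))"
  by (simp add: pos_Cons nth_append)

lemma length_pos_Cons [simp]: "length (pos (l # ls)) = length l + length (pos ls)"
  by (simp add: pos_Cons)

lemma pos_pred:
  assumes "k < length (pos ls)" "snd (pos ls ! k) > 0"
  shows "k > 0 \<and> snd (pos ls ! k) = Suc (snd (pos ls ! (k - 1)))"
  using assms
proof (induct ls arbitrary: k)
  case (Cons l ls)
  show ?case
  proof (cases "k < length l")
    case True
    with Cons(3) show ?thesis by (auto simp: pos_Cons_nth)
  next
    case False
    with Cons(1)[of "k - length l"] Cons(2,3)
    have *: "k - length l > 0" "snd (pos ls ! (k - length l)) = Suc (snd (pos ls ! (k - length l - 1)))"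
      by (auto simp: pos_Cons_nth)
    then have "\<not> k - 1 < length l" "k - 1 - length l = k - length l - 1" by auto
    with * False show ?thesis by (simp add: pos_Cons_nth)
  qed
qed simp

text \<open>The superdiagonal 1s stand in the columns whose index inside their block is positive.
  This matches the encoding by \<open>ev\<close> and \<open>lev\<close>.\<close>

lemma diag_block_bidiag:
  fixes ls :: "'k::{zero,one} list list"
  shows "diag_block_mat (map bidiag ls) = mat (length (pos ls)) (length (pos ls))
    (\<lambda>(i, k). if i = k then fst (pos ls ! i) else if Suc i = k \<and> 0 < snd (pos ls ! k) then 1 else 0)"
proof (induct ls)
  case Nil
  show ?case by (intro eq_matI) auto
next
  case (Cons l ls)
  let ?M = "\<lambda>ls :: 'k list list. mat (length (pos ls)) (length (pos ls))
    (\<lambda>(i, k). if i = k then fst (pos ls ! i) else if Suc i = k \<and> 0 < snd (pos ls ! k) then 1 else 0)"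
  show ?case
  proof (rule eq_matI)
    fix i k assume "i < dim_row (?M (l # ls))" "k < dim_col (?M (l # ls))"
    then have ik: "i < length l + length (pos ls)" "k < length l + length (pos ls)" by auto
    \<comment> \<open>A new block starts at index 0, so there is no 1 at the seam.\<close>
    have first: "snd (pos ls ! 0) = 0" if "0 < length (pos ls)"
      using pos_pred[OF that] by auto
    show "diag_block_mat (map bidiag (l # ls)) $$ (i, k) = ?M (l # ls) $$ (i, k)"
    proof (cases "i < length l")
      case i: True
      show ?thesis
      proof (cases "k < length l")
        case True
        with i ik show ?thesis by (auto simp: Let_def Cons bidiag_def pos_Cons_nth)
      next
        case False
        then have "0 < length (pos ls)" using ik by linarith
        with first have "snd (pos ls ! 0) = 0" by simp
        with i ik False show ?thesis by (auto simp: Let_def Cons bidiag_def pos_Cons_nth less_Suc_eq)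
      qed
    next
      case i: False
      show ?thesis
      proof (cases "k < length l")
        case True
        with i ik show ?thesis by (auto simp: Let_def Cons bidiag_def)
      next
        case False
        with i have "i - length l = k - length l \<longleftrightarrow> i = k" "Suc (i - length l) = k - length l \<longleftrightarrow> Suc i = k" by auto
        with i False ik show ?thesis by (auto simp: Let_def Cons bidiag_def pos_Cons_nth)
      qed
    qed
  qed (simp_all add: Let_def Cons)
qed

lemma jordan_block_bidiag: "jordan_block s a = bidiag (replicate s a)"
  by (intro eq_matI) (auto simp: bidiag_def)

section \<open>Level counts of a Jordan normal form\<close>

definition blocks_list :: "(nat \<times> 'k) list \<Rightarrow> 'k list list" where
  "blocks_list n_as = map (\<lambda>(s, a). replicate s a) n_as"

lemma jordan_matrix_bidiag: "jordan_matrix n_as = diag_block_mat (map bidiag (blocks_list n_as))"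
  unfolding jordan_matrix_def blocks_list_def
  by (simp add: jordan_block_bidiag o_def case_prod_unfold)

lemma pos_blocks_pred:
  assumes "k < length (pos (blocks_list n_as))" "snd (pos (blocks_list n_as) ! k) > 0"
  shows "fst (pos (blocks_list n_as) ! (k - 1)) = fst (pos (blocks_list n_as) ! k)"
  using assms
proof (induct n_as arbitrary: k)
  case (Cons sa n_as)
  obtain s a where sa: "sa = (s, a)" by force
  have bl: "blocks_list (sa # n_as) = replicate s a # blocks_list n_as" by (simp add: blocks_list_def sa)
  show ?case
  proof (cases "k < s")
    case True
    with Cons(3) show ?thesis unfolding bl by (auto simp: pos_Cons_nth)
  next
    case False
    with Cons(2,3) have k: "k - s < length (pos (blocks_list n_as))" "snd (pos (blocks_list n_as) ! (k - s)) > 0"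
      unfolding bl by (auto simp: pos_Cons_nth)
    from pos_pred[OF k] have "\<not> k - 1 < s" "k - 1 - s = k - s - 1" by auto
    with Cons(1)[OF k] False show ?thesis unfolding bl by (simp add: pos_Cons_nth)
  qed
qed (simp add: blocks_list_def)

definition blk :: "(nat \<times> 'k) list \<Rightarrow> 'k \<Rightarrow> nat \<Rightarrow> nat" where
  "blk n_as a j = length (filter (\<lambda>(s, b). b = a \<and> j < s) n_as)"

text \<open>The numbers \<^term>\<open>blk n_as a j\<close> are the dimensions of
  \<open>ker (A - a)\<^sup>j\<^sup>+\<^sup>1 / ker (A - a)\<^sup>j\<close>.\<close>

definition lvls :: "(nat \<times> 'k) list \<Rightarrow> nat multiset" where
  "lvls n_as = image_mset (\<lambda>(a, j). blk n_as a j) (mset_set {(a, j). 0 < blk n_as a j})"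

lemma count_pos: "length (filter (\<lambda>x. x = (a, j)) (pos (blocks_list n_as))) = blk n_as a j"
proof (induct n_as)
  case (Cons sb n_as)
  obtain s b where sb: "sb = (s, b)" by force
  have "filter (\<lambda>x. x = (a, j)) (zip (replicate s b) [0..<s]) = (if b = a \<and> j < s then [(a, j)] else [])"
  proof -
    have "zip (replicate s b) [0..<s] = map (Pair b) [0..<s]" by (intro nth_equalityI) auto
    moreover have "filter (\<lambda>x. x = j) [0..<s] = (if j < s then [j] else [])" by (induct s) auto
    then have "filter (\<lambda>x. x = (a, j)) (map (Pair b) [0..<s]) = (if b = a \<and> j < s then [(a, j)] else [])"
      by (auto simp: filter_map o_def)
    ultimately show ?thesis by simp
  qed
  with Cons show ?case by (simp add: blocks_list_def sb pos_Cons blk_def)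
qed (simp add: blocks_list_def blk_def)

lemma length_pos_blocks: "length (pos (blocks_list n_as)) = sum_list (map fst n_as)"
  by (induct n_as) (auto simp: blocks_list_def)

lemma jordan_shape_pos:
  "jordan_shape (length (pos (blocks_list n_as))) (\<lambda>k. fst (pos (blocks_list n_as) ! k)) (\<lambda>k. snd (pos (blocks_list n_as) ! k))"
  by unfold_locales (use pos_pred pos_blocks_pred in blast)

lemma jordan_similar_of_nf:
  fixes A :: "'k::field mat"
  assumes inf: "infinite (UNIV :: 'k set)" and A: "A \<in> carrier_mat n n" and nf: "jordan_nf A n_as"
  shows "\<exists>ev lev S S'. jordan_similar n ev lev A S S' \<and> jordan_shape.levels n ev lev = lvls n_as"
proof -
  from nf have "similar_mat A (jordan_matrix n_as)" by (simp add: jordan_nf_def)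
  then obtain S S' where w: "similar_mat_wit A (jordan_matrix n_as) S S'" by (auto simp: similar_mat_def)
  from similar_mat_witD2[OF A w] have c: "S * S' = 1\<^sub>m n" "S' * S = 1\<^sub>m n" "A = S * jordan_matrix n_as * S'"
    "jordan_matrix n_as \<in> carrier_mat n n" "S \<in> carrier_mat n n" "S' \<in> carrier_mat n n" by auto
  let ?p = "pos (blocks_list n_as)"
  let ?ev = "\<lambda>k. fst (?p ! k)" and ?lev = "\<lambda>k. snd (?p ! k)"
  from c(4) have len: "length ?p = n" unfolding length_pos_blocks by auto
  interpret jordan_shape n ?ev ?lev using jordan_shape_pos[of n_as] unfolding len .
  have jm: "jmat = jordan_matrix n_as"
    unfolding jmat_def jordan_matrix_bidiag diag_block_bidiag len by (rule cong_mat) auto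
  have "jordan_similar n ?ev ?lev A S S'"
    by unfold_locales (use A c jm inf in auto)
  moreover have "levels = lvls n_as"
  proof -
    have Lk: "L k = ?p ! k" for k by (simp add: L_def)
    have cn: "cnt (a, j) = blk n_as a j" for a j
      unfolding cnt_def Lk count_pos[symmetric] length_filter_conv_card len by (simp add: conj_commute)
    have "LS = {(a, j). 0 < blk n_as a j}"
    proof (intro equalityI subsetI)
      fix l assume "l \<in> LS"
      then obtain k where k: "k < n" "L k = l" by (auto simp: LS_def)
      then have "k \<in> {k. k < n \<and> L k = l}" by simp
      then have "0 < cnt l" unfolding cnt_def by (subst card_gt_0_iff) auto
      then show "l \<in> {(a, j). 0 < blk n_as a j}" using cn by (cases l) auto
    next
      fix l assume "l \<in> {(a, j). 0 < blk n_as a j}"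
      then have "0 < cnt l" using cn by (cases l) auto
      then have "{k. k < n \<and> L k = l} \<noteq> {}" unfolding cnt_def by (auto simp: card_gt_0_iff)
      then show "l \<in> LS" using L_in_LS by auto
    qed
    then show ?thesis unfolding levels_def lvls_def
      by (simp add: cn case_prod_unfold) (metis (no_types, lifting) cn image_mset_cong prod.collapse)
  qed
  ultimately show ?thesis by blast
qed

lemma sum_levels: 
  assumes "jordan_shape n ev lev"
  shows "(\<Sum>l\<in>jordan_shape.LS n ev lev. (jordan_shape.cnt n ev lev l)\<^sup>2)
    = sum_mset (image_mset (\<lambda>c. c\<^sup>2) (jordan_shape.levels n ev lev))"
proof -
  interpret jordan_shape n ev lev by (rule assms)
  show ?thesis unfolding levels_def by (simp add: sum_unfold_sum_mset multiset.map_comp o_def)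
qed

section \<open>Transposes of partitions\<close>

lemma partition_mono: "is_partition p \<Longrightarrow> i \<le> j \<Longrightarrow> p j \<le> p i"
  unfolding is_partition_def by (metis lift_Suc_antimono_le)

lemma downset_nat:
  fixes T :: "nat set"
  assumes "finite T" "\<And>x y. x \<in> T \<Longrightarrow> y < x \<Longrightarrow> y \<in> T"
  shows "T = {..<card T}"
proof (cases "T = {}")
  case False
  have "T = {..Max T}"
  proof (intro equalityI subsetI)
    fix x assume "x \<in> {..Max T}"
    then show "x \<in> T" using assms(2)[OF Max_in[OF assms(1) False], of x] Max_in[OF assms(1) False]
      by (cases "x = Max T") auto
  qed (use assms(1) in auto)
  then have "T = {..<Suc (Max T)}" by (simp add: lessThan_Suc_atMost)
  then show ?thesis by (metis card_lessThan)
qed simp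

text \<open>Both sides say that the cell \<open>(i, j)\<close> lies in the Young diagram of
  \<open>p\<close>.\<close>

lemma conjugate_less_iff:
  assumes p: "is_partition p"
  shows "i < conjugate p j \<longleftrightarrow> j < p i"
proof -
  have "finite {i. j < p i}" by (rule finite_subset[of _ "{i. p i \<noteq> 0}"]) (use p in \<open>auto simp: is_partition_def\<close>)
  moreover have "y \<in> {i. j < p i}" if "x \<in> {i. j < p i}" "y < x" for x y
    using partition_mono[OF p, of y x] that by simp
  ultimately have "{i. j < p i} = {..<conjugate p j}" unfolding conjugate_def by (rule downset_nat)
  then show ?thesis by blast
qed

lemma partition_eqI:
  assumes "is_partition p" "is_partition q" "\<And>j. conjugate p j = conjugate q j"
  shows "p = q"
proof
  fix i
  have "j < p i \<longleftrightarrow> j < q i" for j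
    using conjugate_less_iff[OF assms(1), of i j] conjugate_less_iff[OF assms(2), of i j] assms(3) by simp
  then show "p i = q i" by (metis linorder_neqE_nat less_irrefl)
qed

lemma finite_conjugate: "is_partition p \<Longrightarrow> finite {j. conjugate p j \<noteq> 0}"
  by (rule finite_subset[of _ "{..<p 0}"]) (auto simp: conjugate_less_iff[symmetric])

lemma size_filter_image_mset_set:
  assumes "finite T"
  shows "size (filter_mset P (image_mset f (mset_set T))) = card {a \<in> T. P (f a)}"
proof -
  have "filter_mset P (image_mset f (mset_set T)) = image_mset f (filter_mset (\<lambda>a. P (f a)) (mset_set T))"
    by (rule filter_mset_image_mset)
  then show ?thesis using assms by (simp add: filter_mset_mset_set)
qed

text \<open>The multiplicity of \<open>Suc i\<close> is a difference of consecutive tail counts.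
  Zeros are invisible to every tail and so are excluded.\<close>

lemma multiset_eq_by_tails:
  fixes M N :: "nat multiset"
  assumes "0 \<notin># M" "0 \<notin># N" "\<And>i. size (filter_mset (\<lambda>x. i < x) M) = size (filter_mset (\<lambda>x. i < x) N)"
  shows "M = N"
proof (rule multiset_eqI)
  fix x
  have c: "size (filter_mset (\<lambda>y. i < y) K) = count K (Suc i) + size (filter_mset (\<lambda>y. Suc i < y) K)"
    for i and K :: "nat multiset"
    by (induct K) auto
  show "count M x = count N x"
  proof (cases x)
    case 0
    then show ?thesis using assms(1,2) by (simp add: not_in_iff)
  next
    case (Suc i)
    then show ?thesis using c[of i M] c[of i N] assms(3)[of i] assms(3)[of "Suc i"] by simp
  qed
qed

lemma partition_of_partition: "is_partition (partition_of M)"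
  unfolding is_partition_def
proof
  let ?s = "sorted_list_of_multiset M"
  have len: "length ?s = size M" by (metis mset_sorted_list_of_multiset size_mset)
  show "\<forall>i. partition_of M (Suc i) \<le> partition_of M i"
  proof
    fix i
    show "partition_of M (Suc i) \<le> partition_of M i"
    proof (cases "Suc i < size M")
      case True
      have "?s ! (size M - Suc (Suc i)) \<le> ?s ! (size M - Suc i)"
        by (rule sorted_nth_mono) (use True len in auto)
      then show ?thesis using True len by (simp add: partition_of_def rev_nth)
    qed (simp add: partition_of_def)
  qed
  show "finite {i. partition_of M i \<noteq> 0}"
    by (rule finite_subset[of _ "{..<size M}"]) (auto simp: partition_of_def split: if_splits)
qed

lemma conjugate_partition_of:
  "conjugate (partition_of M) j = size (filter_mset (\<lambda>x. j < x) M)"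
proof -
  let ?s = "rev (sorted_list_of_multiset M)"
  have ms: "mset ?s = M" by simp
  have len: "length ?s = size M" by (metis ms size_mset)
  have "{i. j < partition_of M i} = {i. i < length ?s \<and> j < ?s ! i}"
    unfolding partition_of_def len by auto
  then have "conjugate (partition_of M) j = length (filter (\<lambda>x. j < x) ?s)"
    unfolding conjugate_def length_filter_conv_card by simp
  also have "\<dots> = size (filter_mset (\<lambda>x. j < x) (mset ?s))" by (metis mset_filter size_mset)
  finally show ?thesis by (simp only: ms)
qed

lemma blk_jnf_blocks: "conjugate (partition_of (jnf_blocks n_as a)) j = blk n_as a j"
  unfolding conjugate_partition_of jnf_blocks_def blk_def
  by (induct n_as) auto

lemma blk_pos_iff: "0 < blk n_as a j \<longleftrightarrow> (\<exists>s. (s, a) \<in> set n_as \<and> j < s)"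
  unfolding blk_def by (auto simp: filter_empty_conv)

lemma finite_blk: "finite {(a, j). 0 < blk n_as a j}"
proof (rule finite_subset)
  show "{(a, j). 0 < blk n_as a j} \<subseteq> (\<Union>(s, a)\<in>set n_as. {a} \<times> {..<s})"
    by (force simp: blk_pos_iff)
qed auto

lemma zero_notin_lvls: "0 \<notin># lvls n_as"
  unfolding lvls_def using finite_blk[of n_as] by auto

lemma finite_eigs [simp]: "finite (jnf_eigs n_as)" by (simp add: jnf_eigs_def)

lemma is_partition_psum:
  assumes "\<forall>p\<in>#D. is_partition p"
  shows "is_partition (psum D)"
  using assms
proof (induct D)
  case empty
  show ?case by (simp add: psum_def is_partition_def)
next
  case (add p D)
  then have "is_partition p" "is_partition (psum D)" by auto
  moreover have "psum (add_mset p D) = (\<lambda>i. p i + psum D i)" by (simp add: psum_def)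
  moreover have "{i. p i + psum D i \<noteq> 0} \<subseteq> {i. p i \<noteq> 0} \<union> {i. psum D i \<noteq> 0}" by auto
  ultimately show ?case unfolding is_partition_def
    by (auto intro!: add_mono intro: finite_subset)
qed

text \<open>A multiset of positive numbers is determined by its tail counts, and on both sides
  the number of elements exceeding \<open>i\<close> is \<open>\<Gamma>\<^sub>i\<close>.\<close>

lemma lvls_conjugate:
  "lvls n_as = parts (conjugate (psum (jordan_type n_as)))"
proof (rule multiset_eq_by_tails)
  let ?G = "psum (jordan_type n_as)"
  let ?q = "\<lambda>a. partition_of (jnf_blocks n_as a)"
  have G: "is_partition ?G"
    by (rule is_partition_psum) (auto simp: jordan_type_def partition_of_partition)
  have Gi: "?G i = (\<Sum>a\<in>jnf_eigs n_as. ?q a i)" for i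
    by (simp add: psum_def jordan_type_def multiset.map_comp o_def sum_unfold_sum_mset)
  show "0 \<notin># lvls n_as" by (rule zero_notin_lvls)
  show "0 \<notin># parts (conjugate ?G)" using finite_conjugate[OF G] by (auto simp: parts_def)
  fix i
  \<comment> \<open>For a fixed eigenvalue the levels with count above \<open>i\<close> form an
    initial segment whose length is the \<open>i\<close>-th part of its partition.\<close>
  have "{x \<in> {(a, j). 0 < blk n_as a j}. i < (case x of (a, j) \<Rightarrow> blk n_as a j)}
      = (SIGMA a:jnf_eigs n_as. {..<?q a i})"
  proof (rule Set.set_eqI)
    fix x :: "'a \<times> nat"
    obtain a j where x: "x = (a, j)" by force
    have "i < blk n_as a j \<longleftrightarrow> j < ?q a i"
      unfolding blk_jnf_blocks[symmetric] by (rule conjugate_less_iff[OF partition_of_partition])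
    moreover have "a \<in> jnf_eigs n_as" if "0 < blk n_as a j"
      using iffD1[OF blk_pos_iff that] by (force simp: jnf_eigs_def)
    ultimately show "x \<in> {x \<in> {(a, j). 0 < blk n_as a j}. i < (case x of (a, j) \<Rightarrow> blk n_as a j)}
      \<longleftrightarrow> x \<in> (SIGMA a:jnf_eigs n_as. {..<?q a i})" unfolding x by auto
  qed
  then have "size (filter_mset (\<lambda>x. i < x) (lvls n_as)) = card (SIGMA a:jnf_eigs n_as. {..<?q a i})"
    unfolding lvls_def size_filter_image_mset_set[OF finite_blk] by simp
  also have "\<dots> = ?G i" by (simp add: Gi)
  also have "\<dots> = card {j. i < conjugate ?G j}" by (simp add: conjugate_less_iff[OF G] flip: lessThan_def)
  also have "\<dots> = size (filter_mset (\<lambda>x. i < x) (parts (conjugate ?G)))"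
    unfolding parts_def size_filter_image_mset_set[OF finite_conjugate[OF G]]
    by (rule arg_cong[of _ _ card]) auto
  finally show "size (filter_mset (\<lambda>x. i < x) (lvls n_as)) = size (filter_mset (\<lambda>x. i < x) (parts (conjugate ?G)))" .
qed

section \<open>Semisimple matrices\<close>

lemma pos_singletons: "pos (blocks_list (map (Pair 1) as)) = map (\<lambda>a. (a, 0)) as"
  by (induct as) (auto simp: blocks_list_def pos_Cons)

lemma jordan_matrix_singletons:
  "jordan_matrix (map (Pair 1) as) = mat (length as) (length as) (\<lambda>(i, k). if i = k then as ! i else 0)"
  unfolding jordan_matrix_bidiag diag_block_bidiag pos_singletons by (rule eq_matI) auto

lemma semisimple_nf:
  fixes A :: "'k::field mat"
  assumes "A \<in> carrier_mat n n" "semisimple A"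
  shows "\<exists>as. jordan_nf A (map (Pair 1) as)"
proof -
  from assms(2) obtain E where E: "diagonal_mat E" "similar_mat A E" by (auto simp: semisimple_def)
  from similar_matD[OF E(2)] assms(1) have Ec: "E \<in> carrier_mat n n" by auto
  have "jordan_matrix (map (Pair 1) (map (\<lambda>i. E $$ (i, i)) [0..<n])) = E"
    unfolding jordan_matrix_singletons using Ec E(1) by (intro eq_matI) (auto simp: diagonal_mat_def)
  with E(2) show ?thesis by (intro exI[of _ "map (\<lambda>i. E $$ (i, i)) [0..<n]"]) (auto simp: jordan_nf_def)
qed

lemma nf_semisimple: "jordan_nf A (map (Pair 1) as) \<Longrightarrow> semisimple A"
  unfolding semisimple_def jordan_nf_def jordan_matrix_singletons
  by (auto simp: diagonal_mat_def intro!: exI)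

lemma blk_singletons: "blk (map (Pair 1) as) a j = (if j = 0 then count (mset as) a else 0)"
  unfolding blk_def by (induct as) auto

lemma lvls_singletons: "lvls (map (Pair 1) as) = image_mset (count (mset as)) (mset_set (set as))"
proof -
  have "{(a, j). 0 < blk (map (Pair 1) as) a j} = (\<lambda>a. (a, 0)) ` set as"
    unfolding blk_singletons by (auto split: if_splits)
  moreover have "inj_on (\<lambda>a. (a, 0 :: nat)) (set as)" by (simp add: inj_on_def)
  ultimately have "mset_set {(a, j). 0 < blk (map (Pair 1) as) a j} = image_mset (\<lambda>a. (a, 0)) (mset_set (set as))"
    by (simp only: image_mset_mset_set)
  then show ?thesis unfolding lvls_def blk_singletons by (simp add: multiset.map_comp o_def)
qed

text \<open>Links the eigenspace dimensions in \<open>S_set\<close> to the level counts: with all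
  blocks of size 1 only level 0 occurs.\<close>

lemma eigenspaces_lvls:
  fixes A :: "'k::field mat"
  assumes A: "A \<in> carrier_mat n n" and nf: "jordan_nf A (map (Pair 1) as)"
  shows "image_mset (\<lambda>a. kernel_dim (char_matrix A a)) (mset_set {a. eigenvalue A a}) = lvls (map (Pair 1) as)"
proof -
  have ker: "kernel_dim (char_matrix A a) = count (mset as) a" for a
  proof -
    have "kernel_dim (char_matrix A a) = dim_gen_eigenspace A a 1"
      using A by (simp add: dim_gen_eigenspace_def)
    also have "\<dots> = count (mset as) a" unfolding dim_gen_eigenspace[OF nf]
      by (induct as) auto
    finally show ?thesis .
  qed
  have "char_poly A = (\<Prod>a\<leftarrow>as. [:- a, 1:])"
    unfolding jordan_nf_char_poly[OF nf] by (simp add: o_def)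
  then have ev: "{a. eigenvalue A a} = set as"
    unfolding eigenvalue_root_char_poly[OF A] by (auto simp: poly_prod_list prod_list_zero_iff)
  show ?thesis unfolding ev ker lvls_singletons ..
qed

section \<open>Deformations\<close>

text \<open>A univariate polynomial vanishing for all \<open>t\<close> outside \<open>F\<close> is
  zero, hence vanishes at \<open>t = 0\<close> too, which is typically one of the
  exceptions.\<close>

lemma zariski_closure_line:
  fixes A E :: "'k::field mat"
  assumes inf: "infinite (UNIV :: 'k set)" and A: "A \<in> carrier_mat n n" and E: "E \<in> carrier_mat n n"
    and F: "finite F" and X: "\<And>t. t \<notin> F \<Longrightarrow> A + t \<cdot>\<^sub>m E \<in> X"
  shows "A \<in> zariski_closure n n X"
  unfolding zariski_closure_def
proof (rule InterI)
  fix C assume "C \<in> {C. zariski_closed n n C \<and> X \<subseteq> C}"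
  then obtain H where H: "H \<subseteq> poly_fun n n" "C = {M \<in> carrier_mat n n. \<forall>f\<in>H. f M = 0}" "X \<subseteq> C"
    by (auto simp: zariski_closed_def)
  have "f A = 0" if f: "f \<in> H" for f
  proof -
    from poly_fun_line[of f n n A E] f H(1) A E obtain p where p: "\<And>t. f (A + t \<cdot>\<^sub>m E) = poly p t" by blast
    have "p = 0"
    proof (rule poly_zero_of_infinite[OF inf F])
      fix t assume "t \<notin> F"
      then have "A + t \<cdot>\<^sub>m E \<in> C" using X H(3) by blast
      then have "f (A + t \<cdot>\<^sub>m E) = 0" using f H(2) by blast
      then show "poly p t = 0" by (simp add: p)
    qed
    moreover have "A + 0 \<cdot>\<^sub>m E = A" using A E by (intro eq_matI) auto
    ultimately show ?thesis using p[of 0] by simp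
  qed
  then show "A \<in> C" using A H(2) by simp
qed

section \<open>Bidiagonal matrices as nonderogatory matrices\<close>

text \<open>The entrywise equation is
  \<open>(l ! j - a) * x i j = e i j + x (i + 1) j - x i (j - 1)\<close>, with \<open>x\<close> zero
  below the last row and left of the first column. It needs only entries nearer to the bottom left
  corner.\<close>

function sylv :: "nat \<Rightarrow> 'k::field \<Rightarrow> 'k list \<Rightarrow> nat \<Rightarrow> nat \<Rightarrow> 'k" where
  "sylv s a l i j = (if i < s then ((if Suc i = s \<and> j = 0 then 1 else 0) + sylv s a l (Suc i) j
     - (if j = 0 then 0 else sylv s a l i (j - 1))) / (l ! j - a) else 0)"
  by pat_completeness auto
termination by (relation "measure (\<lambda>(s, a, l, i, j). (s - i) + j)") auto

declare sylv.simps [simp del]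

text \<open>The corner entry is removed by the solution of a Sylvester equation, computed
  entrywise from the bottom left.\<close>

lemma bidiag_decouple:
  fixes a :: "'k::field"
  assumes a: "a \<notin> set l"
  shows "similar_mat (bidiag (replicate s a @ l))
    (four_block_mat (jordan_block s a) (0\<^sub>m s (length l)) (0\<^sub>m (length l) s) (bidiag l))"
proof -
  let ?m = "length l"
  let ?J = "jordan_block s a" and ?B = "bidiag l"
  define X where "X = mat s ?m (\<lambda>(i, j). sylv s a l i j)"
  \<comment> \<open>The single superdiagonal 1 that joins the last row of the first block to the
    rest.\<close>
  define E where "E = mat s ?m (\<lambda>(i, j). if Suc i = s \<and> j = 0 then 1 else 0 :: 'k)"
  have J: "?J \<in> carrier_mat s s" and B: "?B \<in> carrier_mat ?m ?m" and Xc: "X \<in> carrier_mat s ?m"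
    and Ec: "E \<in> carrier_mat s ?m" and Xm: "- X \<in> carrier_mat s ?m"
    by (auto simp: X_def E_def intro: carrier_matI)
  let ?P = "four_block_mat (1\<^sub>m s) X (0\<^sub>m ?m s) (1\<^sub>m ?m)"
  let ?Q = "four_block_mat (1\<^sub>m s) (- X) (0\<^sub>m ?m s) (1\<^sub>m ?m)"
  let ?D = "four_block_mat ?J (0\<^sub>m s ?m) (0\<^sub>m ?m s) ?B"
  have syl: "?J * (- X) + X * ?B = E"
  proof (rule eq_matI)
    fix i j assume "i < dim_row E" "j < dim_col E"
    then have ij: "i < s" "j < ?m" by (auto simp: E_def)
    have XB: "(X * ?B) $$ (i, j) = sylv s a l i j * l ! j + (if j = 0 then 0 else sylv s a l i (j - 1))"
    proof -
      have "(X * ?B) $$ (i, j) = (\<Sum>k<?m. X $$ (i, k) * ?B $$ (k, j))"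
        by (rule index_mult_mat_sum[OF Xc B ij])
      also have "\<dots> = (\<Sum>k<?m. (if k = j then sylv s a l i j * l ! j else 0)
        + (if k = j - 1 then (if j = 0 then 0 else sylv s a l i (j - 1)) else 0))"
        by (rule sum.cong) (use ij in \<open>auto simp: X_def bidiag_def\<close>)
      also have "\<dots> = sylv s a l i j * l ! j + (if j = 0 then 0 else sylv s a l i (j - 1))"
        using ij by (auto simp: sum.distrib)
      finally show ?thesis .
    qed
    have JX: "(?J * (- X)) $$ (i, j) = - (a * sylv s a l i j + sylv s a l (Suc i) j)"
    proof -
      have "(?J * (- X)) $$ (i, j) = (\<Sum>k<s. ?J $$ (i, k) * (- X) $$ (k, j))"
        by (rule index_mult_mat_sum[OF J Xm ij])
      also have "\<dots> = (\<Sum>k<s. (if k = i then - (a * sylv s a l i j) else 0)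
        + (if k = Suc i then - sylv s a l (Suc i) j else 0))"
        by (rule sum.cong) (use ij in \<open>auto simp: X_def\<close>)
      also have "\<dots> = - (a * sylv s a l i j) + (if Suc i < s then - sylv s a l (Suc i) j else 0)"
        using ij by (simp add: sum.distrib)
      also have "\<dots> = - (a * sylv s a l i j + sylv s a l (Suc i) j)"
        by (simp add: sylv.simps[of s a l "Suc i" j])
      finally show ?thesis .
    qed
    have "l ! j - a \<noteq> 0" using a ij by auto
    then have "(l ! j - a) * sylv s a l i j = (if Suc i = s \<and> j = 0 then 1 else 0) + sylv s a l (Suc i) j
      - (if j = 0 then 0 else sylv s a l i (j - 1))" using ij by (subst sylv.simps) simp
    moreover have "(?J * (- X) + X * ?B) $$ (i, j) = (?J * (- X)) $$ (i, j) + (X * ?B) $$ (i, j)"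
      by (rule index_add_mat) (use ij Xc B in auto)
    ultimately show "(?J * (- X) + X * ?B) $$ (i, j) = E $$ (i, j)"
      unfolding XB JX using ij by (simp add: E_def algebra_simps)
  qed (use J B Xc Ec in auto)
  have "bidiag (replicate s a @ l) = four_block_mat ?J E (0\<^sub>m ?m s) ?B"
  proof (rule eq_matI)
    fix i j assume "i < dim_row (four_block_mat ?J E (0\<^sub>m ?m s) ?B)" "j < dim_col (four_block_mat ?J E (0\<^sub>m ?m s) ?B)"
    then have "i < s + ?m" "j < s + ?m" by auto
    then show "bidiag (replicate s a @ l) $$ (i, j) = four_block_mat ?J E (0\<^sub>m ?m s) ?B $$ (i, j)"
      by (cases "i < s"; cases "j < s") (auto simp: bidiag_def E_def nth_append)
  qed (auto simp: bidiag_def)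
  moreover have "?P * ?D = four_block_mat ?J (X * ?B) (0\<^sub>m ?m s) ?B"
    by (subst mult_four_block_mat[OF one_carrier_mat Xc zero_carrier_mat one_carrier_mat J zero_carrier_mat zero_carrier_mat B])
      (use J B Xc in auto)
  moreover have "four_block_mat ?J (X * ?B) (0\<^sub>m ?m s) ?B * ?Q = four_block_mat ?J E (0\<^sub>m ?m s) ?B"
    by (subst mult_four_block_mat[OF J mult_carrier_mat[OF Xc B] zero_carrier_mat B one_carrier_mat Xm zero_carrier_mat one_carrier_mat])
      (use J B Xc syl in auto)
  moreover have "?P * ?Q = 1\<^sub>m (s + ?m)" "?Q * ?P = 1\<^sub>m (s + ?m)"
  proof -
    have "- X + X = 0\<^sub>m s ?m" "X + - X = 0\<^sub>m s ?m" using Xc by (auto intro!: eq_matI)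
    moreover have "- 0\<^sub>m ?m ?m + 1\<^sub>m ?m = (1\<^sub>m ?m :: 'k mat)" by (auto intro!: eq_matI)
    ultimately show "?P * ?Q = 1\<^sub>m (s + ?m)"
      by (subst mult_four_block_mat[OF one_carrier_mat Xc zero_carrier_mat one_carrier_mat one_carrier_mat Xm zero_carrier_mat one_carrier_mat])
        (use Xc Xm in auto)
    from \<open>- X + X = 0\<^sub>m s ?m\<close> \<open>X + - X = 0\<^sub>m s ?m\<close> show "?Q * ?P = 1\<^sub>m (s + ?m)"
      by (subst mult_four_block_mat[OF one_carrier_mat Xm zero_carrier_mat one_carrier_mat one_carrier_mat Xc zero_carrier_mat one_carrier_mat])
        (use Xc Xm in auto)
  qed
  ultimately show ?thesis
    by (intro similar_matI[where n = "s + ?m" and P = ?P and Q = ?Q]) (use J B Xc Ec in auto)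
qed

text \<open>Runs of equal diagonal entries are split off one at a time. Runs of length 0 are
  excluded because a Jordan normal form has no empty blocks.\<close>

lemma bidiag_nf:
  fixes ms :: "(nat \<times> 'k::field) list"
  assumes "distinct (map snd ms)" "0 \<notin> fst ` set ms"
  shows "jordan_nf (bidiag (concat (blocks_list ms))) ms"
  using assms
proof (induct ms)
  case Nil
  have e: "bidiag [] = (jordan_matrix [] :: 'k mat)" by (auto simp: jordan_matrix_def bidiag_def)
  have "similar_mat (bidiag []) (jordan_matrix [] :: 'k mat)"
    unfolding e by (rule similar_mat_refl[OF jordan_matrix_carrier])
  then show ?case by (simp add: jordan_nf_def blocks_list_def)
next
  case (Cons sa ms)
  obtain s a where sa: "sa = (s, a)" by force
  let ?l = "concat (blocks_list ms)"
  have IH: "similar_mat (bidiag ?l) (jordan_matrix ms)" using Cons by (simp add: jordan_nf_def)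
  have len: "length ?l = sum_list (map fst ms)"
    by (induct ms) (auto simp: blocks_list_def)
  have "a \<notin> set ?l" using Cons(2) by (force simp: sa blocks_list_def)
  from bidiag_decouple[OF this, of s]
  have "similar_mat (bidiag (concat (blocks_list (sa # ms))))
    (four_block_mat (jordan_block s a) (0\<^sub>m s (length ?l)) (0\<^sub>m (length ?l) s) (bidiag ?l))"
    by (simp add: blocks_list_def sa)
  moreover have "similar_mat (four_block_mat (jordan_block s a) (0\<^sub>m s (length ?l)) (0\<^sub>m (length ?l) s) (bidiag ?l))
    (four_block_mat (jordan_block s a) (0\<^sub>m s (length ?l)) (0\<^sub>m (length ?l) s) (jordan_matrix ms))"
    by (rule similar_mat_four_block_0_0[OF similar_mat_refl[OF jordan_block_carrier] IH])
      (auto intro: carrier_matI)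
  ultimately have "similar_mat (bidiag (concat (blocks_list (sa # ms)))) (jordan_matrix (sa # ms))"
    unfolding sa jordan_matrix_Cons len by (rule similar_mat_trans)
  with Cons(3) show ?case by (simp add: jordan_nf_def)
qed

section \<open>Deformations of the diagonal of a Jordan matrix\<close>

lemma pos_map: "pos (map (map f) ls) = map (\<lambda>(x, j). (f x, j)) (pos ls)"
  by (induct ls) (auto simp: pos_Cons zip_map1)

text \<open>An entry \<open>(a, g)\<close> of \<open>zss\<close> is the diagonal entry \<open>a + t g\<close> of the deformed Jordan matrix.\<close>

lemma closure_of_deformation:
  fixes A :: "'k::field mat" and zss :: "('k \<times> 'k) list list"
  assumes inf: "infinite (UNIV :: 'k set)" and A: "A \<in> carrier_mat n n" and nf: "jordan_nf A n_as"
    and zss: "map (map fst) zss = blocks_list n_as" and F: "finite F"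
    and X: "\<And>t B. t \<notin> F \<Longrightarrow> B \<in> carrier_mat n n \<Longrightarrow>
      similar_mat B (diag_block_mat (map (\<lambda>zs. bidiag (map (\<lambda>(a, g). a + t * g) zs)) zss)) \<Longrightarrow> B \<in> X"
  shows "A \<in> zariski_closure n n X"
proof -
  let ?f = "\<lambda>t (a, g). a + t * g :: 'k"
  let ?D = "\<lambda>t. diag_block_mat (map (\<lambda>zs. bidiag (map (?f t) zs)) zss)"
  from nf have "similar_mat A (jordan_matrix n_as)" by (simp add: jordan_nf_def)
  then obtain S S' where w: "similar_mat_wit A (jordan_matrix n_as) S S'" by (auto simp: similar_mat_def)
  from similar_mat_witD2[OF A w] have c: "S * S' = 1\<^sub>m n" "S' * S = 1\<^sub>m n" "A = S * jordan_matrix n_as * S'"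
    "jordan_matrix n_as \<in> carrier_mat n n" "S \<in> carrier_mat n n" "S' \<in> carrier_mat n n" by auto
  have "length (pos zss) = length (pos (map (map fst) zss))" by (simp add: pos_map)
  also have "\<dots> = n" using c(4) unfolding zss length_pos_blocks by auto
  finally have len: "length (pos zss) = n" .
  define \<Gamma> where "\<Gamma> = mat n n (\<lambda>(i, k). if i = k then snd (fst (pos zss ! i)) else 0)"
  have \<Gamma>: "\<Gamma> \<in> carrier_mat n n" by (simp add: \<Gamma>_def)
  have D: "?D t = jordan_matrix n_as + t \<cdot>\<^sub>m \<Gamma>" for t
  proof -
    have "map (\<lambda>zs. bidiag (map (?f t) zs)) zss = map bidiag (map (map (?f t)) zss)" by simp
    then have "?D t = mat n n (\<lambda>(i, k). if i = k then fst (pos (map (map (?f t)) zss) ! i)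
        else if Suc i = k \<and> 0 < snd (pos (map (map (?f t)) zss) ! k) then 1 else 0)"
      by (simp only: diag_block_bidiag) (simp add: pos_map len)
    also have "\<dots> = jordan_matrix n_as + t \<cdot>\<^sub>m \<Gamma>"
      unfolding jordan_matrix_bidiag zss[symmetric] diag_block_bidiag
      by (rule eq_matI) (auto simp: pos_map len \<Gamma>_def case_prod_unfold)
    finally show ?thesis .
  qed
  have E: "S * \<Gamma> * S' \<in> carrier_mat n n" using c \<Gamma> by (simp add: mult_carrier_mat[of _ n n _ n])
  show ?thesis
  proof (rule zariski_closure_line[OF inf A E F])
    fix t assume t: "t \<notin> F"
    let ?B = "A + t \<cdot>\<^sub>m (S * \<Gamma> * S')"
    have Bc: "?B \<in> carrier_mat n n" using A E by simp
    have t\<Gamma>: "t \<cdot>\<^sub>m \<Gamma> \<in> carrier_mat n n" using \<Gamma> by simp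
    have "S * ?D t * S' = (S * jordan_matrix n_as + S * (t \<cdot>\<^sub>m \<Gamma>)) * S'"
      unfolding D mult_add_distrib_mat[OF c(5,4) t\<Gamma>] ..
    also have "\<dots> = S * jordan_matrix n_as * S' + S * (t \<cdot>\<^sub>m \<Gamma>) * S'"
      by (rule add_mult_distrib_mat[OF mult_carrier_mat[OF c(5,4)] mult_carrier_mat[OF c(5) t\<Gamma>] c(6)])
    also have "S * (t \<cdot>\<^sub>m \<Gamma>) * S' = t \<cdot>\<^sub>m (S * \<Gamma> * S')"
      unfolding mult_smult_distrib[OF c(5) \<Gamma>] by (rule mult_smult_assoc_mat[OF mult_carrier_mat[OF c(5) \<Gamma>] c(6)])
    finally have "?B = S * ?D t * S'" unfolding c(3)[symmetric] by simp
    then have "similar_mat ?B (?D t)"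
      by (intro similar_matI[where n = n and P = S and Q = S']) (use c Bc D[of t] t\<Gamma> in auto)
    from X[OF t Bc this] show "?B \<in> X" .
  qed
qed

lemma nf_of_similar_bidiags:
  fixes B :: "'k::field mat"
  assumes sim: "similar_mat B (diag_block_mat (map (\<lambda>x. bidiag (concat (blocks_list (ms x)))) xs))"
    and ms: "\<And>x. x \<in> set xs \<Longrightarrow> distinct (map snd (ms x)) \<and> 0 \<notin> fst ` set (ms x)"
  shows "jordan_nf B (concat (map ms xs))"
proof -
  let ?Ms = "map (\<lambda>x. (bidiag (concat (blocks_list (ms x))), ms x)) xs"
  have "jordan_nf (diag_block_mat (map fst ?Ms)) (concat (map snd ?Ms))"
    by (rule jordan_nf_diag_block_mat) (use bidiag_nf ms in auto)
  then have "jordan_nf (diag_block_mat (map (\<lambda>x. bidiag (concat (blocks_list (ms x)))) xs)) (concat (map ms xs))"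
    by (simp add: o_def)
  with sim show ?thesis unfolding jordan_nf_def using similar_mat_trans by blast
qed

lemma blk_Nil [simp]: "blk [] a j = 0"
  and blk_append: "blk (xs @ ys) a j = blk xs a j + blk ys a j"
  by (simp_all add: blk_def)

text \<open>Two labels with different \<open>j\<close> collide for one \<open>t\<close> only, and
  with equal \<open>j\<close> and different \<open>a\<close> they never collide.\<close>

lemma finite_bad_parameters:
  fixes T :: "('k::field \<times> nat) set" and \<beta> :: "nat \<Rightarrow> 'k"
  assumes T: "finite T" and \<beta>: "inj \<beta>"
  shows "finite {t. \<not> inj_on (\<lambda>(a, j). a + t * \<beta> j) T}"
proof (rule finite_subset)
  show "finite ((\<lambda>((a, j), (a', j')). (a' - a) / (\<beta> j - \<beta> j')) ` (T \<times> T))" using T by simp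
  show "{t. \<not> inj_on (\<lambda>(a, j). a + t * \<beta> j) T} \<subseteq> (\<lambda>((a, j), (a', j')). (a' - a) / (\<beta> j - \<beta> j')) ` (T \<times> T)"
  proof
    fix t assume "t \<in> {t. \<not> inj_on (\<lambda>(a, j). a + t * \<beta> j) T}"
    then obtain a j a' j' where *: "(a, j) \<in> T" "(a', j') \<in> T" "a + t * \<beta> j = a' + t * \<beta> j'" "(a, j) \<noteq> (a', j')"
      unfolding inj_on_def by auto
    have "j \<noteq> j'" using * by auto
    then have "\<beta> j - \<beta> j' \<noteq> 0" using \<beta> by (auto simp: inj_eq)
    moreover have "t * (\<beta> j - \<beta> j') = a' - a" using *(3) by (simp add: algebra_simps)
    ultimately have "t = (a' - a) / (\<beta> j - \<beta> j')" by (simp add: field_simps)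
    then show "t \<in> (\<lambda>((a, j), (a', j')). (a' - a) / (\<beta> j - \<beta> j')) ` (T \<times> T)"
      using *(1,2) by (intro image_eqI[of _ _ "((a, j), (a', j'))"]) auto
  qed
qed

text \<open>The diagonal after position \<open>j\<close> of every block is moved from
  \<open>a\<close> to \<open>a + t * \<beta> j\<close>. Blocks of one eigenvalue share the shift at
  equal height, so multiplicities become column lengths of its Young diagram.\<close>

definition spread :: "(nat \<Rightarrow> 'k::field) \<Rightarrow> 'k \<Rightarrow> (nat \<times> 'k) list \<Rightarrow> 'k list" where
  "spread \<beta> t n_as = concat (map (\<lambda>(s, a). map (\<lambda>j. a + t * \<beta> j) [0..<s]) n_as)"

lemma set_spread: "set (spread \<beta> t n_as) = (\<lambda>(a, j). a + t * \<beta> j) ` {(a, j). 0 < blk n_as a j}"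
  unfolding spread_def by (force simp: blk_pos_iff)

lemma count_spread:
  assumes "\<And>s b i. (s, b) \<in> set n_as \<Longrightarrow> i < s \<Longrightarrow> b + t * \<beta> i = c \<longleftrightarrow> b = a \<and> i = j"
  shows "count (mset (spread \<beta> t n_as)) c = blk n_as a j"
  using assms
proof (induct n_as)
  case Nil
  show ?case by (simp add: spread_def)
next
  case (Cons sb n_as)
  obtain s b where sb: "sb = (s, b)" by force
  have IH: "count (mset (spread \<beta> t n_as)) c = blk n_as a j" by (rule Cons(1)) (use Cons(2) in auto)
  have "count (mset (map (\<lambda>i. b + t * \<beta> i) [0..<s'])) c = (if b = a \<and> j < s' then 1 else 0)" if "s' \<le> s" for s'
    using that
  proof (induct s')
    case (Suc s')
    have "b + t * \<beta> s' = c \<longleftrightarrow> b = a \<and> s' = j" by (rule Cons(2)[of s]) (use Suc(2) sb in auto)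
    with Suc show ?case by auto
  qed simp
  from this[of s] IH show ?case by (simp add: spread_def sb blk_def)
qed

lemma lvls_spread:
  assumes inj: "inj_on (\<lambda>(a, j). a + t * \<beta> j) {(a, j). 0 < blk n_as a j}"
  shows "lvls (map (Pair 1) (spread \<beta> t n_as)) = lvls n_as"
proof -
  let ?T = "{(a, j). 0 < blk n_as a j}" and ?h = "\<lambda>(a, j). a + t * \<beta> j"
  have "lvls (map (Pair 1) (spread \<beta> t n_as))
    = image_mset (count (mset (spread \<beta> t n_as))) (image_mset ?h (mset_set ?T))"
    unfolding lvls_singletons set_spread image_mset_mset_set[OF inj] ..
  also have "\<dots> = image_mset (\<lambda>x. count (mset (spread \<beta> t n_as)) (?h x)) (mset_set ?T)"
    by (simp add: multiset.map_comp o_def)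
  also have "\<dots> = lvls n_as"
    unfolding lvls_def
  proof (rule image_mset_cong)
    fix x assume "x \<in># mset_set ?T"
    then have x: "x \<in> ?T" using finite_blk[of n_as] by simp
    obtain a j where e: "x = (a, j)" by force
    have "count (mset (spread \<beta> t n_as)) (a + t * \<beta> j) = blk n_as a j"
    proof (rule count_spread)
      fix s b i assume "(s, b) \<in> set n_as" "i < s"
      then have "(b, i) \<in> ?T" by (auto simp: blk_pos_iff)
      with inj_on_eq_iff[OF inj this x] show "b + t * \<beta> i = a + t * \<beta> j \<longleftrightarrow> b = a \<and> i = j" by (simp add: e)
    qed
    then show "count (mset (spread \<beta> t n_as)) (?h x) = (case x of (a, j) \<Rightarrow> blk n_as a j)" by (simp add: e)
  qed
  finally show ?thesis .
qed

lemma S_setI: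
  assumes "A \<in> carrier_mat n n" "jordan_nf A (map (Pair 1) as)" "lvls (map (Pair 1) as) = parts G"
  shows "A \<in> S_set n G"
  using assms nf_semisimple[OF assms(2)] eigenspaces_lvls[OF assms(1,2)] by (simp add: S_set_def)

text \<open>For good \<open>t\<close> the diagonal entries inside each block are distinct, so the
  deformed matrix is diagonalisable. The value \<open>a + t * \<beta> j\<close> occurs once in every
  block of \<open>a\<close> longer than \<open>j\<close>, which makes the eigenspace dimensions the
  level counts.\<close>

lemma in_closure_S_set:
  fixes A :: "'k::field mat"
  assumes inf: "infinite (UNIV :: 'k set)" and A: "A \<in> carrier_mat n n" and nf: "jordan_nf A n_as"
    and lv: "lvls n_as = parts G"
  shows "A \<in> zariski_closure n n (S_set n G)"
proof -
  from inf obtain \<beta> :: "nat \<Rightarrow> 'k" where \<beta>: "inj \<beta>" using infinite_countable_subset by blast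
  define zss where "zss = map (\<lambda>(s, a). map (\<lambda>j. (a, \<beta> j)) [0..<s]) n_as"
  let ?T = "{(a, j). 0 < blk n_as a j}"
  show ?thesis
  proof (rule closure_of_deformation[OF inf A nf, where zss = zss])
    show "map (map fst) zss = blocks_list n_as"
      unfolding zss_def blocks_list_def by (auto simp: o_def map_replicate_const)
    show "finite {t. \<not> inj_on (\<lambda>(a, j). a + t * \<beta> j) ?T}"
      by (rule finite_bad_parameters[OF finite_blk \<beta>])
    fix t and B :: "'k mat"
    assume t: "t \<notin> {t. \<not> inj_on (\<lambda>(a, j). a + t * \<beta> j) ?T}" and B: "B \<in> carrier_mat n n"
      and sim: "similar_mat B (diag_block_mat (map (\<lambda>zs. bidiag (map (\<lambda>(a, g). a + t * g) zs)) zss))"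
    from t have inj: "inj_on (\<lambda>(a, j). a + t * \<beta> j) ?T" by simp
    define ms where "ms = (\<lambda>(s, a). map (\<lambda>j. (1 :: nat, a + t * \<beta> j)) [0..<s])"
    have "concat (blocks_list (ms (s, a))) = map (\<lambda>j. a + t * \<beta> j) [0..<s]" for s a
    proof -
      have "concat (map (\<lambda>j. [f j]) xs) = map f xs" for f :: "nat \<Rightarrow> 'k" and xs by (induct xs) auto
      then show ?thesis by (simp add: ms_def blocks_list_def o_def)
    qed
    then have "map (\<lambda>zs. bidiag (map (\<lambda>(a, g). a + t * g) zs)) zss = map (\<lambda>x. bidiag (concat (blocks_list (ms x)))) n_as"
      unfolding zss_def by (auto simp: o_def)
    with sim have sim': "similar_mat B (diag_block_mat (map (\<lambda>x. bidiag (concat (blocks_list (ms x)))) n_as))" by simp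
    have "jordan_nf B (concat (map ms n_as))"
    proof (rule nf_of_similar_bidiags[OF sim'])
      fix x assume x: "x \<in> set n_as"
      obtain s a where e: "x = (s, a)" by force
      have "inj_on (\<lambda>j. a + t * \<beta> j) {0..<s}"
      proof (rule inj_onI)
        fix i j assume ij: "i \<in> {0..<s}" "j \<in> {0..<s}" "a + t * \<beta> i = a + t * \<beta> j"
        then have "(a, i) \<in> ?T" "(a, j) \<in> ?T" using x e by (auto simp: blk_pos_iff)
        from inj_on_eq_iff[OF inj this] ij(3) show "i = j" by simp
      qed
      then show "distinct (map snd (ms x)) \<and> 0 \<notin> fst ` set (ms x)"
        unfolding e ms_def by (auto simp: o_def distinct_map)
    qed
    moreover have "concat (map ms n_as) = map (Pair 1) (spread \<beta> t n_as)"
      unfolding spread_def ms_def by (induct n_as) auto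
    ultimately show "B \<in> S_set n G"
      using S_setI[OF B] lvls_spread[OF inj] lv by simp
  qed
qed

lemma partition_of_nth:
  obtains xs where "mset xs = M" "length xs = size M" "\<And>i. partition_of M i = (if i < size M then xs ! i else 0)"
proof
  show "mset (rev (sorted_list_of_multiset M)) = M" by simp
  then show "length (rev (sorted_list_of_multiset M)) = size M" by (metis size_mset)
  show "partition_of M i = (if i < size M then rev (sorted_list_of_multiset M) ! i else 0)" for i
    by (simp add: partition_of_def)
qed

lemma blk_concat_upt: "blk (concat (map f [0..<k])) a j = (\<Sum>b<k. blk (f b) a j)"
  by (induct k) (simp_all add: blk_append)

lemma blk_single_group:
  assumes "inj_on c {..<m}" "i < m"
  shows "blk (filter (\<lambda>(s, a). s \<noteq> 0) (map (\<lambda>i. (q i, c i)) [0..<m])) (c i) j = (if j < q i then 1 else 0)"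
proof -
  have "filter (\<lambda>(s, b). b = c i \<and> j < s) (filter (\<lambda>(s, a). s \<noteq> 0) (map (\<lambda>i. (q i, c i)) [0..<m]))
    = map (\<lambda>i. (q i, c i)) (filter (\<lambda>i'. c i' = c i \<and> j < q i') [0..<m])"
    by (auto simp: filter_map o_def intro!: arg_cong[of _ _ "map _"] filter_cong)
  moreover have "{i'. i' < m \<and> c i' = c i \<and> j < q i'} = (if j < q i then {i} else {})"
    using assms inj_on_eq_iff[OF assms(1)] by auto
  moreover have "length (filter (\<lambda>i'. c i' = c i \<and> j < q i') [0..<m]) = card {i'. i' < m \<and> c i' = c i \<and> j < q i'}"
    unfolding length_filter_conv_card by (rule arg_cong[of _ _ card]) auto
  ultimately show ?thesis unfolding blk_def by simp
qed

text \<open>The block of rank \<open>b\<close> has length \<open>psum D b\<close> and is cut into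
  one run for each partition, the run of partition \<open>i\<close> having length its
  \<open>b\<close>-th part and shift \<open>\<alpha> i\<close>. Each nonempty run becomes one Jordan
  block, so eigenvalue number \<open>i\<close> receives the parts of partition \<open>i\<close>.
  Since the shifts are distinct, only \<open>t = 0\<close> is exceptional.\<close>

lemma in_closure_X_set:
  fixes A :: "'k::field mat"
  assumes inf: "infinite (UNIV :: 'k set)" and D: "\<forall>p\<in>#D. is_partition p \<and> psize p > 0"
    and A: "A \<in> U_set n (psum D)"
  shows "A \<in> zariski_closure n n (X_set n D)"
proof -
  let ?G = "psum D"
  from A obtain n_as where Ac: "A \<in> carrier_mat n n" and nf: "jordan_nf A n_as"
    and one: "card (jnf_eigs n_as) = 1" and ty: "jordan_type n_as = {#?G#}" by (auto simp: U_set_def)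
  from one obtain l where l: "jnf_eigs n_as = {l}" by (auto simp: card_1_singleton_iff)
  have all: "snd x = l" if "x \<in> set n_as" for x using l that by (auto simp: jnf_eigs_def)
  let ?len = "length n_as"
  have "jnf_blocks n_as l = mset (map fst n_as)"
    unfolding jnf_blocks_def using all by (simp add: filter_True)
  with ty l have G: "?G = partition_of (mset (map fst n_as))" by (simp add: jordan_type_def)
  obtain xs where xs: "mset xs = mset (map fst n_as)" "length xs = ?len" "\<And>i. ?G i = (if i < ?len then xs ! i else 0)"
    unfolding G by (rule partition_of_nth[of "mset (map fst n_as)"]) simp
  \<comment> \<open>The normal form lists its blocks in any order; \<open>\<pi>\<close> sends a
    block to its rank in nonincreasing order.\<close>
  from mset_eq_permutation[OF xs(1)[symmetric]] obtain \<pi> where \<pi>: "\<pi> permutes {..<length xs}" "permute_list \<pi> xs = map fst n_as" .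
  have \<pi>': "\<pi> permutes {..<?len}" using \<pi>(1) xs(2) by simp
  have s\<pi>: "fst (n_as ! b) = ?G (\<pi> b)" if b: "b < ?len" for b
  proof -
    have "fst (n_as ! b) = permute_list \<pi> xs ! b" using b \<pi>(2) by simp
    also have "\<dots> = xs ! \<pi> b" by (rule permute_list_nth[OF \<pi>(1)]) (use b xs(2) in simp)
    also have "\<dots> = ?G (\<pi> b)" using xs(3)[of "\<pi> b"] permutes_in_image[OF \<pi>', of b] b by simp
    finally show ?thesis .
  qed
  obtain ps where ps: "mset ps = D" by (metis ex_mset)
  let ?m = "length ps"
  have psp: "is_partition (ps ! i)" "psize (ps ! i) > 0" if "i < ?m" for i
    using D that unfolding ps[symmetric] by auto
  have Gsum: "?G j = (\<Sum>i<?m. (ps ! i) j)" for j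
  proof -
    have "?G j = sum_list (map (\<lambda>p. p j) ps)" unfolding psum_def ps[symmetric] by (simp flip: mset_map add: sum_mset_sum_list)
    also have "\<dots> = (\<Sum>i<?m. (ps ! i) j)" by (simp add: sum_list_sum_nth lessThan_atLeast0)
    finally show ?thesis .
  qed
  from inf obtain \<alpha> :: "nat \<Rightarrow> 'k" where \<alpha>: "inj \<alpha>" using infinite_countable_subset by blast
  define zss where "zss = map (\<lambda>b. concat (map (\<lambda>i. replicate ((ps ! i) (\<pi> b)) (l, \<alpha> i)) [0..<?m])) [0..<?len]"
  show ?thesis
  proof (rule closure_of_deformation[OF inf Ac nf, where zss = zss and F = "{0}"])
    show "map (map fst) zss = blocks_list n_as"
    proof (rule nth_equalityI)
      show "length (map (map fst) zss) = length (blocks_list n_as)" by (simp add: zss_def blocks_list_def)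
      fix b assume "b < length (map (map fst) zss)"
      then have b: "b < ?len" by (simp add: zss_def)
      have "concat (map (\<lambda>i. replicate (q i) l) [0..<k]) = replicate (\<Sum>i<k. q i) l" for q and k :: nat
        by (induct k) (simp_all add: replicate_add)
      then have "map (map fst) zss ! b = replicate (?G (\<pi> b)) l"
        using b by (simp add: zss_def map_concat o_def Gsum)
      also have "\<dots> = blocks_list n_as ! b" using b s\<pi>[OF b] all[of "n_as ! b"]
        by (simp add: blocks_list_def case_prod_unfold)
      finally show "map (map fst) zss ! b = blocks_list n_as ! b" .
    qed
    show "finite {0 :: 'k}" by simp
    fix t and B :: "'k mat"
    assume "t \<notin> {0}" and B: "B \<in> carrier_mat n n"
      and sim: "similar_mat B (diag_block_mat (map (\<lambda>zs. bidiag (map (\<lambda>(a, g). a + t * g) zs)) zss))"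
    then have t: "t \<noteq> 0" by simp
    define c where "c i = l + t * \<alpha> i" for i
    have c: "inj_on c X" for X using t \<alpha> by (auto simp: c_def inj_on_def dest: injD)
    \<comment> \<open>Runs of length 0 are dropped, since a Jordan normal form has no empty
      blocks.\<close>
    define ms where "ms b = filter (\<lambda>(s, a). s \<noteq> 0) (map (\<lambda>i. ((ps ! i) (\<pi> b), c i)) [0..<?m])" for b
    have cb: "concat (blocks_list (ms b)) = concat (map (\<lambda>i. replicate ((ps ! i) (\<pi> b)) (c i)) [0..<?m])" for b
    proof -
      have "concat (map (\<lambda>(s, a). replicate s a) (filter (\<lambda>(s, a). s \<noteq> 0) (map (\<lambda>i. (q i, c i)) ks)))
        = concat (map (\<lambda>i. replicate (q i) (c i)) ks)" for q :: "nat \<Rightarrow> nat" and ks :: "nat list"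
        by (induct ks) auto
      then show ?thesis by (simp add: blocks_list_def ms_def)
    qed
    have "map (\<lambda>zs. bidiag (map (\<lambda>(a, g). a + t * g) zs)) zss = map (\<lambda>b. bidiag (concat (blocks_list (ms b)))) [0..<?len]"
      unfolding zss_def cb by (simp add: o_def map_concat c_def)
    with sim have sim': "similar_mat B (diag_block_mat (map (\<lambda>b. bidiag (concat (blocks_list (ms b)))) [0..<?len]))"
      by simp
    let ?n_t = "concat (map ms [0..<?len])"
    have nfB: "jordan_nf B ?n_t"
    proof (rule nf_of_similar_bidiags[OF sim'])
      fix b
      have "distinct (map snd (map (\<lambda>i. ((ps ! i) (\<pi> b), c i)) [0..<?m]))"
        by (simp add: o_def distinct_map c)
      then have "distinct (map snd (ms b))" unfolding ms_def by (rule distinct_map_filter)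
      then show "distinct (map snd (ms b)) \<and> 0 \<notin> fst ` set (ms b)" by (auto simp: ms_def)
    qed
    have blkc: "blk ?n_t (c i) j = conjugate (ps ! i) j" if i: "i < ?m" for i j
    proof -
      have "blk ?n_t (c i) j = (\<Sum>b<?len. if j < (ps ! i) (\<pi> b) then 1 else 0)"
        unfolding blk_concat_upt ms_def by (intro sum.cong refl blk_single_group[OF c i])
      also have "\<dots> = (\<Sum>b<?len. if j < (ps ! i) b then 1 else 0)"
        using sum.permute[OF \<pi>', of "\<lambda>b. if j < (ps ! i) b then 1 else 0 :: nat"] by (simp add: o_def)
      also have "\<dots> = card {b. b < ?len \<and> j < (ps ! i) b}"
        by (subst sum.If_cases) (auto intro: arg_cong[of _ _ card])
      \<comment> \<open>No part is lost: beyond the number of blocks the sum of the partitions is 0,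
        hence so is each of them.\<close>
      also have "{b. b < ?len \<and> j < (ps ! i) b} = {b. j < (ps ! i) b}"
      proof -
        have "b < ?len" if jb: "j < (ps ! i) b" for b
        proof (rule ccontr)
          assume "\<not> b < ?len"
          then have "(\<Sum>i<?m. (ps ! i) b) = 0" using xs(3)[of b] Gsum[of b] by simp
          with i jb show False by simp
        qed
        then show ?thesis by auto
      qed
      finally show ?thesis by (simp add: conjugate_def)
    qed
    have eigs: "jnf_eigs ?n_t = c ` {..<?m}"
    proof (intro equalityI subsetI)
      fix a assume "a \<in> c ` {..<?m}"
      then obtain i where i: "i < ?m" "a = c i" by auto
      \<comment> \<open>A nonempty partition has a part, so every \<open>c i\<close> really occurs
        as an eigenvalue.\<close>
      have "\<exists>j. (ps ! i) j \<noteq> 0" using psp(2)[OF i(1)] unfolding psize_def by (metis (mono_tags, lifting) mem_Collect_eq not_less_zero sum.neutral)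
      then obtain j where "0 < (ps ! i) j" by auto
      then have "j < conjugate (ps ! i) 0" using conjugate_less_iff[OF psp(1)[OF i(1)]] by simp
      then have "0 < blk ?n_t a 0" using blkc[OF i(1)] i(2) by simp
      from iffD1[OF blk_pos_iff this] obtain s where "(s, a) \<in> set ?n_t" by auto
      then show "a \<in> jnf_eigs ?n_t" unfolding jnf_eigs_def by (metis imageI snd_conv)
    qed (auto simp: jnf_eigs_def ms_def)
    have "jordan_type ?n_t = image_mset (\<lambda>a. partition_of (jnf_blocks ?n_t a)) (image_mset c (mset_set {..<?m}))"
      unfolding jordan_type_def eigs image_mset_mset_set[OF c] ..
    also have "\<dots> = image_mset (\<lambda>i. partition_of (jnf_blocks ?n_t (c i))) (mset_set {..<?m})"
      by (simp add: multiset.map_comp o_def)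
    also have "\<dots> = image_mset (\<lambda>i. ps ! i) (mset_set {..<?m})"
    proof (rule image_mset_cong)
      fix i assume "i \<in># mset_set {..<?m}"
      then have i: "i < ?m" by simp
      show "partition_of (jnf_blocks ?n_t (c i)) = ps ! i"
        by (rule partition_eqI[OF partition_of_partition psp(1)[OF i]]) (simp only: blk_jnf_blocks blkc[OF i])
    qed
    also have "\<dots> = D"
      unfolding ps[symmetric] by (metis lessThan_atLeast0 map_nth mset_map mset_upt)
    finally show "B \<in> X_set n D" unfolding X_set_def using B nfB by blast
  qed
qed

section \<open>The four statements for the three families\<close>

theorem theorem2p2:
  fixes D :: "(nat \<Rightarrow> nat) multiset" and n :: nat
  assumes "alg_closed TYPE('k::field)"
    and "n \<ge> 1"
    and "\<forall>p \<in># D. is_partition p \<and> psize p > 0"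
    and "sum_mset (image_mset psize D) = n"
  defines "G \<equiv> psum D"
  defines "G' \<equiv> conjugate G"
  shows "(X_set n D \<subseteq> zariski_closure n n (S_set n G' :: 'k mat set)) \<and>
         (U_set n G \<subseteq> zariski_closure n n (X_set n D :: 'k mat set)) \<and>
         (\<forall>A \<in> (S_set n G' \<union> X_set n D \<union> U_set n G :: 'k mat set).
           mat_space_dim n n (centralizer A) = (\<Sum>i | G' i \<noteq> 0. (G' i)\<^sup>2)) \<and>
         (\<forall>d. 1 \<le> d \<and> d < n \<longrightarrow>
           (\<forall>A \<in> (S_set n G' \<union> X_set n D \<union> U_set n G :: 'k mat set).
            \<forall>B \<in> (S_set n G' \<union> X_set n D \<union> U_set n G :: 'k mat set).
              inv_grass_dim A d = inv_grass_dim B d))"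
proof -
  note inf = alg_closed_infinite[OF assms(1)]
  have X_lvls: "\<exists>n_as. A \<in> carrier_mat n n \<and> jordan_nf A n_as \<and> lvls n_as = parts G'"
    if "A \<in> X_set n D" for A :: "'k mat"
    using that lvls_conjugate unfolding X_set_def G'_def G_def by fastforce
  have lv: "\<exists>n_as. A \<in> carrier_mat n n \<and> jordan_nf A n_as \<and> lvls n_as = parts G'"
    if A: "A \<in> S_set n G' \<union> X_set n D \<union> U_set n G" for A :: "'k mat"
  proof -
    from A consider "A \<in> S_set n G'" | "A \<in> X_set n D" | "A \<in> U_set n G" by blast
    then show ?thesis
    proof cases
      case 1
      then have c: "A \<in> carrier_mat n n" "semisimple A" by (auto simp: S_set_def)
      from semisimple_nf[OF c] obtain as where as: "jordan_nf A (map (Pair 1) as)" by blast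
      from eigenspaces_lvls[OF c(1) as] 1 have "lvls (map (Pair 1) as) = parts G'" by (simp add: S_set_def)
      with c(1) as show ?thesis by blast
    next
      case 2
      then show ?thesis by (rule X_lvls)
    next
      case 3
      then obtain n_as where n_as: "A \<in> carrier_mat n n" "jordan_nf A n_as" "jordan_type n_as = {#G#}"
        by (auto simp: U_set_def)
      have "psum {#G#} = G" by (simp add: psum_def)
      with lvls_conjugate[of n_as] n_as show ?thesis by (auto simp: G'_def)
    qed
  qed
  \<comment> \<open>From here on a matrix of any of the three families enters only through the
    common multiset \<open>parts G'\<close>.\<close>
  have sim: "\<exists>ev lev S S'. jordan_similar n ev lev A S S' \<and> jordan_shape.levels n ev lev = parts G'"
    if A: "A \<in> S_set n G' \<union> X_set n D \<union> U_set n G" for A :: "'k mat"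
    using lv[OF A] jordan_similar_of_nf[OF inf, of A n] by metis
  have dimC: "mat_space_dim n n (centralizer A) = (\<Sum>i | G' i \<noteq> 0. (G' i)\<^sup>2)"
    if A: "A \<in> S_set n G' \<union> X_set n D \<union> U_set n G" for A :: "'k mat"
  proof -
    from sim[OF A] obtain ev lev S S' where js: "jordan_similar n ev lev A S S'"
      and l: "jordan_shape.levels n ev lev = parts G'" by blast
    from js have sh: "jordan_shape n ev lev" by (simp add: jordan_similar_def)
    show ?thesis
      unfolding jordan_similar.dim_centralizer[OF js] sum_levels[OF sh] l parts_def
      by (simp add: multiset.map_comp o_def sum_unfold_sum_mset)
  qed
  have dimG: "inv_grass_dim A d = Sup {enat v |v. feasible (parts G') d v}"
    if A: "A \<in> S_set n G' \<union> X_set n D \<union> U_set n G" for A :: "'k mat" and d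
  proof -
    from sim[OF A] obtain ev lev S S' where js: "jordan_similar n ev lev A S S'"
      and l: "jordan_shape.levels n ev lev = parts G'" by blast
    show ?thesis using jordan_similar.inv_grass_dim_eq[OF js, of d] unfolding l .
  qed
  have "X_set n D \<subseteq> zariski_closure n n (S_set n G' :: 'k mat set)"
    using X_lvls in_closure_S_set[OF inf] by blast
  moreover have "U_set n G \<subseteq> zariski_closure n n (X_set n D :: 'k mat set)"
    using in_closure_X_set[OF inf assms(3)] unfolding G_def by blast
  ultimately show ?thesis using dimC dimG by simp
qed

end
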